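(* For any integer $m\ge3$ and any $2\le p<\infty$ there is a constant $C=C(m,p)$ such that for every $n\ge1$ $$w_m(\ell_p^n)\le Cn^{\frac{m-3}2}\log(n+1).$$
   Context: $\ell_p^n$ is $\mathbb R^n$ with the usual $p$-norm. For a finite-dimensional real Banach space $X$ with closed unit ball $B_X$ and $f\in C(B_X)$ (continuous real-valued), let $E_m(f;B_X)=\inf_\varphi\max_{x\in B_X}|f(x)-\varphi(x)|$, the infimum over all real polynomials $\varphi$ on $X$ of total degree at most $m-1$; let $\Delta_h^m(f;x)=\sum_{j=0}^m(-1)^{m-j}\binom mj f(x+jh)$ and $\omega_m(f;B_X)=\sup|\Delta_h^m(f;x)|$, the supremum over all $x,h\in X$ with $x,x+h,\dots,x+mh\in B_X$. The Whitney constant is $w_m(X)=\sup\{E_m(f;B_X): f\in C(B_X),\ \omega_m(f;B_X)\le1\}$. *)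

theory Defs
  imports "HOL-Analysis.Analysis"
begin

text \<open>
  The constant in the theorem is uniform in the dimension, so the dimension cannot be a type.
  A finite-dimensional normed space is given by a natural number \<open>n\<close> and a norm \<open>N\<close> on
  \<open>R^n\<close>, whose elements are the sequences that vanish from index \<open>n\<close> on. On this set the product
  topology of \<^typ>\<open>nat \<Rightarrow> real\<close>, used by \<^const>\<open>continuous_on\<close>, is the topology of any norm.
\<close>

definition coord_space :: "nat \<Rightarrow> (nat \<Rightarrow> real) set" where
  "coord_space n = {x. \<forall>i\<ge>n. x i = 0}"

definition lp_norm :: "real \<Rightarrow> nat \<Rightarrow> (nat \<Rightarrow> real) \<Rightarrow> real" where
  "lp_norm p n x = (\<Sum>i<n. \<bar>x i\<bar> powr p) powr (1 / p)"

definition unit_ball :: "nat \<Rightarrow> ((nat \<Rightarrow> real) \<Rightarrow> real) \<Rightarrow> (nat \<Rightarrow> real) set" where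
  "unit_ball n N = {x \<in> coord_space n. N x \<le> 1}"

definition multi_indices :: "nat \<Rightarrow> nat \<Rightarrow> (nat \<Rightarrow> nat) set" where
  "multi_indices n d = {\<alpha>. (\<forall>i\<ge>n. \<alpha> i = 0) \<and> (\<Sum>i<n. \<alpha> i) \<le> d}"

definition polynomials :: "nat \<Rightarrow> nat \<Rightarrow> ((nat \<Rightarrow> real) \<Rightarrow> real) set" where
  "polynomials n d =
    {\<phi>. \<exists>c :: (nat \<Rightarrow> nat) \<Rightarrow> real.
          \<phi> = (\<lambda>x. \<Sum>\<alpha>\<in>multi_indices n d. c \<alpha> * (\<Prod>i<n. x i ^ \<alpha> i))}"

text \<open>
  Suprema and infima are taken in \<^typ>\<open>ereal\<close>, so that an upper bound includes finiteness. For
  continuous \<open>f\<close> the inner supremum below is the maximum, as the unit ball of a norm is compact.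
\<close>

definition best_approx ::
  "nat \<Rightarrow> nat \<Rightarrow> ((nat \<Rightarrow> real) \<Rightarrow> real) \<Rightarrow> ((nat \<Rightarrow> real) \<Rightarrow> real) \<Rightarrow> ereal" where
  "best_approx m n N f =
    (INF \<phi>\<in>polynomials n (m - 1). SUP x\<in>unit_ball n N. ereal \<bar>f x - \<phi> x\<bar>)"

definition finite_difference ::
  "nat \<Rightarrow> (nat \<Rightarrow> real) \<Rightarrow> ((nat \<Rightarrow> real) \<Rightarrow> real) \<Rightarrow> (nat \<Rightarrow> real) \<Rightarrow> real" where
  "finite_difference m h f x =
    (\<Sum>j\<le>m. (- 1) ^ (m - j) * real (m choose j) * f (\<lambda>i. x i + real j * h i))"

definition modulus_of_smoothness ::
  "nat \<Rightarrow> nat \<Rightarrow> ((nat \<Rightarrow> real) \<Rightarrow> real) \<Rightarrow> ((nat \<Rightarrow> real) \<Rightarrow> real) \<Rightarrow> ereal" where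
  "modulus_of_smoothness m n N f =
    (SUP (x, h) \<in> {(x, h). x \<in> coord_space n \<and> h \<in> coord_space n \<and>
                      (\<forall>j\<le>m. (\<lambda>i. x i + real j * h i) \<in> unit_ball n N)}.
       ereal \<bar>finite_difference m h f x\<bar>)"

definition whitney_constant :: "nat \<Rightarrow> nat \<Rightarrow> ((nat \<Rightarrow> real) \<Rightarrow> real) \<Rightarrow> ereal" where
  "whitney_constant m n N =
    (SUP f \<in> {f. continuous_on (unit_ball n N) f \<and> modulus_of_smoothness m n N f \<le> 1}.
       best_approx m n N f)"

end

theory Submission
  imports Defs "HOL-Probability.Probability" "HOL-Library.Function_Algebras"
begin

text \<open>
  Let \<open>f\<close> have bounded differences of order \<open>m = k + 1\<close>. Pure differences control mixed ones
  (\<open>mixed_diff_bound\<close>), so the mixed difference of order \<open>k\<close> at the origin is, up to a bounded error,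
  additive in each of its \<open>k\<close> arguments. The core of the proof is to replace it by a genuine
  \<open>k\<close>-linear form \<open>M\<close> (\<open>multilinear_constant_exists\<close>). Then \<open>M (x, ..., x) / k!\<close> is the part of degree
  \<open>k\<close> of the approximating polynomial, and the parts of lower degree follow by induction
  (\<open>local_whitney_Suc\<close>).

  The induction must not feed the error of the multilinear approximation back into the smoothness bound,
  since the errors of the different degrees would multiply. Therefore one subtracts from \<open>f\<close> not the
  polynomial but an exactly homogeneous function of degree \<open>k\<close> that is close to the leading part of \<open>f\<close>
  up to a dimension-free constant, and the remainder has differences of order \<open>k\<close> bounded by a
  dimension-free constant (\<open>smooth_bound_remainder\<close>). The errors of the degrees then add up. All this
  happens on a ball of a smaller radius, independent of the dimension; finitely many extrapolations lead
  back to the unit ball.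

  The multilinear approximation starts with \<open>k = 1\<close> and \<open>k = 2\<close>, where the error is of order
  \<open>ln (n + 1)\<close>. By duality (\<open>best_approximation_duality\<close>) and Caratheodory's theorem it suffices to
  consider at most \<open>n + 1\<close> vectors with a vanishing combination, or at most \<open>n\<^sup>2 + 1\<close> pairs of vectors with a vanishing
  combination of tensor products. Vectors are summed along a balanced binary tree, whose depth is of
  order \<open>ln (n + 1)\<close>; each level contributes a bounded error. For pairs, one sums Gaussian multiples of the
  vectors: since \<open>l_p\<close> with \<open>p \<ge> 2\<close> has type 2 (\<open>gaussian_type_2\<close>), each level again contributes a
  bounded error, and at the root one finds two Gaussian vectors without correlation, which are independent, so
  that an odd function of them has mean zero (\<open>gaussian_uncorrelated_vanishes\<close>).

  Each further argument costs a factor \<open>sqrt n\<close> (\<open>multilinear_constant_Suc\<close>): a unit vector is a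
  combination of normalised sign vectors with total weight at most \<open>sqrt n\<close>, and the form is defined at
  these by the case of one argument less. For \<open>k = m - 1\<close> this is
  \<open>n powr ((m - 3) / 2) * ln (n + 1)\<close>.
\<close>

text \<open>
  The vectors are functions \<open>nat \<Rightarrow> real\<close>. With pointwise operations they form a real vector space, so that
  sums and multiples of vectors can be written, and computed with, as in any other such space.
\<close>
instantiation "fun" :: (type, real_vector) real_vector
begin
definition scaleR_fun :: "real \<Rightarrow> ('a \<Rightarrow> 'b) \<Rightarrow> 'a \<Rightarrow> 'b"
  where "scaleR_fun c f = (\<lambda>x. c *\<^sub>R f x)"
instance
  by standard (simp_all add: scaleR_fun_def fun_eq_iff scaleR_add_right scaleR_add_left)
end

lemma scaleR_fun_apply [simp]: "(c *\<^sub>R f) x = c *\<^sub>R f x"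
  by (simp add: scaleR_fun_def)

lemma sum_fun_apply [simp]: "(\<Sum>i\<in>A. f i) x = (\<Sum>i\<in>A. f i x)"
  by (induction A rule: infinite_finite_induct) auto

section \<open>Duality for uniform approximation\<close>
text \<open>
  Split \<open>A\<close> into two halves, those into halves again, and so on. The sets of one level of this binary
  tree are disjoint, so all the errors of a level add up to at most \<open>c * w A\<close>, and there are \<open>d\<close> levels.
  All the logarithms in this theory come from here.
\<close>
lemma quasi_additive_tree:
  fixes H w :: "'a set \<Rightarrow> real" and c :: real
  assumes add: "\<And>S T. S \<subseteq> A \<Longrightarrow> T \<subseteq> A \<Longrightarrow> S \<inter> T = {} \<Longrightarrow> \<bar>H (S \<union> T) - H S - H T\<bar> \<le> c * w (S \<union> T)"
    and w: "\<And>S T. S \<subseteq> A \<Longrightarrow> T \<subseteq> A \<Longrightarrow> S \<inter> T = {} \<Longrightarrow> w (S \<union> T) = w S + w T"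
    and "H {} = 0" "finite A" "card A \<le> 2 ^ d" "c \<ge> 0" "\<And>S. w S \<ge> 0"
  shows "\<bar>H A - (\<Sum>i\<in>A. H {i})\<bar> \<le> c * real d * w A"
proof -
  have "\<bar>H B - (\<Sum>i\<in>B. H {i})\<bar> \<le> c * real d * w B" if "B \<subseteq> A" "card B \<le> 2 ^ d" for B
    using that
  proof (induction d arbitrary: B)
    case 0
    have fB: "finite B" using 0 \<open>finite A\<close> finite_subset by blast
    have "card B = 0 \<or> card B = 1" using 0 by (simp add: le_Suc_eq)
    then show ?case
    proof
      assume "card B = 0" then show ?thesis using fB \<open>H {} = 0\<close> by simp
    next
      assume "card B = 1" then obtain b where "B = {b}" using card_1_singletonE by blast
      then show ?thesis by simp
    qed
  next
    case (Suc d)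
    have fB: "finite B" using Suc \<open>finite A\<close> finite_subset by blast
    have "min (2^d) (card B) \<le> card B" by simp
    then obtain S where S: "S \<subseteq> B" "card S = min (2^d) (card B)" "finite S"
      using obtain_subset_with_card_n by metis
    let ?T = "B - S"
    have "card ?T = card B - card S" using S by (simp add: card_Diff_subset)
    moreover have "card B \<le> 2^d + 2^d" using Suc.prems by simp
    ultimately have cT: "card ?T \<le> 2^d" unfolding S(2) by linarith
    have sub: "S \<subseteq> A" "?T \<subseteq> A" "S \<inter> ?T = {}" "S \<union> ?T = B" using S Suc.prems by auto
    have 1: "\<bar>H S - (\<Sum>i\<in>S. H {i})\<bar> \<le> c * real d * w S" using S(2) by (intro Suc.IH sub(1)) simp
    have 2: "\<bar>H ?T - (\<Sum>i\<in>?T. H {i})\<bar> \<le> c * real d * w ?T" by (intro Suc.IH sub(2) cT)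
    have 3: "\<bar>H B - H S - H ?T\<bar> \<le> c * w B" using add[OF sub(1-3)] unfolding sub(4) .
    have 4: "(\<Sum>i\<in>B. H {i}) = (\<Sum>i\<in>S. H {i}) + (\<Sum>i\<in>?T. H {i})"
      using sum.subset_diff[OF S(1) fB, of "\<lambda>i. H {i}"] by simp
    have 5: "w B = w S + w ?T" using w[OF sub(1-3)] unfolding sub(4) .
    have "\<bar>H B - (\<Sum>i\<in>B. H {i})\<bar> \<le> c * w B + c * real d * w S + c * real d * w ?T"
      using 1 2 3 4 by linarith
    also have "\<dots> = c * real (Suc d) * w B" using 5 by (simp add: algebra_simps)
    finally show ?case .
  qed
  from this[OF subset_refl] show ?thesis using \<open>card A \<le> 2 ^ d\<close> .
qed

text \<open>
  Gaussian elimination: one equation with a nonzero coefficient is used to remove one unknown.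
\<close>
lemma underdetermined_system_nontrivial:
  fixes v :: "'a \<Rightarrow> 'j \<Rightarrow> real"
  assumes "finite J" "finite A" "card J < card A"
  shows "\<exists>z. (\<exists>s\<in>A. z s \<noteq> 0) \<and> (\<forall>s. s \<notin> A \<longrightarrow> z s = 0) \<and> (\<forall>j\<in>J. (\<Sum>s\<in>A. z s * v s j) = 0)"
  using assms
proof (induction J arbitrary: A v rule: finite_induct)
  case empty
  then obtain s where "s \<in> A" by fastforce
  then show ?case by (intro exI[of _ "\<lambda>t. if t = s then 1 else 0"]) auto
next
  case (insert j J)
  show ?case
  proof (cases "\<forall>s\<in>A. v s j = 0")
    case True
    have "card J < card A" using insert(1,2,5) by simp
    then obtain z where "\<exists>s\<in>A. z s \<noteq> 0" "\<forall>s. s \<notin> A \<longrightarrow> z s = 0" "\<forall>k\<in>J. (\<Sum>s\<in>A. z s * v s k) = 0"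
      using insert.IH[of A v] insert(4) by metis
    with True show ?thesis by (intro exI[of _ z]) simp
  next
    case False
    then obtain s0 where s0: "s0 \<in> A" "v s0 j \<noteq> 0" by blast
    define v' where "v' s k = v s k - v s j / v s0 j * v s0 k" for s k
    have "card J < card (A - {s0})" using insert(1,2,4,5) s0 by simp
    moreover have "finite (A - {s0})" using insert(4) by simp
    ultimately obtain z where
      z: "\<exists>s\<in>A-{s0}. z s \<noteq> 0" "\<forall>s. s \<notin> A-{s0} \<longrightarrow> z s = 0"
         "\<forall>k\<in>J. (\<Sum>s\<in>A-{s0}. z s * v' s k) = 0"
      using insert.IH[of "A - {s0}" v'] by metis
    define c where "c = - (\<Sum>s\<in>A-{s0}. z s * v s j) / v s0 j"
    define y where "y = z(s0 := c)"
    have sum_y: "(\<Sum>s\<in>A. y s * v s k) = c * v s0 k + (\<Sum>s\<in>A-{s0}. z s * v s k)" for k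
      using s0 insert(4) by (subst sum.remove[of A s0]) (auto simp: y_def intro!: sum.cong)
    have "(\<Sum>s\<in>A. y s * v s j) = 0" using s0 by (simp add: sum_y c_def)
    moreover have "(\<Sum>s\<in>A. y s * v s k) = 0" if "k \<in> J" for k
    proof -
      have "0 = (\<Sum>s\<in>A-{s0}. z s * v' s k)" using z that by simp
      also have "\<dots> = (\<Sum>s\<in>A-{s0}. z s * v s k - z s * v s j * (v s0 k / v s0 j))"
        by (rule sum.cong) (auto simp: v'_def algebra_simps)
      also have "\<dots> = (\<Sum>s\<in>A-{s0}. z s * v s k) - (\<Sum>s\<in>A-{s0}. z s * v s j) * (v s0 k / v s0 j)"
        by (simp only: sum_subtractf sum_distrib_right)
      also have "\<dots> = (\<Sum>s\<in>A. y s * v s k)" by (simp add: sum_y c_def)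
      finally show ?thesis by simp
    qed
    moreover have "\<exists>s\<in>A. y s \<noteq> 0" using z(1) by (auto simp: y_def)
    moreover have "\<forall>s. s \<notin> A \<longrightarrow> y s = 0" using z(2) s0 by (auto simp: y_def)
    ultimately show ?thesis by (intro exI[of _ y]) auto
  qed
qed

text \<open>
  This is Caratheodory's theorem for annihilators: a vector \<open>a\<close> of the kernel with a large support lies
  between two kernel vectors with smaller supports, with the same signs and the same total variation,
  on a line along which the left-hand side is linear.
\<close>
lemma annihilator_bound_by_small_supports:
  fixes v :: "'a \<Rightarrow> 'j \<Rightarrow> real" and D :: "'a \<Rightarrow> real"
  assumes J: "finite J"
    and small: "\<And>A a. A \<subseteq> S \<Longrightarrow> finite A \<Longrightarrow> card A \<le> Suc (card J) \<Longrightarrow>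
        (\<forall>j\<in>J. (\<Sum>s\<in>A. a s * v s j) = 0) \<Longrightarrow> \<bar>\<Sum>s\<in>A. a s * D s\<bar> \<le> c * (\<Sum>s\<in>A. \<bar>a s\<bar>)"
    and A: "finite A" "A \<subseteq> S" and a: "\<forall>j\<in>J. (\<Sum>s\<in>A. a s * v s j) = 0"
  shows "\<bar>\<Sum>s\<in>A. a s * D s\<bar> \<le> c * (\<Sum>s\<in>A. \<bar>a s\<bar>)"
  using A a
proof (induction "card {s\<in>A. a s \<noteq> 0}" arbitrary: A a rule: less_induct)
  case less
  define B where "B = {s\<in>A. a s \<noteq> 0}"
  have B: "finite B" "B \<subseteq> S" "B \<subseteq> A" using less by (auto simp: B_def)
  have red: "(\<Sum>s\<in>A. a s * f s) = (\<Sum>s\<in>B. a s * f s)" for f :: "'a \<Rightarrow> real"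
    using less by (intro sum.mono_neutral_right) (auto simp: B_def)
  have red1: "(\<Sum>s\<in>A. \<bar>a s\<bar>) = (\<Sum>s\<in>B. \<bar>a s\<bar>)"
    using less by (intro sum.mono_neutral_right) (auto simp: B_def)
  show ?case
  proof (cases "card B \<le> Suc (card J)")
    case True
    then show ?thesis using small[of B a] B less(4) by (simp add: red red1)
  next
    case False
    (* One equation more than needed for the kernel: it keeps the total variation constant
       along the line a + t z. *)
    define v' where "v' s k = (case k of None \<Rightarrow> sgn (a s) | Some j \<Rightarrow> v s j)" for s k
    have fJ: "finite (insert None (Some ` J))" using J by simp
    have cJ: "card (insert None (Some ` J)) = Suc (card J)" using J by (subst card_insert_disjoint) (auto simp: card_image)
    from underdetermined_system_nontrivial[OF fJ B(1), of v'] False cJ obtain z where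
      z: "\<exists>s\<in>B. z s \<noteq> 0" "\<forall>j\<in>J. (\<Sum>s\<in>B. z s * v s j) = 0" "(\<Sum>s\<in>B. z s * sgn (a s)) = 0"
      by (fastforce simp: v'_def)
    define r where "r s = z s / a s" for s
    have nz: "a s \<noteq> 0" if "s \<in> B" for s using that by (simp add: B_def)
    have sgnz: "z s * sgn (a s) = r s * \<bar>a s\<bar>" if "s \<in> B" for s
      using nz[OF that] by (auto simp: r_def sgn_if)
    have sr: "(\<Sum>s\<in>B. r s * \<bar>a s\<bar>) = 0" using z(3) sgnz by simp
    have "\<exists>s\<in>B. r s < 0"
    proof (rule ccontr)
      assume "\<not> ?thesis"
      then have "\<forall>s\<in>B. r s * \<bar>a s\<bar> \<ge> 0" by (auto simp: not_less)
      then have "\<forall>s\<in>B. r s * \<bar>a s\<bar> = 0"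
        using sr B(1) sum_nonneg_eq_0_iff[of B "\<lambda>s. r s * \<bar>a s\<bar>"] by simp
      then show False using z nz by (auto simp: r_def)
    qed
    moreover have "\<exists>s\<in>B. r s > 0"
    proof (rule ccontr)
      assume "\<not> ?thesis"
      then have "\<forall>s\<in>B. - (r s * \<bar>a s\<bar>) \<ge> 0" by (auto simp: mult_nonpos_nonneg not_less)
      then have "\<forall>s\<in>B. - (r s * \<bar>a s\<bar>) = 0"
        using sr B(1) sum_nonneg_eq_0_iff[of B "\<lambda>s. - (r s * \<bar>a s\<bar>)"] by (simp add: sum_negf)
      then show False using z nz by (auto simp: r_def)
    qed
    moreover have Bne: "B \<noteq> {}" using z by auto
    ultimately have rmin: "Min (r ` B) < 0" and rmax: "Max (r ` B) > 0"
      using B(1) by (auto simp: Min_less_iff Max_gr_iff)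
    let ?lo = "Min (r ` B)" and ?hi = "Max (r ` B)"
    have endpt: "\<bar>\<Sum>s\<in>B. (a s + t * z s) * D s\<bar> \<le> c * (\<Sum>s\<in>B. \<bar>a s\<bar>)"
      if t: "\<forall>s\<in>B. 0 \<le> 1 + t * r s" and t0: "\<exists>s\<in>B. 1 + t * r s = 0" for t
    proof -
      have fac: "a s + t * z s = a s * (1 + t * r s)" if "s \<in> B" for s
        using nz[OF that] by (simp add: r_def field_simps)
      obtain s0 where "s0 \<in> B" "a s0 + t * z s0 = 0" using t0 fac by force
      then have "{s\<in>B. a s + t * z s \<noteq> 0} \<subset> B" by blast
      then have "card {s\<in>B. a s + t * z s \<noteq> 0} < card B" using B(1) by (rule psubset_card_mono[rotated])
      then have "\<bar>\<Sum>s\<in>B. (a s + t * z s) * D s\<bar> \<le> c * (\<Sum>s\<in>B. \<bar>a s + t * z s\<bar>)"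
        using less(1)[of B "\<lambda>s. a s + t * z s"] B less(4) z(2)
        by (simp add: B_def[symmetric] algebra_simps sum.distrib red flip: sum_distrib_left)
      also have "(\<Sum>s\<in>B. \<bar>a s + t * z s\<bar>) = (\<Sum>s\<in>B. \<bar>a s\<bar> + t * (r s * \<bar>a s\<bar>))"
      proof (intro sum.cong refl)
        fix s assume s: "s \<in> B"
        have "\<bar>a s + t * z s\<bar> = \<bar>a s\<bar> * (1 + t * r s)"
          using t s unfolding fac[OF s] abs_mult by simp
        then show "\<bar>a s + t * z s\<bar> = \<bar>a s\<bar> + t * (r s * \<bar>a s\<bar>)" by (simp add: algebra_simps)
      qed
      also have "\<dots> = (\<Sum>s\<in>B. \<bar>a s\<bar>)"
        using sr by (simp add: sum.distrib flip: sum_distrib_left)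
      finally show ?thesis .
    qed
    (* The parameters at which the first coefficient vanishes, in either direction. *)
    define t1 where "t1 = - 1 / ?lo"
    define t2 where "t2 = - 1 / ?hi"
    have t1: "t1 > 0" and t2: "t2 < 0" using rmin rmax by (auto simp: t1_def t2_def divide_simps)
    have mem: "?lo \<in> r ` B" "?hi \<in> r ` B" using B Bne by auto
    have bd: "?lo \<le> r s" "r s \<le> ?hi" if "s \<in> B" for s using B that by auto
    have e1: "\<bar>\<Sum>s\<in>B. (a s + t1 * z s) * D s\<bar> \<le> c * (\<Sum>s\<in>B. \<bar>a s\<bar>)"
    proof (rule endpt)
      show "\<forall>s\<in>B. 0 \<le> 1 + t1 * r s"
      proof
        fix s assume "s \<in> B"
        then have "t1 * ?lo \<le> t1 * r s" using bd t1 by (intro mult_left_mono) auto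
        then show "0 \<le> 1 + t1 * r s" using rmin by (simp add: t1_def)
      qed
      show "\<exists>s\<in>B. 1 + t1 * r s = 0" using mem(1) rmin by (auto simp: t1_def)
    qed
    have e2: "\<bar>\<Sum>s\<in>B. (a s + t2 * z s) * D s\<bar> \<le> c * (\<Sum>s\<in>B. \<bar>a s\<bar>)"
    proof (rule endpt)
      show "\<forall>s\<in>B. 0 \<le> 1 + t2 * r s"
      proof
        fix s assume "s \<in> B"
        then have "t2 * ?hi \<le> t2 * r s" using bd t2 by (intro mult_left_mono_neg) auto
        then show "0 \<le> 1 + t2 * r s" using rmax by (simp add: t2_def)
      qed
      show "\<exists>s\<in>B. 1 + t2 * r s = 0" using mem(2) rmax by (auto simp: t2_def)
    qed
    define P where "P = (\<Sum>s\<in>B. a s * D s)"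
    define Q where "Q = (\<Sum>s\<in>B. z s * D s)"
    have lin: "(\<Sum>s\<in>B. (a s + t * z s) * D s) = P + t * Q" for t
      by (simp add: P_def Q_def algebra_simps sum.distrib sum_distrib_left)
    have "\<bar>P\<bar> \<le> c * (\<Sum>s\<in>B. \<bar>a s\<bar>)"
    proof (cases "Q \<ge> 0")
      case True
      have "t1 * Q \<ge> 0" "t2 * Q \<le> 0" using True t1 t2 by (auto simp: mult_nonpos_nonneg)
      then show ?thesis using e1 e2 by (simp add: lin)
    next
      case False
      have "t1 * Q \<le> 0" "t2 * Q \<ge> 0" using False t1 t2 by (auto simp: mult_nonneg_nonpos mult_nonpos_nonpos)
      then show ?thesis using e1 e2 by (simp add: lin)
    qed
    then show ?thesis by (simp add: P_def red red1)
  qed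
qed

text \<open>
  This is the Hahn-Banach theorem for the uniform distance from \<open>D\<close> to the span of finitely many
  functions: an obstruction to approximation within \<open>c\<close> is a finite combination of point evaluations
  that annihilates the span. The functions are adjoined one at a time. The coefficient of a new function has to
  lie in a family of intervals, which pairwise intersect because the difference of two annihilators of
  the old functions, normalised on the new one, annihilates all of them.
\<close>
lemma best_approximation_duality:
  fixes v :: "'a \<Rightarrow> 'j \<Rightarrow> real" and D :: "'a \<Rightarrow> real"
  assumes "finite J" "c \<ge> 0"
    and "\<And>A a. A \<subseteq> S \<Longrightarrow> finite A \<Longrightarrow> (\<forall>j\<in>J. (\<Sum>s\<in>A. a s * v s j) = 0)
        \<Longrightarrow> \<bar>\<Sum>s\<in>A. a s * D s\<bar> \<le> c * (\<Sum>s\<in>A. \<bar>a s\<bar>)"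
  shows "\<exists>b. \<forall>s\<in>S. \<bar>D s - (\<Sum>j\<in>J. b j * v s j)\<bar> \<le> c"
  using assms(1,3)
proof (induction J arbitrary: D rule: finite_induct)
  case empty
  have "\<bar>D s\<bar> \<le> c" if "s \<in> S" for s using empty[of "{s}" "\<lambda>_. 1"] that by simp
  then show ?case by simp
next
  case (insert j J)
  define X where "X = {(A, a). A \<subseteq> S \<and> finite A \<and> (\<forall>k\<in>J. (\<Sum>s\<in>A. a s * v s k) = 0) \<and> (\<Sum>s\<in>A. a s * v s j) = 1}"
  define lo where "lo = (\<lambda>(A, a). (\<Sum>s\<in>A. a s * D s) - c * (\<Sum>s\<in>A. \<bar>a s :: real\<bar>))"
  define hi where "hi = (\<lambda>(A, a). (\<Sum>s\<in>A. a s * D s) + c * (\<Sum>s\<in>A. \<bar>a s :: real\<bar>))"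
  (* The difference of two admissible combinations annihilates the new function as well. *)
  have lohi: "lo x \<le> hi y" if x: "x \<in> X" and y: "y \<in> X" for x y
  proof -
    obtain A a B b where [simp]: "x = (A, a)" "y = (B, b)" by (cases x, cases y) auto
    define e where "e s = (if s \<in> A then a s else 0) - (if s \<in> B then b s else 0)" for s
    have fin: "finite A" "finite B" "A \<subseteq> S" "B \<subseteq> S" using x y by (auto simp: X_def)
    have se: "(\<Sum>s\<in>A\<union>B. e s * f s) = (\<Sum>s\<in>A. a s * f s) - (\<Sum>s\<in>B. b s * f s)" for f :: "'a \<Rightarrow> real"
    proof -
      have "(\<Sum>s\<in>A. a s * f s) = (\<Sum>s\<in>A\<union>B. (if s \<in> A then a s else 0) * f s)"
        using fin by (intro sum.mono_neutral_cong_left) auto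
      moreover have "(\<Sum>s\<in>B. b s * f s) = (\<Sum>s\<in>A\<union>B. (if s \<in> B then b s else 0) * f s)"
        using fin by (intro sum.mono_neutral_cong_left) auto
      ultimately show ?thesis by (simp add: e_def left_diff_distrib sum_subtractf)
    qed
    have "(\<Sum>s\<in>A\<union>B. \<bar>e s\<bar>) \<le> (\<Sum>s\<in>A\<union>B. \<bar>if s \<in> A then a s else 0\<bar>) + (\<Sum>s\<in>A\<union>B. \<bar>if s \<in> B then b s else 0\<bar>)"
      unfolding sum.distrib[symmetric] by (intro sum_mono) (auto simp: e_def)
    also have "(\<Sum>s\<in>A\<union>B. \<bar>if s \<in> A then a s else 0\<bar>) = (\<Sum>s\<in>A. \<bar>a s\<bar>)"
      using fin by (intro sum.mono_neutral_cong_right) auto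
    also have "(\<Sum>s\<in>A\<union>B. \<bar>if s \<in> B then b s else 0\<bar>) = (\<Sum>s\<in>B. \<bar>b s\<bar>)"
      using fin by (intro sum.mono_neutral_cong_right) auto
    finally have ab: "c * (\<Sum>s\<in>A\<union>B. \<bar>e s\<bar>) \<le> c * (\<Sum>s\<in>A. \<bar>a s\<bar>) + c * (\<Sum>s\<in>B. \<bar>b s\<bar>)"
      using \<open>c \<ge> 0\<close> by (metis distrib_left mult_left_mono)
    have "\<bar>\<Sum>s\<in>A\<union>B. e s * D s\<bar> \<le> c * (\<Sum>s\<in>A\<union>B. \<bar>e s\<bar>)"
      using fin x y by (intro insert.prems) (auto simp: se X_def)
    then show ?thesis using ab by (simp add: se lo_def hi_def)
  qed
  obtain \<beta> where \<beta>: "\<And>x. x \<in> X \<Longrightarrow> lo x \<le> \<beta> \<and> \<beta> \<le> hi x"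
  proof (cases "X = {}")
    case True then show ?thesis using that by blast
  next
    case False
    then obtain y where y: "y \<in> X" by blast
    have "bdd_above (lo ` X)" using lohi[OF _ y] by (intro bdd_aboveI[of _ "hi y"]) blast
    then have "lo x \<le> Sup (lo ` X)" if "x \<in> X" for x using that by (intro cSup_upper) auto
    moreover have "Sup (lo ` X) \<le> hi x" if "x \<in> X" for x
      using False lohi[OF _ that] by (intro cSup_least) blast+
    ultimately show ?thesis using that by blast
  qed
  have "\<exists>b. \<forall>s\<in>S. \<bar>(D s - \<beta> * v s j) - (\<Sum>k\<in>J. b k * v s k)\<bar> \<le> c"
  proof (rule insert.IH)
    fix A a assume A: "A \<subseteq> S" "finite A" "\<forall>k\<in>J. (\<Sum>s\<in>A. a s * v s k) = 0"
    define t where "t = (\<Sum>s\<in>A. a s * v s j)"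
    have expand: "(\<Sum>s\<in>A. a s * (D s - \<beta> * v s j)) = (\<Sum>s\<in>A. a s * D s) - \<beta> * t"
      by (simp add: t_def right_diff_distrib sum_subtractf sum_distrib_left mult.left_commute)
    show "\<bar>\<Sum>s\<in>A. a s * (D s - \<beta> * v s j)\<bar> \<le> c * (\<Sum>s\<in>A. \<bar>a s\<bar>)"
    proof (cases "t = 0")
      case True
      then show ?thesis using insert.prems[OF A(1,2), of a] A(3) by (simp add: expand) (simp add: t_def)
    next
      case False
      let ?a = "\<lambda>s. a s / t"
      have sc: "(\<Sum>s\<in>A. ?a s * f s) = (\<Sum>s\<in>A. a s * f s) / t" for f :: "'a \<Rightarrow> real"
        by (simp add: sum_divide_distrib)
      have sa: "(\<Sum>s\<in>A. \<bar>?a s\<bar>) = (\<Sum>s\<in>A. \<bar>a s\<bar>) / \<bar>t\<bar>" by (simp add: sum_divide_distrib abs_divide)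
      have "(A, ?a) \<in> X" using A False unfolding X_def mem_Collect_eq prod.case sc by (simp flip: t_def)
      from \<beta>[OF this] have "\<bar>(\<Sum>s\<in>A. a s * D s) / t - \<beta>\<bar> \<le> c * ((\<Sum>s\<in>A. \<bar>a s\<bar>) / \<bar>t\<bar>)"
        unfolding lo_def hi_def prod.case sc sa by linarith
      then have "\<bar>t\<bar> * \<bar>(\<Sum>s\<in>A. a s * D s) / t - \<beta>\<bar> \<le> \<bar>t\<bar> * (c * ((\<Sum>s\<in>A. \<bar>a s\<bar>) / \<bar>t\<bar>))"
        by (intro mult_left_mono) auto
      also have "\<bar>t\<bar> * \<bar>(\<Sum>s\<in>A. a s * D s) / t - \<beta>\<bar> = \<bar>(\<Sum>s\<in>A. a s * D s) - \<beta> * t\<bar>"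
        using False by (simp add: abs_mult[symmetric] right_diff_distrib mult.commute)
      also have "\<bar>t\<bar> * (c * ((\<Sum>s\<in>A. \<bar>a s\<bar>) / \<bar>t\<bar>)) = c * (\<Sum>s\<in>A. \<bar>a s\<bar>)" using False by simp
      finally show ?thesis by (simp add: expand)
    qed
  qed
  then obtain b where b: "\<forall>s\<in>S. \<bar>(D s - \<beta> * v s j) - (\<Sum>k\<in>J. b k * v s k)\<bar> \<le> c" by blast
  have "(\<Sum>k\<in>insert j J. (b(j := \<beta>)) k * v s k) = \<beta> * v s j + (\<Sum>k\<in>J. b k * v s k)" for s
  proof -
    have "(\<Sum>k\<in>J. (b(j := \<beta>)) k * v s k) = (\<Sum>k\<in>J. b k * v s k)"
      using insert(2) by (intro sum.cong) auto
    then show ?thesis using insert(1,2) by simp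
  qed
  then show ?case using b by (intro exI[of _ "b(j := \<beta>)"]) (simp add: algebra_simps)
qed

section \<open>Gaussian vectors and their symmetries\<close>
definition gaussian :: "'i set \<Rightarrow> ('i \<Rightarrow> real) measure" where
  "gaussian A = density (Pi\<^sub>M A (\<lambda>_. lborel)) (\<lambda>w. \<Prod>i\<in>A. std_normal_density (w i))"

lemma sets_gaussian [measurable_cong]: "sets (gaussian A) = sets (Pi\<^sub>M A (\<lambda>_. lborel))"
  by (simp add: gaussian_def)

lemma space_gaussian: "space (gaussian A) = space (Pi\<^sub>M A (\<lambda>_. lborel))"
  by (simp add: gaussian_def)

lemma measurable_gaussian_component [measurable]:
  "i \<in> A \<Longrightarrow> (\<lambda>w. w i) \<in> borel_measurable (gaussian A)"
  by measurable

interpretation lborel_prod: product_sigma_finite "\<lambda>_::'i. lborel :: real measure"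
  by standard

lemma measurable_update_component:
  assumes "i \<in> A" "h \<in> borel_measurable (Pi\<^sub>M A (\<lambda>_. lborel :: real measure))"
  shows "(\<lambda>w. w(i := h w)) \<in> Pi\<^sub>M A (\<lambda>_. lborel) \<rightarrow>\<^sub>M Pi\<^sub>M A (\<lambda>_. lborel)"
proof (rule measurable_PiM_single')
  fix k assume "k \<in> A"
  show "(\<lambda>w. (w(i := h w)) k) \<in> Pi\<^sub>M A (\<lambda>_. lborel) \<rightarrow>\<^sub>M lborel"
  proof (cases "k = i")
    case True then show ?thesis using assms by simp
  next
    case False then show ?thesis using \<open>k \<in> A\<close> by simp
  qed
qed (use assms in \<open>auto simp: space_PiM PiE_def extensional_def\<close>)

text \<open>
  In the coordinate \<open>i\<close>, with all others fixed, the map is a translation or a reflection; integrate this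
  coordinate first.
\<close>
lemma distr_PiM_lborel_shear:
  fixes t :: "('i \<Rightarrow> real) \<Rightarrow> real" and c :: real
  assumes A: "finite A" "i \<in> A" and c: "\<bar>c\<bar> = 1"
    and t: "t \<in> borel_measurable (Pi\<^sub>M A (\<lambda>_. lborel))" "\<And>w y. t (w(i := y)) = t w"
  defines "T \<equiv> \<lambda>w. w(i := c * w i + t w)"
  shows "T \<in> Pi\<^sub>M A (\<lambda>_. lborel) \<rightarrow>\<^sub>M Pi\<^sub>M A (\<lambda>_. lborel)"
    and "distr (Pi\<^sub>M A (\<lambda>_. lborel)) (Pi\<^sub>M A (\<lambda>_. lborel)) T = Pi\<^sub>M A (\<lambda>_. lborel)"
proof -
  let ?L = "Pi\<^sub>M A (\<lambda>_. lborel :: real measure)"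
  have "(\<lambda>w. c * w i + t w) \<in> borel_measurable ?L" using A t by measurable
  from measurable_update_component[OF A(2) this]
  show T [measurable]: "T \<in> ?L \<rightarrow>\<^sub>M ?L" by (simp add: T_def)
  define I where "I = A - {i}"
  have I: "finite I" "i \<notin> I" "insert i I = A" using A by (auto simp: I_def)
  have inv: "(\<integral>\<^sup>+w. f (T w) \<partial>?L) = (\<integral>\<^sup>+w. f w \<partial>?L)" if f: "f \<in> borel_measurable ?L" for f
  proof -
    have fT: "(\<lambda>w. f (T w)) \<in> borel_measurable (Pi\<^sub>M (insert i I) (\<lambda>_. lborel))" using f T I(3) by simp
    have fI: "f \<in> borel_measurable (Pi\<^sub>M (insert i I) (\<lambda>_. lborel))" using f I(3) by simp
    have "(\<integral>\<^sup>+w. f (T w) \<partial>?L) = (\<integral>\<^sup>+ x. (\<integral>\<^sup>+ y. f (T (x(i := y))) \<partial>lborel) \<partial>(Pi\<^sub>M I (\<lambda>_. lborel)))"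
      using lborel_prod.product_nn_integral_insert[OF I(1,2) fT] I(3) by simp
    also have "\<dots> = (\<integral>\<^sup>+ x. (\<integral>\<^sup>+ y. f (x(i := y)) \<partial>lborel) \<partial>(Pi\<^sub>M I (\<lambda>_. lborel)))"
    proof (rule nn_integral_cong)
      fix x assume x: "x \<in> space (Pi\<^sub>M I (\<lambda>_. lborel :: real measure))"
      have "(\<lambda>y. x(i := y)) \<in> lborel \<rightarrow>\<^sub>M Pi\<^sub>M (insert i I) (\<lambda>_. lborel)"
        using measurable_component_update[OF x I(2)] .
      then have "(\<lambda>y. f (x(i := y))) \<in> borel_measurable borel" using fI by measurable
      from nn_integral_real_affine[OF this, of c "t x"] c
      show "(\<integral>\<^sup>+ y. f (T (x(i := y))) \<partial>lborel) = (\<integral>\<^sup>+ y. f (x(i := y)) \<partial>lborel)"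
        by (auto simp: T_def t(2) add.commute)
    qed
    also have "\<dots> = (\<integral>\<^sup>+w. f w \<partial>?L)"
      using lborel_prod.product_nn_integral_insert[OF I(1,2) fI] I(3) by simp
    finally show ?thesis .
  qed
  show "distr ?L ?L T = ?L"
  proof (rule measure_eqI)
    fix X assume "X \<in> sets (distr ?L ?L T)"
    then have X [measurable]: "X \<in> sets ?L" by simp
    have "emeasure (distr ?L ?L T) X = (\<integral>\<^sup>+w. indicator X w \<partial>(distr ?L ?L T))" by simp
    also have "\<dots> = (\<integral>\<^sup>+w. indicator X (T w) \<partial>?L)" by (rule nn_integral_distr) measurable
    also have "\<dots> = emeasure ?L X" using inv[of "indicator X"] by simp
    finally show "emeasure (distr ?L ?L T) X = emeasure ?L X" .
  qed simp
qed

definition gaussian_symmetry :: "'i set \<Rightarrow> (('i \<Rightarrow> real) \<Rightarrow> ('i \<Rightarrow> real)) \<Rightarrow> bool" where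
  "gaussian_symmetry A T \<longleftrightarrow> T \<in> gaussian A \<rightarrow>\<^sub>M gaussian A \<and> distr (gaussian A) (gaussian A) T = gaussian A"

lemma gaussian_symmetryI:
  assumes T: "T \<in> Pi\<^sub>M A (\<lambda>_. lborel) \<rightarrow>\<^sub>M Pi\<^sub>M A (\<lambda>_. lborel)"
    and d: "distr (Pi\<^sub>M A (\<lambda>_. lborel)) (Pi\<^sub>M A (\<lambda>_. lborel)) T = Pi\<^sub>M A (\<lambda>_. lborel)"
    and w: "\<And>w. (\<Prod>i\<in>A. std_normal_density (T w i)) = (\<Prod>i\<in>A. std_normal_density (w i))"
  shows "gaussian_symmetry A T"
proof -
  let ?L = "Pi\<^sub>M A (\<lambda>_. lborel :: real measure)" and ?w = "\<lambda>w. ennreal (\<Prod>i\<in>A. std_normal_density (w i))"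
  have m: "T \<in> gaussian A \<rightarrow>\<^sub>M gaussian A"
    using T by (simp add: measurable_cong_sets[OF sets_gaussian sets_gaussian])
  have "gaussian A = density (distr ?L ?L T) ?w" by (simp only: d gaussian_def)
  also have "\<dots> = distr (density ?L (\<lambda>w. ?w (T w))) ?L T" by (rule density_distr) (use T in measurable)
  also have "\<dots> = distr (gaussian A) ?L T" by (simp only: w gaussian_def)
  also have "\<dots> = distr (gaussian A) (gaussian A) T" by (rule distr_cong) (simp_all add: sets_gaussian)
  finally have "distr (gaussian A) (gaussian A) T = gaussian A" by (rule sym)
  with m show ?thesis unfolding gaussian_symmetry_def by (rule conjI)
qed

lemma gaussian_symmetry_integral:
  fixes f :: "_ \<Rightarrow> real"
  assumes "gaussian_symmetry A T" "f \<in> borel_measurable (gaussian A)"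
  shows "integral\<^sup>L (gaussian A) (\<lambda>w. f (T w)) = integral\<^sup>L (gaussian A) f"
    and "integrable (gaussian A) (\<lambda>w. f (T w)) \<longleftrightarrow> integrable (gaussian A) f"
proof -
  have T: "T \<in> gaussian A \<rightarrow>\<^sub>M gaussian A" "distr (gaussian A) (gaussian A) T = gaussian A"
    using assms(1) unfolding gaussian_symmetry_def by (rule conjunct1, rule conjunct2)
  show "integral\<^sup>L (gaussian A) (\<lambda>w. f (T w)) = integral\<^sup>L (gaussian A) f"
    using integral_distr[OF T(1) assms(2)] unfolding T(2) by (rule sym)
  show "integrable (gaussian A) (\<lambda>w. f (T w)) \<longleftrightarrow> integrable (gaussian A) f"
    using integrable_distr_eq[OF T(1) assms(2)] unfolding T(2) by (rule sym)
qed

definition rotate :: "'i \<Rightarrow> 'i \<Rightarrow> real \<Rightarrow> real \<Rightarrow> ('i \<Rightarrow> real) \<Rightarrow> ('i \<Rightarrow> real)" where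
  "rotate i j c s w = w(i := c * w i - s * w j, j := s * w i + c * w j)"

text \<open>
  A rotation is a product of three shears, which preserve Lebesgue measure, and it preserves the density
  because it preserves the sum of squares.
\<close>
lemma gaussian_symmetry_rotate:
  assumes A: "finite A" "i \<in> A" "j \<in> A" "i \<noteq> j" and cs: "c\<^sup>2 + s\<^sup>2 = 1" "c \<ge> 0"
  shows "gaussian_symmetry A (rotate i j c s)"
proof (rule gaussian_symmetryI)
  let ?L = "Pi\<^sub>M A (\<lambda>_. lborel :: real measure)"
  (* The tangent of half of the angle of rotation. *)
  define t where "t = s / (1 + c)"
  define S1 where "S1 = (\<lambda>w::'a \<Rightarrow> real. w(i := 1 * w i + (- t * w j)))"
  define S2 where "S2 = (\<lambda>w::'a \<Rightarrow> real. w(j := 1 * w j + s * w i))"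
  have st: "s * t = 1 - c" "t * (1 + c) = s"
    using cs by (auto simp: t_def power2_eq_square divide_simps) (simp add: algebra_simps)
  have S1: "S1 \<in> ?L \<rightarrow>\<^sub>M ?L" "distr ?L ?L S1 = ?L"
    unfolding S1_def using A by (intro distr_PiM_lborel_shear; simp)+
  have S2: "S2 \<in> ?L \<rightarrow>\<^sub>M ?L" "distr ?L ?L S2 = ?L"
    unfolding S2_def using A by (intro distr_PiM_lborel_shear; simp)+
  have rot: "rotate i j c s = S1 \<circ> (S2 \<circ> S1)"
  proof (rule ext, rule ext)
    fix w k
    have "c * w i - s * w j = w i - t * w j - t * (w j + s * (w i - t * w j))"
    proof -
      have "w i - t * w j - t * (w j + s * (w i - t * w j))
          = w i - t * w j - t * w j - (s * t) * w i + (s * t) * (t * w j)" by (simp add: algebra_simps)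
      also have "\<dots> = c * w i - (t * (1 + c)) * w j" unfolding st(1) by (simp add: algebra_simps)
      finally show ?thesis by (simp add: st)
    qed
    moreover have "s * w i + c * w j = w j + s * (w i - t * w j)"
    proof -
      have "w j + s * (w i - t * w j) = w j + s * w i - (s * t) * w j" by (simp add: algebra_simps)
      then show ?thesis unfolding st(1) by (simp add: algebra_simps)
    qed
    ultimately show "rotate i j c s w k = (S1 \<circ> (S2 \<circ> S1)) w k"
      using \<open>i \<noteq> j\<close> by (auto simp: rotate_def S1_def S2_def)
  qed
  have m2: "S2 \<circ> S1 \<in> ?L \<rightarrow>\<^sub>M ?L" using S1(1) S2(1) by (rule measurable_comp)
  show "rotate i j c s \<in> ?L \<rightarrow>\<^sub>M ?L" unfolding rot using m2 S1(1) by (rule measurable_comp)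
  have "distr ?L ?L (S2 \<circ> S1) = ?L" using distr_distr[OF S2(1) S1(1)] S1(2) S2(2) by simp
  then show "distr ?L ?L (rotate i j c s) = ?L"
    using distr_distr[OF S1(1) m2] S1(2) by (simp add: rot)
  fix w :: "'a \<Rightarrow> real"
  have split: "(\<Prod>k\<in>A. g k) = g i * (g j * (\<Prod>k\<in>A - {i} - {j}. g k))" for g :: "'a \<Rightarrow> real"
    using A by (subst prod.remove[of A i], simp, simp, subst prod.remove[of _ j]) auto
  have rest: "(\<Prod>k\<in>A - {i} - {j}. std_normal_density (rotate i j c s w k)) = (\<Prod>k\<in>A - {i} - {j}. std_normal_density (w k))"
    by (intro prod.cong) (auto simp: rotate_def)
  have "std_normal_density (rotate i j c s w i) * std_normal_density (rotate i j c s w j)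
      = std_normal_density (w i) * std_normal_density (w j)"
  proof -
    have "(c * w i - s * w j)\<^sup>2 + (s * w i + c * w j)\<^sup>2 = (c\<^sup>2 + s\<^sup>2) * ((w i)\<^sup>2 + (w j)\<^sup>2)"
      by (simp add: power2_eq_square algebra_simps)
    then have "(c * w i - s * w j)\<^sup>2 + (s * w i + c * w j)\<^sup>2 = (w i)\<^sup>2 + (w j)\<^sup>2" by (simp add: cs)
    then show ?thesis using \<open>i \<noteq> j\<close>
      by (simp add: rotate_def std_normal_density_def exp_add[symmetric] add_divide_distrib[symmetric] flip: minus_add_distrib)
  qed
  then show "(\<Prod>k\<in>A. std_normal_density (rotate i j c s w k)) = (\<Prod>k\<in>A. std_normal_density (w k))"
    unfolding split[of "\<lambda>k. std_normal_density (rotate i j c s w k)"] split[of "\<lambda>k. std_normal_density (w k)"] rest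
    by (simp flip: mult.assoc)
qed

lemma gaussian_symmetry_flip:
  assumes A: "finite A" "S \<subseteq> A"
  shows "gaussian_symmetry A (\<lambda>w i. if i \<in> S then - w i else w i)"
proof -
  have "finite S" using A finite_subset by blast
  then show ?thesis using A(2)
  proof (induction S rule: finite_induct)
    case empty
    show ?case by (simp add: gaussian_symmetry_def distr_id)
  next
    case (insert j S)
    let ?T = "\<lambda>w i. if i \<in> S then - w i else (w i::real)" and ?F = "\<lambda>w::'a \<Rightarrow> real. w(j := - 1 * w j + 0)"
    have F: "gaussian_symmetry A ?F"
    proof (rule gaussian_symmetryI)
      show "?F \<in> Pi\<^sub>M A (\<lambda>_. lborel) \<rightarrow>\<^sub>M Pi\<^sub>M A (\<lambda>_. lborel)"
        using insert A by (intro distr_PiM_lborel_shear) auto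
      show "distr (Pi\<^sub>M A (\<lambda>_. lborel)) (Pi\<^sub>M A (\<lambda>_. lborel)) ?F = Pi\<^sub>M A (\<lambda>_. lborel)"
        using insert A by (intro distr_PiM_lborel_shear) auto
      show "(\<Prod>i\<in>A. std_normal_density (?F w i)) = (\<Prod>i\<in>A. std_normal_density (w i))" for w
        by (intro prod.cong) (auto simp: std_normal_density_def)
    qed
    have T: "gaussian_symmetry A ?T" using insert by simp
    have eq: "(\<lambda>w i. if i \<in> insert j S then - w i else (w i::real)) = ?F \<circ> ?T"
      using insert(2) by (auto simp: fun_eq_iff)
    have "?F \<circ> ?T \<in> gaussian A \<rightarrow>\<^sub>M gaussian A"
      using T F unfolding gaussian_symmetry_def by (intro measurable_comp) auto
    moreover have "distr (gaussian A) (gaussian A) (?F \<circ> ?T) = gaussian A"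
      using distr_distr[of ?F "gaussian A" "gaussian A" ?T "gaussian A"] T F unfolding gaussian_symmetry_def by simp
    ultimately show ?case unfolding eq gaussian_symmetry_def by simp
  qed
qed

lemma prob_space_gaussian:
  assumes "finite A" shows "prob_space (gaussian A)"
proof (rule prob_spaceI)
  have 1: "(\<integral>\<^sup>+x. ennreal (std_normal_density x) \<partial>lborel) = 1"
    using prob_space.emeasure_space_1[OF prob_space_normal_density[of 1 0]]
    by (simp add: emeasure_density)
  have "emeasure (gaussian A) (space (gaussian A)) = (\<integral>\<^sup>+w. (\<Prod>i\<in>A. ennreal (std_normal_density (w i))) \<partial>(Pi\<^sub>M A (\<lambda>_. lborel)))"
    unfolding space_gaussian unfolding gaussian_def
    by (subst emeasure_density) (auto simp: prod_ennreal intro!: nn_integral_cong)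
  also have "\<dots> = (\<Prod>i\<in>A. (\<integral>\<^sup>+x. ennreal (std_normal_density x) \<partial>lborel))"
    using assms by (intro lborel_prod.product_nn_integral_prod) auto
  finally show "emeasure (gaussian A) (space (gaussian A)) = 1" by (simp add: 1)
qed

lemma gaussian_component:
  fixes h :: "real \<Rightarrow> real"
  assumes A: "finite A" "i \<in> A" and h: "integrable lborel (\<lambda>x. std_normal_density x * h x)"
    and [measurable]: "h \<in> borel_measurable borel"
  shows "integrable (gaussian A) (\<lambda>w. h (w i))"
    and "integral\<^sup>L (gaussian A) (\<lambda>w. h (w i)) = (\<integral>x. std_normal_density x * h x \<partial>lborel)"
proof -
  let ?L = "Pi\<^sub>M A (\<lambda>_. lborel :: real measure)"
  define f where "f k = (if k = i then (\<lambda>x. std_normal_density x * h x) else std_normal_density)" for k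
  have int1: "integrable lborel std_normal_density" "integral\<^sup>L lborel std_normal_density = 1"
    using integrable_normal_density[of 1 0] integral_normal_density[of 1 0] by auto
  have f: "integrable lborel (f k)" for k using h int1 by (simp add: f_def)
  have prodf: "(\<Prod>k\<in>A. f k (w k)) = (\<Prod>k\<in>A. std_normal_density (w k)) * h (w i)" for w
  proof -
    have "(\<Prod>k\<in>A. f k (w k)) = (\<Prod>k\<in>A. std_normal_density (w k) * (if k = i then h (w i) else 1))"
      by (intro prod.cong) (auto simp: f_def)
    also have "\<dots> = (\<Prod>k\<in>A. std_normal_density (w k)) * h (w i)"
      using A by (simp add: prod.distrib)
    finally show ?thesis .
  qed
  have hm: "(\<lambda>w. h (w i)) \<in> borel_measurable ?L"
    by (rule measurable_compose[of "\<lambda>w. w i" _ lborel]) (use A in \<open>simp_all add: measurable_component_singleton\<close>)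
  have nn: "AE w in ?L. 0 \<le> (\<Prod>k\<in>A. std_normal_density (w k))" by (simp add: prod_nonneg)
  have wm: "(\<lambda>w. \<Prod>k\<in>A. std_normal_density (w k)) \<in> borel_measurable ?L" by measurable
  show "integrable (gaussian A) (\<lambda>w. h (w i))"
  proof -
    have "integrable ?L (\<lambda>w. \<Prod>k\<in>A. f k (w k))"
      using A f by (intro lborel_prod.product_integrable_prod) auto
    then show ?thesis unfolding gaussian_def integrable_density[OF hm wm nn] by (simp add: prodf)
  qed
  have "integral\<^sup>L (gaussian A) (\<lambda>w. h (w i)) = (\<integral>w. (\<Prod>k\<in>A. f k (w k)) \<partial>?L)"
    unfolding gaussian_def integral_density[OF hm wm nn] by (simp add: prodf)
  also have "\<dots> = (\<Prod>k\<in>A. integral\<^sup>L lborel (f k))"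
    using A f by (intro lborel_prod.product_integral_prod) auto
  also have "\<dots> = (\<Prod>k\<in>A. if k = i then (\<integral>x. std_normal_density x * h x \<partial>lborel) else 1)"
    by (intro prod.cong) (auto simp: f_def int1)
  also have "\<dots> = (\<integral>x. std_normal_density x * h x \<partial>lborel)" using A by simp
  finally show "integral\<^sup>L (gaussian A) (\<lambda>w. h (w i)) = (\<integral>x. std_normal_density x * h x \<partial>lborel)" .
qed

lemma sum_remove_two:
  fixes g :: "'i \<Rightarrow> 'v::comm_monoid_add"
  assumes "finite A" "i \<in> A" "j \<in> A" "i \<noteq> j"
  shows "sum g A = g i + (g j + sum g (A - {i} - {j}))"
  using assms by (subst sum.remove[of A i], simp, simp, subst sum.remove[of _ j]) auto

text \<open>
  Rotating the random coefficients amounts to rotating the two vectors in the opposite direction.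
\<close>
lemma sum_rotate:
  fixes z :: "'i \<Rightarrow> 'v::real_vector"
  assumes A: "finite A" "i \<in> A" "j \<in> A" "i \<noteq> j"
  shows "(\<Sum>k\<in>A. rotate i j c s w k *\<^sub>R z k)
    = (\<Sum>k\<in>A. w k *\<^sub>R (z(i := c *\<^sub>R z i + s *\<^sub>R z j, j := c *\<^sub>R z j - s *\<^sub>R z i)) k)"
proof -
  note split = sum_remove_two[OF A]
  have rest: "(\<Sum>k\<in>A - {i} - {j}. rotate i j c s w k *\<^sub>R z k)
      = (\<Sum>k\<in>A - {i} - {j}. w k *\<^sub>R (z(i := c *\<^sub>R z i + s *\<^sub>R z j, j := c *\<^sub>R z j - s *\<^sub>R z i)) k)"
    by (intro sum.cong) (auto simp: rotate_def)
  show ?thesis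
    unfolding split[of "\<lambda>k. rotate i j c s w k *\<^sub>R z k"]
      split[of "\<lambda>k. w k *\<^sub>R (z(i := c *\<^sub>R z i + s *\<^sub>R z j, j := c *\<^sub>R z j - s *\<^sub>R z i)) k"] rest
    using \<open>i \<noteq> j\<close> by (simp add: rotate_def algebra_simps)
qed

text \<open>
  The sign of \<open>r\<close> is that of \<open>a\<close>, which makes \<open>c = a / r\<close> nonnegative and so keeps the rotation away from
  the half turn, where the factorisation into shears breaks down.
\<close>
lemma eliminating_rotation:
  fixes a b :: real assumes "a \<noteq> 0"
  obtains c s where "c\<^sup>2 + s\<^sup>2 = 1" "c \<ge> 0" "c * b - s * a = 0"
proof
  define r where "r = sqrt (a\<^sup>2 + b\<^sup>2) * sgn a"
  have p: "a\<^sup>2 + b\<^sup>2 > 0" using assms by (simp add: sum_power2_gt_zero_iff)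
  have r: "r\<^sup>2 = a\<^sup>2 + b\<^sup>2" "r \<noteq> 0" using assms p by (auto simp: r_def power_mult_distrib sgn_if)
  show "(a / r)\<^sup>2 + (b / r)\<^sup>2 = 1" using p by (simp only: power_divide add_divide_distrib[symmetric] r(1)) (rule divide_self, linarith)
  show "a / r \<ge> 0" using assms p by (auto simp: r_def sgn_if divide_simps zero_le_mult_iff)
  show "a / r * b - b / r * a = 0" by simp
qed

definition abs_moment :: "real \<Rightarrow> real" where
  "abs_moment q = (\<integral>x. std_normal_density x * \<bar>x\<bar> powr q \<partial>lborel)"

lemma abs_moment_nonneg: "abs_moment q \<ge> 0"
  unfolding abs_moment_def by (intro integral_nonneg_AE) auto

lemma integrable_abs_moment:
  assumes "q \<ge> 0" shows "integrable lborel (\<lambda>x. std_normal_density x * \<bar>x\<bar> powr q)"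
proof -
  define k where "k = nat \<lceil>q\<rceil>"
  have int: "integrable lborel (\<lambda>x. std_normal_density x + std_normal_density x * \<bar>x\<bar> ^ k)"
    using integrable_normal_density[of 1 0] integrable_std_normal_moment_abs[of k] by (intro Bochner_Integration.integrable_add) auto
  have "\<bar>x\<bar> powr q \<le> 1 + \<bar>x\<bar> ^ k" for x :: real
  proof (cases "\<bar>x\<bar> \<le> 1")
    case True
    then have "\<bar>x\<bar> powr q \<le> 1" using assms by (simp add: powr_le1)
    then show ?thesis by (simp add: add_increasing2)
  next
    case False
    then have "\<bar>x\<bar> powr q \<le> \<bar>x\<bar> powr real k" unfolding k_def by (intro powr_mono real_nat_ceiling_ge) auto
    then show ?thesis using False by (simp add: powr_realpow)
  qed
  then have "norm (std_normal_density x * \<bar>x\<bar> powr q) \<le> norm (std_normal_density x + std_normal_density x * \<bar>x\<bar> ^ k)" for x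
    using mult_left_mono[of "\<bar>x\<bar> powr q" "1 + \<bar>x\<bar> ^ k" "std_normal_density x"]
    by (simp add: abs_mult algebra_simps)
  then show ?thesis by (intro Bochner_Integration.integrable_bound[OF int]) auto
qed

lemma power2_powr_half: "(x::real)\<^sup>2 powr (q / 2) = \<bar>x\<bar> powr q"
proof -
  have "x\<^sup>2 = \<bar>x\<bar> powr 2" by (cases "x = 0") (simp_all add: powr_numeral)
  then have "x\<^sup>2 powr (q / 2) = (\<bar>x\<bar> powr 2) powr (q / 2)" by simp
  also have "\<dots> = \<bar>x\<bar> powr q" unfolding powr_powr by simp
  finally show ?thesis .
qed

text \<open>
  Rotations merge two nonzero coefficients into one, with the same sum of squares, until a single
  coefficient is left.
\<close>
lemma gaussian_sum_abs_moment:
  fixes a :: "'i \<Rightarrow> real"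
  assumes A: "finite A" and q: "q > 0"
  shows "integrable (gaussian A) (\<lambda>w. \<bar>\<Sum>i\<in>A. w i * a i\<bar> powr q)
    \<and> integral\<^sup>L (gaussian A) (\<lambda>w. \<bar>\<Sum>i\<in>A. w i * a i\<bar> powr q) = abs_moment q * (\<Sum>i\<in>A. (a i)\<^sup>2) powr (q / 2)"
proof (induction "card {i\<in>A. a i \<noteq> 0}" arbitrary: a rule: less_induct)
  case less
  define B where "B = {i\<in>A. a i \<noteq> 0}"
  have B: "finite B" using A by (simp add: B_def)
  consider "B = {}" | i where "B = {i}" | i j where "i \<in> B" "j \<in> B" "i \<noteq> j" by blast
  then show ?case
  proof cases
    case 1
    then have "a i = 0" if "i \<in> A" for i using that by (auto simp: B_def)
    then show ?thesis using q by simp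
  next
    case (2 i)
    have i: "i \<in> A" and z: "a k = 0" if "k \<in> A" "k \<noteq> i" for k using 2 that by (auto simp: B_def)
    have i: "i \<in> A" using 2 by (auto simp: B_def)
    have red: "(\<Sum>k\<in>A. g k * a k) = g i * a i" for g
      using A i z by (subst sum.remove[of A i]) auto
    have sq: "(\<Sum>k\<in>A. (a k)\<^sup>2) = (a i)\<^sup>2" using red[of a] by (simp add: power2_eq_square)
    note pw = power2_powr_half[of "a i" q]
    have int: "integrable lborel (\<lambda>x. std_normal_density x * (\<bar>a i\<bar> powr q * \<bar>x\<bar> powr q))"
      using integrable_mult_right[OF integrable_abs_moment[of q], of "\<bar>a i\<bar> powr q"] q by (simp add: mult_ac)
    have eq: "(\<lambda>w. \<bar>\<Sum>k\<in>A. w k * a k\<bar> powr q) = (\<lambda>w. \<bar>a i\<bar> powr q * \<bar>w i\<bar> powr q)"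
      by (simp add: red abs_mult powr_mult mult.commute)
    have "(\<integral>x. std_normal_density x * (\<bar>a i\<bar> powr q * \<bar>x\<bar> powr q) \<partial>lborel) = abs_moment q * \<bar>a i\<bar> powr q"
      unfolding abs_moment_def by (subst integral_mult_left_zero[symmetric]) (simp add: mult_ac)
    then show ?thesis using gaussian_component[OF A i int] unfolding eq sq pw by simp
  next
    case (3 i j)
    then have ij: "i \<in> A" "j \<in> A" "i \<noteq> j" "a i \<noteq> 0" "a j \<noteq> 0" by (auto simp: B_def)
    obtain c s where cs: "c\<^sup>2 + s\<^sup>2 = 1" "c \<ge> 0" "c * a j - s * a i = 0"
      using eliminating_rotation[of "a i" "a j"] ij by blast
    define a' where "a' = a(i := c *\<^sub>R a i + s *\<^sub>R a j, j := c *\<^sub>R a j - s *\<^sub>R a i)"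
    have sym: "gaussian_symmetry A (rotate i j c s)" using A ij cs by (intro gaussian_symmetry_rotate)
    have sr: "(\<Sum>k\<in>A. rotate i j c s w k * a k) = (\<Sum>k\<in>A. w k * a' k)" for w
      using sum_rotate[OF A ij(1-3), of c s w a] by (simp add: a'_def)
    have sq: "(\<Sum>k\<in>A. (a' k)\<^sup>2) = (\<Sum>k\<in>A. (a k)\<^sup>2)"
    proof -
      note split = sum_remove_two[OF A ij(1-3)]
      have rest: "(\<Sum>k\<in>A - {i} - {j}. (a' k)\<^sup>2) = (\<Sum>k\<in>A - {i} - {j}. (a k)\<^sup>2)"
        by (intro sum.cong) (auto simp: a'_def)
      have "(c * a i + s * a j)\<^sup>2 + (c * a j - s * a i)\<^sup>2 = (c\<^sup>2 + s\<^sup>2) * ((a i)\<^sup>2 + (a j)\<^sup>2)"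
        by (simp add: power2_eq_square algebra_simps)
      then show ?thesis unfolding split[of "\<lambda>k. (a' k)\<^sup>2"] split[of "\<lambda>k. (a k)\<^sup>2"] rest
        using ij cs by (simp add: a'_def)
    qed
    have "{k\<in>A. a' k \<noteq> 0} \<subset> B"
      using ij cs by (auto simp: a'_def B_def split: if_splits)
    then have "card {k\<in>A. a' k \<noteq> 0} < card B" by (rule psubset_card_mono[OF B])
    from less[OF this[unfolded B_def]] 
    have IH: "integrable (gaussian A) (\<lambda>w. \<bar>\<Sum>i\<in>A. w i * a' i\<bar> powr q)"
      "integral\<^sup>L (gaussian A) (\<lambda>w. \<bar>\<Sum>i\<in>A. w i * a' i\<bar> powr q) = abs_moment q * (\<Sum>i\<in>A. (a i)\<^sup>2) powr (q / 2)"
      by (simp_all add: sq)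
    have m: "(\<lambda>w. \<bar>\<Sum>i\<in>A. w i * a i\<bar> powr q) \<in> borel_measurable (gaussian A)" by measurable
    show ?thesis using gaussian_symmetry_integral[OF sym m] IH by (simp add: sr)
  qed
qed

section \<open>The norm of \<open>l_p\<close> and its type 2 property\<close>
lemma powr_convex_combination:
  fixes u v t q :: real
  assumes "u \<ge> 0" "v \<ge> 0" "0 \<le> t" "t \<le> 1" "q \<ge> 1"
  shows "((1 - t) * u + t * v) powr q \<le> (1 - t) * u powr q + t * v powr q"
proof -
  have shrink: "(s * w) powr q \<le> s * w powr q" if "0 \<le> s" "s \<le> 1" "0 \<le> w" for s w :: real
  proof -
    have "s powr q \<le> s powr 1" using that assms(5) by (cases "s = 0") (simp, intro powr_mono', auto)
    then show ?thesis using that by (simp add: powr_mult mult_right_mono)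
  qed
  consider "u = 0" | "v = 0" | "u > 0" "v > 0" using assms by linarith
  then show ?thesis
  proof cases
    case 1 then show ?thesis using shrink[of t v] assms by simp
  next
    case 2 then show ?thesis using shrink[of "1-t" u] assms by simp
  next
    case 3
    then show ?thesis using convex_onD[OF powr_convex[OF assms(5)], of t u v] assms by simp
  qed
qed

lemma lp_norm_nonneg [simp]: "lp_norm p n x \<ge> 0"
  by (simp add: lp_norm_def)

lemma lp_norm_powr: "p > 0 \<Longrightarrow> lp_norm p n x powr p = (\<Sum>i<n. \<bar>x i\<bar> powr p)"
  by (simp add: lp_norm_def powr_powr sum_nonneg)

lemma lp_norm_eq_0: "lp_norm p n x = 0 \<longleftrightarrow> (\<forall>i<n. x i = 0)"
  by (auto simp: lp_norm_def sum_nonneg_eq_0_iff)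

lemma lp_norm_zero [simp]: "lp_norm p n 0 = 0" "lp_norm p n (\<lambda>_. 0) = 0"
  by (simp_all add: lp_norm_eq_0)

lemma lp_norm_scaleR [simp]:
  assumes "p > 0" shows "lp_norm p n (c *\<^sub>R x) = \<bar>c\<bar> * lp_norm p n x"
proof -
  have "lp_norm p n (c *\<^sub>R x) = (\<bar>c\<bar> powr p * (\<Sum>i<n. \<bar>x i\<bar> powr p)) powr (1 / p)"
    by (simp add: lp_norm_def abs_mult powr_mult sum_distrib_left)
  also have "\<dots> = \<bar>c\<bar> * lp_norm p n x"
    using assms by (simp add: powr_mult sum_nonneg powr_powr lp_norm_def)
  finally show ?thesis .
qed

lemma lp_norm_minus [simp]: "lp_norm p n (- x) = lp_norm p n x"
  by (simp add: lp_norm_def)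

lemma abs_coord_le_lp_norm:
  assumes "p > 0" "i < n" shows "\<bar>x i\<bar> \<le> lp_norm p n x"
proof -
  have "\<bar>x i\<bar> powr p \<le> (\<Sum>i<n. \<bar>x i\<bar> powr p)"
    using assms by (intro member_le_sum) auto
  then have "(\<bar>x i\<bar> powr p) powr (1/p) \<le> lp_norm p n x"
    unfolding lp_norm_def using assms by (intro powr_mono2) auto
  then show ?thesis using assms by (simp add: powr_powr)
qed

lemma lp_norm_triangle:
  assumes "p \<ge> 1" shows "lp_norm p n (x + y) \<le> lp_norm p n x + lp_norm p n y"
proof -
  let ?a = "lp_norm p n x" and ?b = "lp_norm p n y"
  have p: "p > 0" using assms by simp
  consider "?a = 0" | "?b = 0" | "?a > 0" "?b > 0"
    using lp_norm_nonneg[of p n x] lp_norm_nonneg[of p n y] by linarith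
  then show ?thesis
  proof cases
    case 1
    then have "lp_norm p n (x + y) = ?b" unfolding lp_norm_def by (intro arg_cong2[where f="(powr)"] sum.cong) (auto simp: lp_norm_eq_0 lp_norm_def[symmetric])
    then show ?thesis using 1 by simp
  next
    case 2
    then have "lp_norm p n (x + y) = ?a" unfolding lp_norm_def by (intro arg_cong2[where f="(powr)"] sum.cong) (auto simp: lp_norm_eq_0 lp_norm_def[symmetric])
    then show ?thesis using 2 by simp
  next
    case 3
    define t where "t = ?b / (?a + ?b)"
    have t: "0 \<le> t" "t \<le> 1" "1 - t = ?a / (?a + ?b)" using 3 by (auto simp: t_def field_simps)
    have "(\<Sum>i<n. (\<bar>x i + y i\<bar> / (?a + ?b)) powr p)
        \<le> (\<Sum>i<n. (1 - t) * (\<bar>x i\<bar> / ?a) powr p + t * (\<bar>y i\<bar> / ?b) powr p)"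
    proof (rule sum_mono)
      fix i
      have "\<bar>x i + y i\<bar> / (?a + ?b) \<le> (1 - t) * (\<bar>x i\<bar> / ?a) + t * (\<bar>y i\<bar> / ?b)"
        using 3 unfolding t(3) by (simp add: t_def divide_simps)
      then have "(\<bar>x i + y i\<bar> / (?a + ?b)) powr p \<le> ((1 - t) * (\<bar>x i\<bar> / ?a) + t * (\<bar>y i\<bar> / ?b)) powr p"
        using 3 p by (intro powr_mono2) auto
      also have "\<dots> \<le> (1 - t) * (\<bar>x i\<bar> / ?a) powr p + t * (\<bar>y i\<bar> / ?b) powr p"
        using 3 t assms by (intro powr_convex_combination) auto
      finally show "(\<bar>x i + y i\<bar> / (?a + ?b)) powr p \<le> (1 - t) * (\<bar>x i\<bar> / ?a) powr p + t * (\<bar>y i\<bar> / ?b) powr p" .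
    qed
    also have "\<dots> = (1 - t) * ((\<Sum>i<n. \<bar>x i\<bar> powr p) / ?a powr p) + t * ((\<Sum>i<n. \<bar>y i\<bar> powr p) / ?b powr p)"
      using 3 by (simp add: sum.distrib powr_divide sum_distrib_left sum_divide_distrib)
    also have "\<dots> = 1" using 3 p by (simp add: lp_norm_powr[symmetric])
    finally have "(\<Sum>i<n. \<bar>x i + y i\<bar> powr p) / (?a + ?b) powr p \<le> 1"
      using 3 by (simp add: powr_divide sum_divide_distrib)
    then have "lp_norm p n (x + y) powr p \<le> (?a + ?b) powr p"
      using 3 p by (simp add: lp_norm_powr divide_simps)
    then show ?thesis using p powr_less_mono2[of p "?a + ?b" "lp_norm p n (x + y)"] by fastforce
  qed
qed

lemma lp_norm_sum:
  assumes "p \<ge> 1" shows "lp_norm p n (\<Sum>i\<in>S. x i) \<le> (\<Sum>i\<in>S. lp_norm p n (x i))"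
proof (induction S rule: infinite_finite_induct)
  case (insert i S)
  have "lp_norm p n (\<Sum>i\<in>insert i S. x i) = lp_norm p n (x i + (\<Sum>i\<in>S. x i))"
    using sum.insert[OF insert(1,2), of x] by (rule arg_cong)
  also have "\<dots> \<le> lp_norm p n (x i) + lp_norm p n (\<Sum>i\<in>S. x i)" by (rule lp_norm_triangle[OF assms])
  also have "\<dots> \<le> lp_norm p n (x i) + (\<Sum>i\<in>S. lp_norm p n (x i))" by (rule add_left_mono[OF insert.IH])
  finally show ?case using sum.insert[OF insert(1,2), of "\<lambda>i. lp_norm p n (x i)"] by linarith
qed simp_all

lemma coord_space_closed [simp, intro]:
  "0 \<in> coord_space n" "x \<in> coord_space n \<Longrightarrow> y \<in> coord_space n \<Longrightarrow> x + y \<in> coord_space n"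
  "x \<in> coord_space n \<Longrightarrow> c *\<^sub>R x \<in> coord_space n" "x \<in> coord_space n \<Longrightarrow> - x \<in> coord_space n"
  by (auto simp: coord_space_def)

lemma coord_space_sum [intro]:
  "(\<And>i. i \<in> S \<Longrightarrow> x i \<in> coord_space n) \<Longrightarrow> (\<Sum>i\<in>S. x i) \<in> coord_space n"
  by (induction S rule: infinite_finite_induct) auto

lemma coord_space_eq_0: "x \<in> coord_space n \<Longrightarrow> lp_norm p n x = 0 \<Longrightarrow> x = 0"
  by (auto simp: coord_space_def lp_norm_eq_0 fun_eq_iff not_less) (meson not_less)

lemma measurable_lp_norm [measurable]: "lp_norm p n \<in> borel_measurable borel"
  unfolding lp_norm_def by measurable

lemma coord_space_measurable [measurable]: "coord_space n \<in> sets borel"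
proof -
  have "coord_space n = (\<Inter>i\<in>{n..}. (\<lambda>x. x i) -` {0})" by (auto simp: coord_space_def)
  also have "\<dots> \<in> sets borel"
  proof (rule sets.countable_INT'')
    show "(\<lambda>x::nat\<Rightarrow>real. x i) -` {0} \<in> sets borel" for i
    proof -
      have "{0::real} \<in> sets borel" by simp
      from measurable_sets[OF measurable_product_coordinates[of i] this] show ?thesis by simp
    qed
  qed auto
  finally show ?thesis .
qed

abbreviation lp_ball :: "real \<Rightarrow> nat \<Rightarrow> (nat \<Rightarrow> real) set" where
  "lp_ball p n \<equiv> unit_ball n (lp_norm p n)"

lemma mem_lp_ball: "x \<in> lp_ball p n \<longleftrightarrow> x \<in> coord_space n \<and> lp_norm p n x \<le> 1"
  by (simp add: unit_ball_def)

lemma lp_ball_zero [simp]: "0 \<in> lp_ball p n" by (simp add: mem_lp_ball)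

lemma lp_ball_uminus [simp]: "x \<in> lp_ball p n \<Longrightarrow> - x \<in> lp_ball p n" by (simp add: mem_lp_ball)

lemma lp_ball_scaleR: "p > 0 \<Longrightarrow> x \<in> lp_ball p n \<Longrightarrow> \<bar>c\<bar> \<le> 1 \<Longrightarrow> c *\<^sub>R x \<in> lp_ball p n"
  by (simp add: mem_lp_ball mult_le_one)

lemma lp_ball_normalize:
  "p > 0 \<Longrightarrow> x \<in> coord_space n \<Longrightarrow> (1 / lp_norm p n x) *\<^sub>R x \<in> lp_ball p n"
  by (simp add: mem_lp_ball)

lemma lp_norm_scaleR_normalize:
  "x \<in> coord_space n \<Longrightarrow> lp_norm p n x *\<^sub>R ((1 / lp_norm p n x) *\<^sub>R x) = x"
  using coord_space_eq_0[of x n p] by (cases "lp_norm p n x = 0") auto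

text \<open>
  This is the type 2 property of \<open>l_p\<close>. The coordinates of a Gaussian sum are one-dimensional Gaussian
  sums, hence their absolute moments of order \<open>p\<close> are given by the sums of squares, and the triangle
  inequality in \<open>l_(p/2)\<close> bounds these by the squares of the norms. This is where \<open>p \<ge> 2\<close> and the
  dependence of the final constant on \<open>p\<close> enter.
\<close>
lemma gaussian_type_2:
  fixes X :: "'i \<Rightarrow> nat \<Rightarrow> real" and n :: nat
  assumes A: "finite A" "S \<subseteq> A" and p: "p \<ge> 2"
  defines "u \<equiv> \<lambda>w. lp_norm p n (\<Sum>i\<in>S. w i *\<^sub>R X i)"
  shows "integrable (gaussian A) (\<lambda>w. (u w)\<^sup>2)"
    and "integral\<^sup>L (gaussian A) (\<lambda>w. (u w)\<^sup>2) \<le> (1 + abs_moment p) * (\<Sum>i\<in>S. (lp_norm p n (X i))\<^sup>2)"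
proof -
  interpret prob_space "gaussian A" using prob_space_gaussian A by blast
  have fS: "finite S" using A finite_subset by blast
  define Y where "Y i = (if i \<in> S then X i else 0)" for i
  have sumY: "(\<Sum>i\<in>A. w i * Y i j) = (\<Sum>i\<in>S. w i * X i j)" for w j
    using A fS by (intro sum.mono_neutral_cong_right) (auto simp: Y_def)
  have sumY2: "(\<Sum>i\<in>A. (Y i j)\<^sup>2) = (\<Sum>i\<in>S. (X i j)\<^sup>2)" for j
    using A fS by (intro sum.mono_neutral_cong_right) (auto simp: Y_def)
  have p0: "p > 0" using p by simp
  have up: "u w powr p = (\<Sum>j<n. \<bar>\<Sum>i\<in>A. w i * Y i j\<bar> powr p)" for w
    using p0 by (simp add: u_def lp_norm_powr sumY)
  have um [measurable]: "u \<in> borel_measurable (gaussian A)"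
  proof -
    have "u = (\<lambda>w. (\<Sum>j<n. \<bar>\<Sum>i\<in>A. w i * Y i j\<bar> powr p) powr (1 / p))"
      by (simp add: u_def lp_norm_def sumY)
    moreover have "\<dots> \<in> borel_measurable (gaussian A)" by measurable
    ultimately show ?thesis by simp
  qed
  have int: "integrable (gaussian A) (\<lambda>w. u w powr p)"
    unfolding up
    by (intro Bochner_Integration.integrable_sum conjunct1[OF gaussian_sum_abs_moment[OF A(1) p0]])
  define L where "L = (\<Sum>i\<in>S. (lp_norm p n (X i))\<^sup>2)"
  have sq: "lp_norm (p / 2) n (\<lambda>j. (x j)\<^sup>2) = (lp_norm p n x)\<^sup>2" for x
  proof -
    have "lp_norm (p / 2) n (\<lambda>j. (x j)\<^sup>2) = (\<Sum>j<n. \<bar>x j\<bar> powr p) powr (2 / p)"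
      by (simp add: lp_norm_def power2_powr_half)
    also have "\<dots> = (lp_norm p n x) powr 2" by (simp add: lp_norm_def powr_powr)
    also have "\<dots> = (lp_norm p n x)\<^sup>2" by (cases "lp_norm p n x = 0") (simp_all add: powr_numeral less_le)
    finally show ?thesis .
  qed
  have "integral\<^sup>L (gaussian A) (\<lambda>w. u w powr p) = (\<Sum>j<n. abs_moment p * (\<Sum>i\<in>S. (X i j)\<^sup>2) powr (p / 2))"
    unfolding up
    by (subst Bochner_Integration.integral_sum)
      (simp_all only: gaussian_sum_abs_moment[OF A(1) p0, THEN conjunct1]
        gaussian_sum_abs_moment[OF A(1) p0, THEN conjunct2] sumY2)
  also have "\<dots> = abs_moment p * (lp_norm (p / 2) n (\<Sum>i\<in>S. (\<lambda>j. (X i j)\<^sup>2))) powr (p / 2)"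
    using p by (subst lp_norm_powr) (auto simp: sum_distrib_left sum_nonneg)
  also have "\<dots> \<le> abs_moment p * L powr (p / 2)"
  proof -
    have "lp_norm (p / 2) n (\<Sum>i\<in>S. (\<lambda>j. (X i j)\<^sup>2)) \<le> (\<Sum>i\<in>S. lp_norm (p / 2) n (\<lambda>j. (X i j)\<^sup>2))"
      using p by (intro lp_norm_sum) auto
    also have "\<dots> = L" by (simp add: sq L_def)
    finally show ?thesis using p abs_moment_nonneg by (intro mult_left_mono powr_mono2) auto
  qed
  finally have mom: "integral\<^sup>L (gaussian A) (\<lambda>w. u w powr p) \<le> abs_moment p * L powr (p / 2)" .
  have L0: "L \<ge> 0" by (simp add: L_def sum_nonneg)
  have bound: "integrable (gaussian A) (\<lambda>w. (u w)\<^sup>2) \<and> integral\<^sup>L (gaussian A) (\<lambda>w. (u w)\<^sup>2) \<le> (1 + abs_moment p) * L"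
  proof (cases "L = 0")
    case True
    then have "lp_norm p n (X i) = 0" if "i \<in> S" for i
      using that fS unfolding L_def by (subst (asm) sum_nonneg_eq_0_iff) auto
    then have "u w = 0" for w by (auto simp: u_def lp_norm_eq_0)
    then show ?thesis using True by simp
  next
    case False
    then have L: "L > 0" using L0 by simp
    (* A pointwise substitute for the comparison of the second moment with the p-th one. *)
    have pt: "(u w)\<^sup>2 \<le> L + L * (u w powr p / L powr (p / 2))" for w
    proof (cases "(u w)\<^sup>2 \<le> L")
      case True
      then show ?thesis using L by (simp add: add_increasing2)
    next
      case False
      have u0: "u w > 0" using False L0 by (cases "u w = 0") (auto simp: u_def less_le)
      have "(u w)\<^sup>2 / L = ((u w)\<^sup>2 / L) powr 1" using L by simp
      also have "\<dots> \<le> ((u w)\<^sup>2 / L) powr (p / 2)"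
        using False L p by (intro powr_mono) (auto simp: divide_simps)
      also have "\<dots> = u w powr p / L powr (p / 2)"
        using L u0 by (simp add: powr_divide power2_powr_half)
      finally have "(u w)\<^sup>2 \<le> L * (u w powr p / L powr (p / 2))" using L by (simp add: divide_simps mult.commute)
      then show ?thesis using L by simp
    qed
    have int2: "integrable (gaussian A) (\<lambda>w. L + L * (u w powr p / L powr (p / 2)))"
      using int by (intro Bochner_Integration.integrable_add integrable_mult_right integrable_divide) auto
    have int1: "integrable (gaussian A) (\<lambda>w. (u w)\<^sup>2)"
    proof (rule Bochner_Integration.integrable_bound[OF int2])
      have "norm ((u w)\<^sup>2) \<le> norm (L + L * (u w powr p / L powr (p / 2)))" for w
        unfolding real_norm_def abs_of_nonneg[OF zero_le_power2] by (rule order_trans[OF pt abs_ge_self])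
      then show "AE w in gaussian A. norm ((u w)\<^sup>2) \<le> norm (L + L * (u w powr p / L powr (p / 2)))" by (rule AE_I2)
    qed (rule borel_measurable_power[OF um])
    have "integral\<^sup>L (gaussian A) (\<lambda>w. (u w)\<^sup>2) \<le> integral\<^sup>L (gaussian A) (\<lambda>w. L + L * (u w powr p / L powr (p / 2)))"
      by (rule integral_mono[OF int1 int2 pt])
    also have "\<dots> = L + L * (integral\<^sup>L (gaussian A) (\<lambda>w. u w powr p) / L powr (p / 2))"
    proof -
      have "integrable (gaussian A) (\<lambda>w. L * (u w powr p / L powr (p / 2)))"
        by (intro integrable_mult_right integrable_divide int)
      then show ?thesis by (simp add: prob_space)
    qed
    also have "\<dots> \<le> L + L * abs_moment p"
      using mom L by (intro add_left_mono mult_left_mono) (auto simp: divide_simps)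
    finally show ?thesis using int1 by (simp add: algebra_simps)
  qed
  then show "integrable (gaussian A) (\<lambda>w. (u w)\<^sup>2)"
    "integral\<^sup>L (gaussian A) (\<lambda>w. (u w)\<^sup>2) \<le> (1 + abs_moment p) * (\<Sum>i\<in>S. (lp_norm p n (X i))\<^sup>2)"
    by (simp_all add: L_def)
qed

section \<open>Approximately additive functions\<close>
text \<open>
  The deviation \<open>e t = g t - t * g 1\<close> is again approximately additive and vanishes at \<open>1\<close>. Doubling the
  argument bounds it on the lower half of the interval by half of its supremum, up to a multiple of
  \<open>K\<close>, and reflection at \<open>1/2\<close> transfers this to the upper half. Boundedness makes the supremum finite,
  so it can be cancelled.
\<close>
lemma hyers_interval:
  fixes g :: "real \<Rightarrow> real"
  assumes add: "\<And>s t. 0 \<le> s \<Longrightarrow> 0 \<le> t \<Longrightarrow> s + t \<le> 1 \<Longrightarrow> \<bar>g (s + t) - g s - g t\<bar> \<le> K"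
    and bdd: "\<And>t. 0 \<le> t \<Longrightarrow> t \<le> 1 \<Longrightarrow> \<bar>g t\<bar> \<le> b"
    and t: "0 \<le> t" "t \<le> 1"
  shows "\<bar>g t - t * g 1\<bar> \<le> 3 * K"
proof -
  define e where "e t = g t - t * g 1" for t
  define \<beta> where "\<beta> = (SUP t\<in>{0..1}. \<bar>e t\<bar>)"
  have "\<bar>e t\<bar> \<le> b + b" if "0 \<le> t" "t \<le> 1" for t
  proof -
    have "\<bar>t * g 1\<bar> \<le> 1 * b" using that bdd[of 1] unfolding abs_mult by (intro mult_mono) auto
    then show ?thesis using bdd[OF that] unfolding e_def by linarith
  qed
  then have bd: "bdd_above ((\<lambda>t. \<bar>e t\<bar>) ` {0..1})" by (intro bdd_aboveI[of _ "b+b"]) auto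
  have up: "\<bar>e t\<bar> \<le> \<beta>" if "0 \<le> t" "t \<le> 1" for t
    unfolding \<beta>_def using that bd by (intro cSUP_upper) auto
  have eadd: "\<bar>e (s + t) - e s - e t\<bar> \<le> K" if "0 \<le> s" "0 \<le> t" "s + t \<le> 1" for s t
    using add[OF that] by (simp add: e_def algebra_simps)
  have e1: "e 1 = 0" by (simp add: e_def)
  have half: "\<bar>e t\<bar> \<le> \<beta> / 2 + K / 2" if "0 \<le> t" "t \<le> 1/2" for t
    using eadd[of t t] up[of "t + t"] that by linarith
  (* The point t = 0 of additivity gives K >= 0. *)
  have "\<bar>e t\<bar> \<le> \<beta> / 2 + 3 / 2 * K" if "0 \<le> t" "t \<le> 1" for t
  proof (cases "t \<le> 1/2")
    case True
    then show ?thesis using half[of t] eadd[of 0 0] that by linarith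
  next
    case False
    then show ?thesis using eadd[of t "1 - t"] half[of "1 - t"] e1 that by auto
  qed
  then have "\<beta> \<le> \<beta> / 2 + 3 / 2 * K" unfolding \<beta>_def by (intro cSUP_least) auto
  then show ?thesis using up[OF t] unfolding e_def by linarith
qed

definition approx_additive :: "real \<Rightarrow> nat \<Rightarrow> real \<Rightarrow> ((nat \<Rightarrow> real) \<Rightarrow> real) \<Rightarrow> bool" where
  "approx_additive p n K D \<longleftrightarrow> (\<forall>x\<in>lp_ball p n. \<forall>y\<in>lp_ball p n. x + y \<in> lp_ball p n \<longrightarrow> \<bar>D (x + y) - D x - D y\<bar> \<le> K)"

lemma approx_additiveD:
  "approx_additive p n K D \<Longrightarrow> x \<in> lp_ball p n \<Longrightarrow> y \<in> lp_ball p n \<Longrightarrow> x + y \<in> lp_ball p n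
    \<Longrightarrow> \<bar>D (x + y) - D x - D y\<bar> \<le> K"
  by (simp add: approx_additive_def)

text \<open>
  The odd part on the unit sphere, extended along rays. Exact homogeneity turns an additive error on the
  unit ball into an error proportional to the norms, which decays with the size of the vectors.
\<close>
definition homogenize :: "real \<Rightarrow> nat \<Rightarrow> ((nat \<Rightarrow> real) \<Rightarrow> real) \<Rightarrow> (nat \<Rightarrow> real) \<Rightarrow> real" where
  "homogenize p n D x = lp_norm p n x * ((D ((1 / lp_norm p n x) *\<^sub>R x) - D (- ((1 / lp_norm p n x) *\<^sub>R x))) / 2)"

lemma homogenize_scaleR:
  assumes "p > 0" shows "homogenize p n D (c *\<^sub>R x) = c * homogenize p n D x"
proof (cases "c = 0 \<or> lp_norm p n x = 0")
  case True
  then show ?thesis using assms by (auto simp: homogenize_def)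
next
  case False
  then consider "c > 0" | "c < 0" by linarith
  then show ?thesis
  proof cases
    case 1
    then have "(1 / lp_norm p n (c *\<^sub>R x)) *\<^sub>R (c *\<^sub>R x) = (1 / lp_norm p n x) *\<^sub>R x"
      using assms False by simp
    then show ?thesis using 1 assms by (simp add: homogenize_def)
  next
    case 2
    then have "(1 / lp_norm p n (c *\<^sub>R x)) *\<^sub>R (c *\<^sub>R x) = - ((1 / lp_norm p n x) *\<^sub>R x)"
      using assms False by simp
    then show ?thesis using 2 assms by (simp add: homogenize_def algebra_simps)
  qed
qed

lemma approx_additive_ray:
  assumes p: "p \<ge> 1" and D: "approx_additive p n K D" and b: "\<And>x. x \<in> lp_ball p n \<Longrightarrow> \<bar>D x\<bar> \<le> b"
    and u: "u \<in> lp_ball p n" and t: "0 \<le> t" "t \<le> 1"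
  shows "\<bar>D (t *\<^sub>R u) - t * D u\<bar> \<le> 3 * K"
proof -
  have mem: "s *\<^sub>R u \<in> lp_ball p n" if "0 \<le> s" "s \<le> 1" for s
    using that u p by (intro lp_ball_scaleR) auto
  have "\<bar>(\<lambda>s. D (s *\<^sub>R u)) t - t * (\<lambda>s. D (s *\<^sub>R u)) 1\<bar> \<le> 3 * K"
  proof (rule hyers_interval[where b=b])
    fix s t :: real assume st: "0 \<le> s" "0 \<le> t" "s + t \<le> 1"
    have "\<bar>D (s *\<^sub>R u + t *\<^sub>R u) - D (s *\<^sub>R u) - D (t *\<^sub>R u)\<bar> \<le> K"
      using st mem[of "s + t"] by (intro approx_additiveD[OF D] mem) (auto simp: scaleR_add_left)
    then show "\<bar>D ((s + t) *\<^sub>R u) - D (s *\<^sub>R u) - D (t *\<^sub>R u)\<bar> \<le> K" by (simp add: scaleR_add_left)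
  next
    fix s :: real assume "0 \<le> s" "s \<le> 1"
    then show "\<bar>D (s *\<^sub>R u)\<bar> \<le> b" by (intro b mem)
  qed (use t in auto)
  then show ?thesis by simp
qed

lemma homogenize_close:
  assumes p: "p \<ge> 1" and D: "approx_additive p n K D" and b: "\<And>x. x \<in> lp_ball p n \<Longrightarrow> \<bar>D x\<bar> \<le> b"
    and x: "x \<in> lp_ball p n"
  shows "\<bar>homogenize p n D x - D x\<bar> \<le> 4 * K"
proof -
  let ?N = "lp_norm p n x"
  define u where "u = (1 / ?N) *\<^sub>R x"
  have N: "0 \<le> ?N" "?N \<le> 1" and xc: "x \<in> coord_space n" using x by (auto simp: mem_lp_ball)
  have u: "u \<in> lp_ball p n" unfolding u_def using p xc by (intro lp_ball_normalize) auto
  have xu: "?N *\<^sub>R u = x" unfolding u_def by (rule lp_norm_scaleR_normalize[OF xc])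
  have ray: "\<bar>D x - ?N * D u\<bar> \<le> 3 * K" using approx_additive_ray[OF p D b u N] by (simp add: xu)
  have 1: "\<bar>D (u + - u) - D u - D (- u)\<bar> \<le> K" using u by (intro approx_additiveD[OF D]) auto
  have 2: "\<bar>D (0 + 0) - D 0 - D 0\<bar> \<le> K" by (intro approx_additiveD[OF D]) auto
  have "\<bar>(D u - D (- u)) / 2 - D u\<bar> \<le> K" using 1 2 by (simp add: abs_le_iff field_simps)
  then have "\<bar>?N * ((D u - D (- u)) / 2 - D u)\<bar> \<le> 1 * K"
    using N unfolding abs_mult by (intro mult_mono) auto
  then show ?thesis using ray by (simp add: homogenize_def u_def[symmetric] algebra_simps)
qed

lemma homogeneous_quasi_additive:
  assumes p: "p \<ge> 1" and D: "approx_additive p n K D"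
    and hom: "\<And>c x. F (c *\<^sub>R x) = c * F x"
    and close: "\<And>x. x \<in> lp_ball p n \<Longrightarrow> \<bar>F x - D x\<bar> \<le> M"
    and xy: "x \<in> coord_space n" "y \<in> coord_space n"
  shows "\<bar>F (x + y) - F x - F y\<bar> \<le> (3 * M + K) * (lp_norm p n x + lp_norm p n y)"
proof (cases "lp_norm p n x + lp_norm p n y = 0")
  case True
  then have "lp_norm p n x = 0" "lp_norm p n y = 0"
    using lp_norm_nonneg[of p n x] lp_norm_nonneg[of p n y] by linarith+
  then have "x = 0" "y = 0" using xy coord_space_eq_0 by blast+
  then show ?thesis using hom[of 0 0] by simp
next
  case False
  define s where "s = lp_norm p n x + lp_norm p n y"
  have s: "s > 0" using False lp_norm_nonneg[of p n x] lp_norm_nonneg[of p n y] unfolding s_def by linarith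
  have p0: "p > 0" using p by simp
  have mem: "(1 / s) *\<^sub>R z \<in> lp_ball p n" if "z \<in> coord_space n" "lp_norm p n z \<le> s" for z
    using that s p0 by (simp add: mem_lp_ball)
  have x': "(1 / s) *\<^sub>R x \<in> lp_ball p n" and y': "(1 / s) *\<^sub>R y \<in> lp_ball p n"
    using xy by (intro mem; simp add: s_def)+
  have "(1 / s) *\<^sub>R (x + y) \<in> lp_ball p n"
    using xy lp_norm_triangle[OF p, of n x y] by (intro mem) (auto simp: s_def)
  then have xy': "(1 / s) *\<^sub>R x + (1 / s) *\<^sub>R y \<in> lp_ball p n" by (simp add: scaleR_add_right)
  have "\<bar>F ((1 / s) *\<^sub>R x + (1 / s) *\<^sub>R y) - F ((1 / s) *\<^sub>R x) - F ((1 / s) *\<^sub>R y)\<bar> \<le> 3 * M + K"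
    using approx_additiveD[OF D x' y' xy'] close[OF x'] close[OF y'] close[OF xy'] by linarith
  also have "F ((1 / s) *\<^sub>R x + (1 / s) *\<^sub>R y) - F ((1 / s) *\<^sub>R x) - F ((1 / s) *\<^sub>R y) = (F (x + y) - F x - F y) / s"
    by (simp add: hom scaleR_add_right[symmetric] diff_divide_distrib)
  finally show ?thesis using s by (simp add: abs_divide s_def[symmetric] divide_simps mult.commute)
qed

text \<open>
  Let \<open>F\<close> be the homogenised function. By duality and Caratheodory's theorem it suffices to bound
  \<open>\<Sum>a s * F s\<close> for at most \<open>n + 1\<close> vectors with \<open>\<Sum>a s * s = 0\<close>. Adding the vectors up along a binary tree
  of depth \<open>d\<close> leads to \<open>F 0 = 0\<close>.
\<close>
lemma linear_approximation:
  assumes p: "p \<ge> 1" and D: "approx_additive p n K D" and b: "\<And>x. x \<in> lp_ball p n \<Longrightarrow> \<bar>D x\<bar> \<le> b"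
    and d: "n + 1 \<le> 2 ^ d" and K: "K \<ge> 0"
  shows "\<exists>c. \<forall>x\<in>lp_ball p n. \<bar>D x - (\<Sum>j<n. c j * x j)\<bar> \<le> (13 * real d + 4) * K"
proof -
  define F where "F = homogenize p n D"
  have p0: "p > 0" using p by simp
  have hom: "F (c *\<^sub>R x) = c * F x" for c x using homogenize_scaleR[OF p0] by (simp add: F_def)
  have close: "\<bar>F x - D x\<bar> \<le> 4 * K" if "x \<in> lp_ball p n" for x
    unfolding F_def by (rule homogenize_close[OF p D b that])
  have eq: "3 * (4 * K) + K = 13 * K" by simp
  have qa: "\<bar>F (x + y) - F x - F y\<bar> \<le> 13 * K * (lp_norm p n x + lp_norm p n y)"
    if "x \<in> coord_space n" "y \<in> coord_space n" for x y
    using homogeneous_quasi_additive[where F=F and M="4 * K", OF p D hom close that]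
    unfolding eq .
  have "\<exists>c. \<forall>s\<in>lp_ball p n. \<bar>F s - (\<Sum>j\<in>{..<n}. c j * s j)\<bar> \<le> 13 * real d * K"
  proof (rule best_approximation_duality[where v="\<lambda>s j. s j"])
    fix A and a :: "(nat \<Rightarrow> real) \<Rightarrow> real"
    assume A: "A \<subseteq> lp_ball p n" "finite A" "\<forall>j\<in>{..<n}. (\<Sum>s\<in>A. a s * s j) = 0"
    show "\<bar>\<Sum>s\<in>A. a s * F s\<bar> \<le> 13 * real d * K * (\<Sum>s\<in>A. \<bar>a s\<bar>)"
    proof (rule annihilator_bound_by_small_supports[where v="\<lambda>s j. s j" and J="{..<n}" and S="lp_ball p n"])
      fix A and a :: "(nat \<Rightarrow> real) \<Rightarrow> real"
      assume A: "A \<subseteq> lp_ball p n" "finite A" "card A \<le> Suc (card {..<n})" "\<forall>j\<in>{..<n}. (\<Sum>s\<in>A. a s * s j) = 0"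
      define H where "H T = F (\<Sum>s\<in>T. a s *\<^sub>R s)" for T
      define w where "w T = (\<Sum>s\<in>T. \<bar>a s\<bar>)" for T :: "(nat \<Rightarrow> real) set"
      have coord: "(\<Sum>s\<in>T. a s *\<^sub>R s) \<in> coord_space n" if "T \<subseteq> A" for T
        using that A by (intro coord_space_sum coord_space_closed) (auto simp: mem_lp_ball)
      have nrm: "lp_norm p n (\<Sum>s\<in>T. a s *\<^sub>R s) \<le> w T" if "T \<subseteq> A" for T
      proof -
        have "lp_norm p n (\<Sum>s\<in>T. a s *\<^sub>R s) \<le> (\<Sum>s\<in>T. lp_norm p n (a s *\<^sub>R s))" by (rule lp_norm_sum[OF p])
        also have "\<dots> \<le> w T" unfolding w_def
        proof (rule sum_mono)
          fix s assume "s \<in> T"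
          then have "lp_norm p n s \<le> 1" using that A by (auto simp: mem_lp_ball)
          then show "lp_norm p n (a s *\<^sub>R s) \<le> \<bar>a s\<bar>" using p0 by (simp add: mult_left_le)
        qed
        finally show ?thesis .
      qed
      have "\<bar>H A - (\<Sum>s\<in>A. H {s})\<bar> \<le> 13 * K * real d * w A"
      proof (rule quasi_additive_tree)
        fix S T assume ST: "S \<subseteq> A" "T \<subseteq> A" "S \<inter> T = {}"
        have fin: "finite S" "finite T" using ST A finite_subset by blast+
        show wST: "w (S \<union> T) = w S + w T" unfolding w_def using sum.union_disjoint[OF fin ST(3)] .
        have "H (S \<union> T) = F ((\<Sum>s\<in>S. a s *\<^sub>R s) + (\<Sum>s\<in>T. a s *\<^sub>R s))"
          unfolding H_def by (rule arg_cong[where f=F, OF sum.union_disjoint[OF fin ST(3)]])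
        then have "\<bar>H (S \<union> T) - H S - H T\<bar> \<le> 13 * K * (lp_norm p n (\<Sum>s\<in>S. a s *\<^sub>R s) + lp_norm p n (\<Sum>s\<in>T. a s *\<^sub>R s))"
          using qa[OF coord[OF ST(1)] coord[OF ST(2)]] by (simp add: H_def)
        also have "\<dots> \<le> 13 * K * (w S + w T)"
          using K nrm[OF ST(1)] nrm[OF ST(2)] by (intro mult_left_mono add_mono) auto
        finally show "\<bar>H (S \<union> T) - H S - H T\<bar> \<le> 13 * K * w (S \<union> T)" by (simp add: wST)
      next
        show "H {} = 0" using hom[of 0 0] by (simp add: H_def zero_fun_def)
        show "card A \<le> 2 ^ d" using A(3) d by simp
        show "w S \<ge> 0" for S by (simp add: w_def sum_nonneg)
      qed (use A K in auto)
      moreover have "H A = 0"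
      proof -
        have "(\<Sum>s\<in>A. a s *\<^sub>R s) = 0"
        proof (rule ext)
          fix j
          show "(\<Sum>s\<in>A. a s *\<^sub>R s) j = 0 j"
          proof (cases "j < n")
            case True then show ?thesis using A(4) by simp
          next
            case False then show ?thesis using coord[of A] by (simp add: coord_space_def)
          qed
        qed
        then have "H A = F 0" unfolding H_def by (rule arg_cong[where f=F])
        then show ?thesis using hom[of 0 0] by simp
      qed
      ultimately show "\<bar>\<Sum>s\<in>A. a s * F s\<bar> \<le> 13 * real d * K * (\<Sum>s\<in>A. \<bar>a s\<bar>)"
        by (simp add: H_def hom w_def mult_ac)
    qed (use A in auto)
  qed (use K in auto)
  then obtain c where c: "\<forall>s\<in>lp_ball p n. \<bar>F s - (\<Sum>j<n. c j * s j)\<bar> \<le> 13 * real d * K" by blast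
  show ?thesis
  proof (intro exI[of _ c] ballI)
    fix x assume x: "x \<in> lp_ball p n"
    then show "\<bar>D x - (\<Sum>j<n. c j * x j)\<bar> \<le> (13 * real d + 4) * K"
      using c close[OF x] by (force simp: algebra_simps)
  qed
qed

section \<open>Approximately bilinear functions\<close>
lemma measurable_gaussian_sum:
  fixes X :: "'i \<Rightarrow> nat \<Rightarrow> real"
  assumes "S \<subseteq> A" shows "(\<lambda>w. \<Sum>i\<in>S. w i *\<^sub>R X i) \<in> gaussian A \<rightarrow>\<^sub>M borel"
proof (rule measurable_coordinatewise_then_product)
  fix j
  have "(\<lambda>w. \<Sum>i\<in>S. w i * X i j) \<in> borel_measurable (gaussian A)"
    by (intro borel_measurable_sum borel_measurable_times measurable_gaussian_component borel_measurable_const)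
      (rule subsetD[OF assms])
  then show "(\<lambda>w. (\<Sum>i\<in>S. w i *\<^sub>R X i) j) \<in> borel_measurable (gaussian A)"
    by (simp only: sum_fun_apply scaleR_fun_apply real_scaleR_def)
qed

lemma measurable_gaussian_bilinear:
  fixes X Y :: "'i \<Rightarrow> nat \<Rightarrow> real" and F :: "(nat \<Rightarrow> real) \<Rightarrow> (nat \<Rightarrow> real) \<Rightarrow> real"
  assumes F: "(\<lambda>(x, y). F x y) \<in> borel_measurable (borel \<Otimes>\<^sub>M borel)" and ST: "S \<subseteq> A" "T \<subseteq> A"
  shows "(\<lambda>w. F (\<Sum>i\<in>S. w i *\<^sub>R X i) (\<Sum>i\<in>T. w i *\<^sub>R Y i)) \<in> borel_measurable (gaussian A)"
proof -
  have "(\<lambda>w. (\<Sum>i\<in>S. w i *\<^sub>R X i, \<Sum>i\<in>T. w i *\<^sub>R Y i)) \<in> gaussian A \<rightarrow>\<^sub>M borel \<Otimes>\<^sub>M borel"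
    by (intro measurable_Pair measurable_gaussian_sum ST)
  from measurable_compose[OF this F] show ?thesis by (simp only: prod.case)
qed

text \<open>
  The two sums involve disjoint sets of coefficients; changing the signs of the first set changes the
  sign of the integrand.
\<close>
lemma gaussian_odd_cross_term:
  fixes X Y :: "'i \<Rightarrow> nat \<Rightarrow> real" and F :: "(nat \<Rightarrow> real) \<Rightarrow> (nat \<Rightarrow> real) \<Rightarrow> real"
  assumes F: "(\<lambda>(x, y). F x y) \<in> borel_measurable (borel \<Otimes>\<^sub>M borel)"
    and odd: "\<And>x y. F (- x) y = - F x y"
    and ST: "S \<subseteq> A" "T \<subseteq> A" "S \<inter> T = {}" and A: "finite A"
  shows "integral\<^sup>L (gaussian A) (\<lambda>w. F (\<Sum>i\<in>S. w i *\<^sub>R X i) (\<Sum>i\<in>T. w i *\<^sub>R Y i)) = 0"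
proof -
  let ?f = "\<lambda>w. F (\<Sum>i\<in>S. w i *\<^sub>R X i) (\<Sum>i\<in>T. w i *\<^sub>R Y i)"
  let ?T = "\<lambda>w i. if i \<in> S then - w i else (w i :: real)"
  have "?f (?T w) = - ?f w" for w
  proof -
    have "(\<Sum>i\<in>S. ?T w i *\<^sub>R X i) = - (\<Sum>i\<in>S. w i *\<^sub>R X i)"
      by (subst sum_negf[symmetric]) (intro sum.cong, auto)
    moreover have "(\<Sum>i\<in>T. ?T w i *\<^sub>R Y i) = (\<Sum>i\<in>T. w i *\<^sub>R Y i)"
      using ST by (intro sum.cong) auto
    ultimately show ?thesis by (simp only: odd)
  qed
  then have "integral\<^sup>L (gaussian A) (\<lambda>w. - ?f w) = integral\<^sup>L (gaussian A) ?f"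
    using gaussian_symmetry_integral(1)[OF gaussian_symmetry_flip[OF A ST(1)] measurable_gaussian_bilinear[OF F ST(1,2)], of X Y]
    by (simp only:)
  then show ?thesis by simp
qed

text \<open>
  Two Gaussian vectors without correlation are independent, and the mean of a function odd in the first
  one is zero. The proof makes the independence visible: the coordinates of the vectors \<open>X i\<close> are treated
  one after the other, and rotations concentrate a coordinate in a single index \<open>i\<close>. The missing
  correlation then forces \<open>Y i = 0\<close>, and the index is set aside. At the end \<open>X i = 0\<close> or \<open>Y i = 0\<close> for
  every \<open>i\<close>, so that the two sums have no coefficient in common.
\<close>
lemma gaussian_uncorrelated_vanishes:
  fixes X Y :: "'i \<Rightarrow> nat \<Rightarrow> real" and F :: "(nat \<Rightarrow> real) \<Rightarrow> (nat \<Rightarrow> real) \<Rightarrow> real"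
  assumes F: "(\<lambda>(x, y). F x y) \<in> borel_measurable (borel \<Otimes>\<^sub>M borel)"
    and odd: "\<And>x y. F (- x) y = - F x y" and A: "finite A"
    and supp: "\<And>i j. i \<in> A \<Longrightarrow> j \<ge> n \<Longrightarrow> X i j = 0"
    and uncor: "\<And>j k. (\<Sum>i\<in>A. X i j * Y i k) = 0"
  shows "integral\<^sup>L (gaussian A) (\<lambda>w. F (\<Sum>i\<in>A. w i *\<^sub>R X i) (\<Sum>i\<in>A. w i *\<^sub>R Y i)) = 0"
proof -
  define \<Phi> where "\<Phi> X Y = integral\<^sup>L (gaussian A) (\<lambda>w. F (\<Sum>i\<in>A. w i *\<^sub>R X i) (\<Sum>i\<in>A. w i *\<^sub>R Y i))"
    for X Y :: "'i \<Rightarrow> nat \<Rightarrow> real"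
  have split0: "\<Phi> X Y = 0" if X0: "\<forall>i\<in>A. X i = 0 \<or> Y i = 0" for X Y
  proof -
    (* Split the indices according to which of the two families can be nonzero. *)
    define S where "S = {i\<in>A. X i \<noteq> 0}"
    have 1: "(\<Sum>i\<in>A. w i *\<^sub>R X i) = (\<Sum>i\<in>S. w i *\<^sub>R X i)" for w :: "'i \<Rightarrow> real"
      by (rule sum.mono_neutral_right[OF A]) (auto simp: S_def)
    have 2: "(\<Sum>i\<in>A. w i *\<^sub>R Y i) = (\<Sum>i\<in>A - S. w i *\<^sub>R Y i)" for w :: "'i \<Rightarrow> real"
      by (rule sum.mono_neutral_right[OF A]) (use X0 in \<open>auto simp: S_def\<close>)
    show ?thesis unfolding \<Phi>_def 1 2
      by (rule gaussian_odd_cross_term[OF F odd _ _ _ A]) (auto simp: S_def)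
  qed
  have rot: "\<Phi> X Y = \<Phi> (X(i := c *\<^sub>R X i + s *\<^sub>R X j, j := c *\<^sub>R X j - s *\<^sub>R X i))
                      (Y(i := c *\<^sub>R Y i + s *\<^sub>R Y j, j := c *\<^sub>R Y j - s *\<^sub>R Y i))"
    if ij: "i \<in> A" "j \<in> A" "i \<noteq> j" and cs: "c\<^sup>2 + s\<^sup>2 = 1" "c \<ge> 0" for X Y i j c s
    unfolding \<Phi>_def sum_rotate[OF A ij, symmetric]
    by (rule gaussian_symmetry_integral(1)[OF gaussian_symmetry_rotate[OF A ij cs]
          measurable_gaussian_bilinear[OF F subset_refl subset_refl], symmetric])
  have main: "\<Phi> X Y = 0"
    if "finite J" "I \<subseteq> A" "\<forall>i\<in>A-I. X i = 0 \<or> Y i = 0" "\<forall>i\<in>I. \<forall>j. j \<notin> J \<longrightarrow> X i j = 0"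
      "\<forall>j k. (\<Sum>i\<in>I. X i j * Y i k) = 0" for J I X Y
    using that
  proof (induction J arbitrary: I X Y rule: finite_induct)
    case empty
    have "\<forall>i\<in>A. X i = 0 \<or> Y i = 0"
    proof
      fix i assume "i \<in> A"
      show "X i = 0 \<or> Y i = 0"
      proof (cases "i \<in> I")
        case True then have "X i = 0" using empty(3) by (intro ext) simp
        then show ?thesis ..
      next
        case False then show ?thesis using empty(2) \<open>i \<in> A\<close> by blast
      qed
    qed
    then show ?case by (rule split0)
  next
    case (insert j J)
    note IH = insert.IH
    from insert.prems show ?case
    proof (induction "card {i\<in>I. X i j \<noteq> 0}" arbitrary: X Y rule: less_induct)
      case less
      define B where "B = {i\<in>I. X i j \<noteq> 0}"
      have fI: "finite I" using less.prems(1) A finite_subset by blast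
      have fB: "finite B" using fI by (simp add: B_def)
      consider "B = {}" | i where "B = {i}" | i l where "i \<in> B" "l \<in> B" "i \<noteq> l" by blast
      then show ?case
      proof cases
        case 1
        show ?thesis
        proof (rule IH[of I])
          show "\<forall>i\<in>I. \<forall>k. k \<notin> J \<longrightarrow> X i k = 0"
          proof (intro ballI allI impI)
            fix i k assume "i \<in> I" "k \<notin> J"
            then show "X i k = 0" using less.prems(3) 1 by (cases "k = j") (simp_all add: B_def)
          qed
        qed (use less.prems in blast)+
      next
        case (2 i)
        then have i: "i \<in> I" "X i j \<noteq> 0" and others: "\<And>k. k \<in> I \<Longrightarrow> k \<noteq> i \<Longrightarrow> X k j = 0"
          by (auto simp: B_def)
        have "Y i = 0"
        proof (rule ext)
          fix k
          have "0 = (\<Sum>l\<in>I. X l j * Y l k)" using less.prems(4) by simp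
          also have "\<dots> = X i j * Y i k" using fI i others by (subst sum.remove[of I i]) auto
          finally show "Y i k = 0 k" using i by simp
        qed
        show ?thesis
        proof (rule IH[of "I - {i}"])
          show "\<forall>l\<in>A - (I - {i}). X l = 0 \<or> Y l = 0"
            using less.prems(2) \<open>Y i = 0\<close> by blast
          show "\<forall>l\<in>I - {i}. \<forall>k. k \<notin> J \<longrightarrow> X l k = 0"
            using less.prems(3) others by (metis Diff_iff insertE singletonI)
          show "\<forall>l k. (\<Sum>m\<in>I - {i}. X m l * Y m k) = 0"
          proof (intro allI)
            fix l k
            have "0 = (\<Sum>m\<in>I. X m l * Y m k)" using less.prems(4) by simp
            also have "\<dots> = (\<Sum>m\<in>I - {i}. X m l * Y m k)"
              using fI i \<open>Y i = 0\<close> by (subst sum.remove[of I i]) auto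
            finally show "(\<Sum>m\<in>I - {i}. X m l * Y m k) = 0" by simp
          qed
        qed (use less.prems in blast)
      next
        case (3 i l)
        then have il: "i \<in> I" "l \<in> I" "i \<noteq> l" "X i j \<noteq> 0" "X l j \<noteq> 0" by (auto simp: B_def)
        then have ilA: "i \<in> A" "l \<in> A" using less.prems(1) by auto
        obtain c s where cs: "c\<^sup>2 + s\<^sup>2 = 1" "c \<ge> 0" "c * X l j - s * X i j = 0"
          using eliminating_rotation[of "X i j" "X l j"] il by blast
        define X' where "X' = X(i := c *\<^sub>R X i + s *\<^sub>R X l, l := c *\<^sub>R X l - s *\<^sub>R X i)"
        define Y' where "Y' = Y(i := c *\<^sub>R Y i + s *\<^sub>R Y l, l := c *\<^sub>R Y l - s *\<^sub>R Y i)"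
        have eq: "\<Phi> X Y = \<Phi> X' Y'" unfolding X'_def Y'_def by (rule rot[OF ilA il(3) cs(1,2)])
        have X'v: "X' i = c *\<^sub>R X i + s *\<^sub>R X l" "X' l = c *\<^sub>R X l - s *\<^sub>R X i" "\<And>m. m \<noteq> i \<Longrightarrow> m \<noteq> l \<Longrightarrow> X' m = X m"
          and Y'v: "Y' i = c *\<^sub>R Y i + s *\<^sub>R Y l" "Y' l = c *\<^sub>R Y l - s *\<^sub>R Y i" "\<And>m. m \<noteq> i \<Longrightarrow> m \<noteq> l \<Longrightarrow> Y' m = Y m"
          using il(3) by (simp_all add: X'_def Y'_def)
        have "{m\<in>I. X' m j \<noteq> 0} \<subset> B"
        proof
          show "{m\<in>I. X' m j \<noteq> 0} \<subseteq> B"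
          proof
            fix m assume m: "m \<in> {m\<in>I. X' m j \<noteq> 0}"
            show "m \<in> B" using m il X'v(3)[of m] by (cases "m = i \<or> m = l") (auto simp: B_def)
          qed
          have "X' l j = 0" using cs(3) by (simp add: X'v(2))
          then show "{m\<in>I. X' m j \<noteq> 0} \<noteq> B" using 3 by blast
        qed
        then have lt: "card {m\<in>I. X' m j \<noteq> 0} < card {m\<in>I. X m j \<noteq> 0}"
          using psubset_card_mono[OF fB] by (simp add: B_def)
        have "\<Phi> X' Y' = 0"
        proof (rule less.hyps[of X' Y'])
          show "\<forall>m\<in>A - I. X' m = 0 \<or> Y' m = 0"
          proof
            fix m assume m: "m \<in> A - I"
            have ne: "m \<noteq> i" "m \<noteq> l" using il m by auto
            show "X' m = 0 \<or> Y' m = 0"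
              unfolding X'v(3)[OF ne] Y'v(3)[OF ne] using less.prems(2) m by (rule bspec)
          qed
          show "\<forall>m\<in>I. \<forall>k. k \<notin> insert j J \<longrightarrow> X' m k = 0"
          proof (intro ballI allI impI)
            fix m k assume m: "m \<in> I" "k \<notin> insert j J"
            then have z: "X m k = 0" "X i k = 0" "X l k = 0" using less.prems(3) il by blast+
            show "X' m k = 0"
            proof (cases "m = i \<or> m = l")
              case True then show ?thesis using z X'v(1,2) by auto
            next
              case False then show ?thesis using z X'v(3)[of m] by simp
            qed
          qed
          show "\<forall>a k. (\<Sum>m\<in>I. X' m a * Y' m k) = 0"
          proof (intro allI)
            fix a k
            note split = sum_remove_two[OF fI il(1-3)]
            have rest: "(\<Sum>m\<in>I - {i} - {l}. X' m a * Y' m k) = (\<Sum>m\<in>I - {i} - {l}. X m a * Y m k)"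
              by (intro sum.cong) (auto simp: X'_def Y'_def)
            have "X' i a * Y' i k + X' l a * Y' l k = (c\<^sup>2 + s\<^sup>2) * (X i a * Y i k + X l a * Y l k)"
              unfolding X'v Y'v by (simp add: power2_eq_square algebra_simps)
            then have "X' i a * Y' i k + X' l a * Y' l k = X i a * Y i k + X l a * Y l k"
              unfolding cs(1) by simp
            then have "(\<Sum>m\<in>I. X' m a * Y' m k) = (\<Sum>m\<in>I. X m a * Y m k)"
              unfolding split[of "\<lambda>m. X' m a * Y' m k"] split[of "\<lambda>m. X m a * Y m k"] rest by linarith
            then show "(\<Sum>m\<in>I. X' m a * Y' m k) = 0" using less.prems(4) by simp
          qed
        qed (rule lt less.prems(1))+
        then show ?thesis unfolding eq .
      qed
    qed
  qed
  have "\<Phi> X Y = 0"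
    by (rule main[of "{..<n}" A]) (use supp uncor in auto)
  then show ?thesis unfolding \<Phi>_def .
qed

lemma gaussian_second_moment:
  assumes "finite A" "i \<in> A"
  shows "integral\<^sup>L (gaussian A) (\<lambda>w. (w i)\<^sup>2) = 1"
proof -
  have int: "integrable lborel (\<lambda>x. std_normal_density x * x\<^sup>2)" by (rule integrable_std_normal_moment)
  have "(\<integral>x. std_normal_density x * x\<^sup>2 \<partial>lborel) = 1"
    using integral_std_normal_moment_even[of 1] by (simp add: numeral_2_eq_2)
  then show ?thesis using gaussian_component(2)[OF assms int] by simp
qed

lemma mult_add_le_sum_squares:
  fixes a b c d :: real
  shows "(a + b) * (c + d) \<le> (a\<^sup>2 + b\<^sup>2) + (c\<^sup>2 + d\<^sup>2)"
proof -
  have "0 \<le> (a - b)\<^sup>2 + (c - d)\<^sup>2 + (a + b - (c + d))\<^sup>2" by simp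
  then show ?thesis by (simp add: power2_eq_square algebra_simps)
qed

text \<open>
  The mean of \<open>F\<close> at two Gaussian sums over the same index set is a quasi-additive function of this set:
  the cross terms vanish, and the errors are controlled by second moments, which are additive up to a
  constant by the type 2 property. A deterministic sum would not do, since the norms of the partial
  sums could grow at each level of the tree.
\<close>
lemma gaussian_bilinear_tree:
  fixes X Y :: "'i \<Rightarrow> nat \<Rightarrow> real" and F :: "(nat \<Rightarrow> real) \<Rightarrow> (nat \<Rightarrow> real) \<Rightarrow> real"
  assumes p: "p \<ge> 2"
    and F: "(\<lambda>(x, y). F x y) \<in> borel_measurable (borel \<Otimes>\<^sub>M borel)"
    and homl: "\<And>c x y. F (c *\<^sub>R x) y = c * F x y" and homr: "\<And>c x y. F x (c *\<^sub>R y) = c * F x y"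
    and addl: "\<And>x x' y. x \<in> coord_space n \<Longrightarrow> x' \<in> coord_space n \<Longrightarrow> y \<in> coord_space n
        \<Longrightarrow> \<bar>F (x + x') y - F x y - F x' y\<bar> \<le> K * (lp_norm p n x + lp_norm p n x') * lp_norm p n y"
    and addr: "\<And>x y y'. x \<in> coord_space n \<Longrightarrow> y \<in> coord_space n \<Longrightarrow> y' \<in> coord_space n
        \<Longrightarrow> \<bar>F x (y + y') - F x y - F x y'\<bar> \<le> K * lp_norm p n x * (lp_norm p n y + lp_norm p n y')"
    and bdd: "\<And>x y. x \<in> coord_space n \<Longrightarrow> y \<in> coord_space n \<Longrightarrow> \<bar>F x y\<bar> \<le> M * (lp_norm p n x * lp_norm p n y)"
    and A: "finite A" "card A \<le> 2 ^ d" and K: "K \<ge> 0"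
    and XY: "\<And>i. i \<in> A \<Longrightarrow> X i \<in> coord_space n" "\<And>i. i \<in> A \<Longrightarrow> Y i \<in> coord_space n"
      "\<And>i. i \<in> A \<Longrightarrow> (lp_norm p n (X i))\<^sup>2 \<le> a i" "\<And>i. i \<in> A \<Longrightarrow> (lp_norm p n (Y i))\<^sup>2 \<le> a i"
  shows "\<bar>integral\<^sup>L (gaussian A) (\<lambda>w. F (\<Sum>i\<in>A. w i *\<^sub>R X i) (\<Sum>i\<in>A. w i *\<^sub>R Y i)) - (\<Sum>i\<in>A. F (X i) (Y i))\<bar>
    \<le> 4 * K * (1 + abs_moment p) * real d * (\<Sum>i\<in>A. a i)"
proof -
  define U where "U S w = (\<Sum>i\<in>S. w i *\<^sub>R X i)" for S and w :: "'i \<Rightarrow> real"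
  define V where "V S w = (\<Sum>i\<in>S. w i *\<^sub>R Y i)" for S and w :: "'i \<Rightarrow> real"
  define H where "H S = integral\<^sup>L (gaussian A) (\<lambda>w. F (U S w) (V S w))" for S
  define wt where "wt S = (\<Sum>i\<in>S. \<bar>a i\<bar>)" for S
  let ?N = "lp_norm p n" and ?\<tau> = "1 + abs_moment p"
  have p1: "p \<ge> 1" using p by simp
  have a0: "a i \<ge> 0" if "i \<in> A" for i using XY(3)[OF that] order_trans[OF zero_le_power2] by blast
  have coordU: "U S w \<in> coord_space n" if "S \<subseteq> A" for S w
    unfolding U_def using that XY(1) by (intro coord_space_sum coord_space_closed) blast
  have coordV: "V S w \<in> coord_space n" if "S \<subseteq> A" for S w
    unfolding V_def using that XY(2) by (intro coord_space_sum coord_space_closed) blast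
  have intU: "integrable (gaussian A) (\<lambda>w. (?N (U S w))\<^sup>2)" if "S \<subseteq> A" for S
    unfolding U_def by (rule gaussian_type_2(1)[OF A(1) that p])
  have intV: "integrable (gaussian A) (\<lambda>w. (?N (V S w))\<^sup>2)" if "S \<subseteq> A" for S
    unfolding V_def by (rule gaussian_type_2(1)[OF A(1) that p])
  have \<tau>: "?\<tau> \<ge> 0" using abs_moment_nonneg[of p] by linarith
  have momU: "integral\<^sup>L (gaussian A) (\<lambda>w. (?N (U S w))\<^sup>2) \<le> ?\<tau> * wt S" if S: "S \<subseteq> A" for S
  proof -
    have "integral\<^sup>L (gaussian A) (\<lambda>w. (?N (U S w))\<^sup>2) \<le> ?\<tau> * (\<Sum>i\<in>S. (?N (X i))\<^sup>2)"
      unfolding U_def by (rule gaussian_type_2(2)[OF A(1) S p])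
    also have "\<dots> \<le> ?\<tau> * wt S" unfolding wt_def
      by (rule mult_left_mono[OF sum_mono \<tau>]) (use XY(3) S in \<open>fastforce intro: order_trans[OF _ abs_ge_self]\<close>)
    finally show ?thesis .
  qed
  have momV: "integral\<^sup>L (gaussian A) (\<lambda>w. (?N (V S w))\<^sup>2) \<le> ?\<tau> * wt S" if S: "S \<subseteq> A" for S
  proof -
    have "integral\<^sup>L (gaussian A) (\<lambda>w. (?N (V S w))\<^sup>2) \<le> ?\<tau> * (\<Sum>i\<in>S. (?N (Y i))\<^sup>2)"
      unfolding V_def by (rule gaussian_type_2(2)[OF A(1) S p])
    also have "\<dots> \<le> ?\<tau> * wt S" unfolding wt_def
      by (rule mult_left_mono[OF sum_mono \<tau>]) (use XY(4) S in \<open>fastforce intro: order_trans[OF _ abs_ge_self]\<close>)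
    finally show ?thesis .
  qed
  have intF: "integrable (gaussian A) (\<lambda>w. F (U S w) (V T w))" if ST: "S \<subseteq> A" "T \<subseteq> A" for S T
  proof (rule Bochner_Integration.integrable_bound)
    show "integrable (gaussian A) (\<lambda>w. \<bar>M\<bar> * ((?N (U S w))\<^sup>2 + (?N (V T w))\<^sup>2))"
      by (intro integrable_mult_right Bochner_Integration.integrable_add intU intV ST)
    show "(\<lambda>w. F (U S w) (V T w)) \<in> borel_measurable (gaussian A)"
      unfolding U_def V_def by (rule measurable_gaussian_bilinear[OF F ST])
    have "norm (F (U S w) (V T w)) \<le> norm (\<bar>M\<bar> * ((?N (U S w))\<^sup>2 + (?N (V T w))\<^sup>2))" for w
    proof -
      have "\<bar>F (U S w) (V T w)\<bar> \<le> M * (?N (U S w) * ?N (V T w))" by (rule bdd[OF coordU[OF ST(1)] coordV[OF ST(2)]])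
      also have "\<dots> \<le> \<bar>M\<bar> * (?N (U S w) * ?N (V T w))" by (rule mult_right_mono) auto
      also have "\<dots> \<le> \<bar>M\<bar> * ((?N (U S w))\<^sup>2 + (?N (V T w))\<^sup>2)"
        using mult_add_le_sum_squares[of "?N (U S w)" 0 "?N (V T w)" 0] by (intro mult_left_mono) auto
      finally show ?thesis unfolding real_norm_def by (rule order_trans[OF _ abs_ge_self])
    qed
    then show "AE w in gaussian A. norm (F (U S w) (V T w)) \<le> norm (\<bar>M\<bar> * ((?N (U S w))\<^sup>2 + (?N (V T w))\<^sup>2))"
      by (rule AE_I2)
  qed
  have cross: "integral\<^sup>L (gaussian A) (\<lambda>w. F (U S w) (V T w)) = 0" if "S \<subseteq> A" "T \<subseteq> A" "S \<inter> T = {}" for S T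
    unfolding U_def V_def
    by (rule gaussian_odd_cross_term[OF F _ that A(1)]) (use homl[of "-1"] in simp)
  have "\<bar>H A - (\<Sum>i\<in>A. H {i})\<bar> \<le> 4 * K * ?\<tau> * real d * wt A"
  proof (rule quasi_additive_tree)
    fix S T assume ST: "S \<subseteq> A" "T \<subseteq> A" "S \<inter> T = {}"
    have fin: "finite S" "finite T" using ST A(1) finite_subset by blast+
    show wST: "wt (S \<union> T) = wt S + wt T" unfolding wt_def by (rule sum.union_disjoint[OF fin ST(3)])
    have UST: "U (S \<union> T) w = U S w + U T w" for w unfolding U_def by (rule sum.union_disjoint[OF fin ST(3)])
    have VST: "V (S \<union> T) w = V S w + V T w" for w unfolding V_def by (rule sum.union_disjoint[OF fin ST(3)])
    define E where "E w = F (U (S \<union> T) w) (V (S \<union> T) w) - F (U S w) (V S w) - F (U T w) (V T w)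
      - F (U S w) (V T w) - F (U T w) (V S w)" for w
    define G where "G w = 2 * K * (((?N (U S w))\<^sup>2 + (?N (U T w))\<^sup>2) + ((?N (V S w))\<^sup>2 + (?N (V T w))\<^sup>2))" for w
    have sub: "S \<union> T \<subseteq> A" using ST by blast
    have EG: "\<bar>E w\<bar> \<le> G w" for w
    proof -
      let ?a = "U S w" and ?b = "U T w" and ?c = "V S w" and ?d = "V T w"
      note co = coordU[OF ST(1), of w] coordU[OF ST(2), of w] coordV[OF ST(1), of w] coordV[OF ST(2), of w]
      have 1: "\<bar>F (?a + ?b) (?c + ?d) - F ?a (?c + ?d) - F ?b (?c + ?d)\<bar> \<le> K * ((?N ?a + ?N ?b) * (?N ?c + ?N ?d))"
      proof -
        have "\<bar>F (?a + ?b) (?c + ?d) - F ?a (?c + ?d) - F ?b (?c + ?d)\<bar> \<le> K * (?N ?a + ?N ?b) * ?N (?c + ?d)"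
          by (rule addl) (use co in \<open>auto intro: coord_space_closed\<close>)
        also have "\<dots> \<le> K * (?N ?a + ?N ?b) * (?N ?c + ?N ?d)"
          using K by (intro mult_left_mono lp_norm_triangle[OF p1]) auto
        finally show ?thesis by (simp add: mult.assoc)
      qed
      have 2: "\<bar>F ?a (?c + ?d) - F ?a ?c - F ?a ?d\<bar> \<le> K * (?N ?a * (?N ?c + ?N ?d))"
        using addr[OF co(1,3,4)] by (simp add: mult.assoc)
      have 3: "\<bar>F ?b (?c + ?d) - F ?b ?c - F ?b ?d\<bar> \<le> K * (?N ?b * (?N ?c + ?N ?d))"
        using addr[OF co(2,3,4)] by (simp add: mult.assoc)
      have "\<bar>E w\<bar> \<le> K * ((?N ?a + ?N ?b) * (?N ?c + ?N ?d)) + K * (?N ?a * (?N ?c + ?N ?d)) + K * (?N ?b * (?N ?c + ?N ?d))"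
        unfolding E_def UST VST using 1 2 3 by linarith
      also have "\<dots> = 2 * K * ((?N ?a + ?N ?b) * (?N ?c + ?N ?d))" by (simp add: algebra_simps)
      also have "\<dots> \<le> G w" unfolding G_def using K by (intro mult_left_mono mult_add_le_sum_squares) auto
      finally show ?thesis .
    qed
    have intG: "integrable (gaussian A) G" unfolding G_def
      by (intro integrable_mult_right Bochner_Integration.integrable_add intU intV ST)
    have intE: "integrable (gaussian A) E" unfolding E_def
      by (intro Bochner_Integration.integrable_diff intF ST sub)
    have "integral\<^sup>L (gaussian A) E = H (S \<union> T) - H S - H T - integral\<^sup>L (gaussian A) (\<lambda>w. F (U S w) (V T w))
        - integral\<^sup>L (gaussian A) (\<lambda>w. F (U T w) (V S w))"
      unfolding E_def H_def
      by (simp only: Bochner_Integration.integral_diff Bochner_Integration.integrable_diff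
          intF[OF sub sub] intF[OF ST(1,1)] intF[OF ST(2,2)] intF[OF ST(1,2)] intF[OF ST(2,1)])
    also have "\<dots> = H (S \<union> T) - H S - H T"
      using cross[OF ST] cross[OF ST(2,1)] ST(3) by (simp add: Int_commute)
    finally have "\<bar>H (S \<union> T) - H S - H T\<bar> = \<bar>integral\<^sup>L (gaussian A) E\<bar>" by simp
    also have "\<dots> \<le> integral\<^sup>L (gaussian A) (\<lambda>w. \<bar>E w\<bar>)" by (rule integral_abs_bound)
    also have "\<dots> \<le> integral\<^sup>L (gaussian A) G"
      by (rule integral_mono[OF integrable_abs[OF intE] intG EG])
    also have "\<dots> = 2 * K * ((integral\<^sup>L (gaussian A) (\<lambda>w. (?N (U S w))\<^sup>2) + integral\<^sup>L (gaussian A) (\<lambda>w. (?N (U T w))\<^sup>2))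
        + (integral\<^sup>L (gaussian A) (\<lambda>w. (?N (V S w))\<^sup>2) + integral\<^sup>L (gaussian A) (\<lambda>w. (?N (V T w))\<^sup>2)))"
      unfolding G_def
      by (simp only: Bochner_Integration.integral_add Bochner_Integration.integrable_add integral_mult_right_zero
          intU[OF ST(1)] intU[OF ST(2)] intV[OF ST(1)] intV[OF ST(2)])
    also have "\<dots> \<le> 2 * K * ((?\<tau> * wt S + ?\<tau> * wt T) + (?\<tau> * wt S + ?\<tau> * wt T))"
      using K by (intro mult_left_mono add_mono momU momV ST) auto
    also have "\<dots> = 4 * K * ?\<tau> * wt (S \<union> T)" by (simp add: wST algebra_simps)
    finally show "\<bar>H (S \<union> T) - H S - H T\<bar> \<le> 4 * K * ?\<tau> * wt (S \<union> T)" .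
  next
    have "F (U {} w) (V {} w) = 0" for w using homl[of 0 0] by (simp add: U_def zero_fun_def)
    then show "H {} = 0" by (simp add: H_def)
    show "wt S \<ge> 0" for S by (simp add: wt_def sum_nonneg)
  qed (use A K \<tau> in auto)
  moreover have "H {i} = F (X i) (Y i)" if "i \<in> A" for i
  proof -
    have "H {i} = integral\<^sup>L (gaussian A) (\<lambda>w. (w i)\<^sup>2 * F (X i) (Y i))"
      unfolding H_def U_def V_def by (simp add: homl homr power2_eq_square mult.assoc)
    also have "\<dots> = F (X i) (Y i)" using gaussian_second_moment[OF A(1) that] by simp
    finally show ?thesis .
  qed
  moreover have "wt A = (\<Sum>i\<in>A. a i)" unfolding wt_def using a0 by (intro sum.cong) auto
  ultimately show ?thesis by (simp add: H_def U_def V_def)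
qed

text \<open>
  As for linear forms, duality reduces the claim to at most \<open>n\<^sup>2 + 1\<close> pairs with
  \<open>\<Sum>a s * x s \<otimes> y s = 0\<close>. These are the summands of Gaussian vectors \<open>X\<close> and \<open>Y\<close> without
  correlation, so at the root of the binary tree the mean is zero.
\<close>
lemma bilinear_approximation:
  fixes D :: "(nat \<Rightarrow> real) \<Rightarrow> (nat \<Rightarrow> real) \<Rightarrow> real"
  assumes p: "p \<ge> 2"
    and D: "(\<lambda>(x, y). D x y) \<in> borel_measurable (borel \<Otimes>\<^sub>M borel)"
    and addl: "\<And>y. y \<in> lp_ball p n \<Longrightarrow> approx_additive p n K (\<lambda>x. D x y)"
    and addr: "\<And>x. x \<in> lp_ball p n \<Longrightarrow> approx_additive p n K (D x)"
    and b: "\<And>x y. x \<in> lp_ball p n \<Longrightarrow> y \<in> lp_ball p n \<Longrightarrow> \<bar>D x y\<bar> \<le> b"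
    and d: "n * n + 1 \<le> 2 ^ d" and K: "K \<ge> 0"
  shows "\<exists>c. \<forall>x\<in>lp_ball p n. \<forall>y\<in>lp_ball p n.
    \<bar>D x y - (\<Sum>j<n. \<Sum>k<n. c (j, k) * (x j * y k))\<bar> \<le> (100 * (1 + abs_moment p) * real d + 8) * K"
proof -
  let ?N = "lp_norm p n" and ?B = "lp_ball p n"
  have p0: "p > 0" and p1: "p \<ge> 1" using p by auto
  define E where "E x y = homogenize p n (D x) y" for x y
  define F where "F x y = homogenize p n (\<lambda>x. E x y) x" for x y
  have homl: "F (c *\<^sub>R x) y = c * F x y" for c x y
    unfolding F_def by (rule homogenize_scaleR[OF p0])
  have homE: "E x (c *\<^sub>R y) = c * E x y" for c x y
    unfolding E_def by (rule homogenize_scaleR[OF p0])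
  have homr: "F x (c *\<^sub>R y) = c * F x y" for c x y
    unfolding F_def homogenize_def homE by (simp add: algebra_simps)
  have ED: "\<bar>E x y - D x y\<bar> \<le> 4 * K" if "x \<in> ?B" "y \<in> ?B" for x y
    unfolding E_def by (rule homogenize_close[OF p1 addr[OF that(1)] b[OF that(1)] that(2)])
  have Eadd: "approx_additive p n K (\<lambda>x. E x y)" if y: "y \<in> ?B" for y
    unfolding approx_additive_def
  proof (intro ballI impI)
    fix x x' assume x: "x \<in> ?B" "x' \<in> ?B" "x + x' \<in> ?B"
    let ?v = "(1 / ?N y) *\<^sub>R y"
    have v: "?v \<in> ?B" "- ?v \<in> ?B" using lp_ball_normalize[OF p0, of y n] y by (auto simp: mem_lp_ball)
    have "\<bar>D (x + x') ?v - D x ?v - D x' ?v\<bar> \<le> K" "\<bar>D (x + x') (- ?v) - D x (- ?v) - D x' (- ?v)\<bar> \<le> K"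
      using approx_additiveD[OF addl[OF v(1)] x] approx_additiveD[OF addl[OF v(2)] x] .
    then have le: "\<bar>(D (x + x') ?v - D x ?v - D x' ?v - (D (x + x') (- ?v) - D x (- ?v) - D x' (- ?v))) / 2\<bar> \<le> K"
      by (simp add: abs_le_iff)
    have "E (x + x') y - E x y - E x' y
        = ?N y * ((D (x + x') ?v - D x ?v - D x' ?v - (D (x + x') (- ?v) - D x (- ?v) - D x' (- ?v))) / 2)"
      unfolding E_def homogenize_def by (simp only: right_diff_distrib diff_divide_distrib)
    also have "\<bar>\<dots>\<bar> \<le> 1 * K" unfolding abs_mult using y le by (intro mult_mono) (auto simp: mem_lp_ball)
    finally show "\<bar>E (x + x') y - E x y - E x' y\<bar> \<le> K" by simp
  qed
  have Eb: "\<bar>E x y\<bar> \<le> b + 4 * K" if "x \<in> ?B" "y \<in> ?B" for x y using ED[OF that] b[OF that] by linarith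
  have FE: "\<bar>F x y - E x y\<bar> \<le> 4 * K" if "x \<in> ?B" "y \<in> ?B" for x y
    unfolding F_def by (rule homogenize_close[OF p1 Eadd[OF that(2)] Eb[OF _ that(2)] that(1)])
  have FD: "\<bar>F x y - D x y\<bar> \<le> 8 * K" if "x \<in> ?B" "y \<in> ?B" for x y
    using FE[OF that] ED[OF that] by linarith
  note unit = lp_norm_scaleR_normalize[of _ n p, symmetric]
  have e25: "3 * (8 * K) + K = 25 * K" by simp
  have Faddl: "\<bar>F (x + x') y - F x y - F x' y\<bar> \<le> 25 * K * (?N x + ?N x') * ?N y"
    if co: "x \<in> coord_space n" "x' \<in> coord_space n" "y \<in> coord_space n" for x x' y
  proof -
    let ?v = "(1 / ?N y) *\<^sub>R y"
    have v: "?v \<in> ?B" by (rule lp_ball_normalize[OF p0 co(3)])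
    have "\<bar>F (x + x') ?v - F x ?v - F x' ?v\<bar> \<le> (3 * (8 * K) + K) * (?N x + ?N x')"
      by (rule homogeneous_quasi_additive[where F="\<lambda>x. F x ?v", OF p1 addl[OF v] homl FD[OF _ v] co(1,2)])
    then have "\<bar>F (x + x') ?v - F x ?v - F x' ?v\<bar> * ?N y \<le> 25 * K * (?N x + ?N x') * ?N y"
      unfolding e25 by (rule mult_right_mono) simp
    moreover have "F z y = F z ?v * ?N y" for z using homr[of z "?N y" ?v] unit[OF co(3)] by simp
    ultimately show ?thesis by (simp add: left_diff_distrib[symmetric] abs_mult)
  qed
  have Faddr: "\<bar>F x (y + y') - F x y - F x y'\<bar> \<le> 25 * K * ?N x * (?N y + ?N y')"
    if co: "x \<in> coord_space n" "y \<in> coord_space n" "y' \<in> coord_space n" for x y y'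
  proof -
    let ?v = "(1 / ?N x) *\<^sub>R x"
    have v: "?v \<in> ?B" by (rule lp_ball_normalize[OF p0 co(1)])
    have "\<bar>F ?v (y + y') - F ?v y - F ?v y'\<bar> \<le> (3 * (8 * K) + K) * (?N y + ?N y')"
      by (rule homogeneous_quasi_additive[where F="F ?v", OF p1 addr[OF v] homr FD[OF v] co(2,3)])
    then have "\<bar>F ?v (y + y') - F ?v y - F ?v y'\<bar> * ?N x \<le> 25 * K * (?N y + ?N y') * ?N x"
      unfolding e25 by (rule mult_right_mono) simp
    moreover have "F x z = F ?v z * ?N x" for z using homl[of "?N x" ?v z] unit[OF co(1)] by simp
    ultimately have "\<bar>F x (y + y') - F x y - F x y'\<bar> \<le> 25 * K * (?N y + ?N y') * ?N x"
      by (simp add: left_diff_distrib[symmetric] abs_mult)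
    moreover have "25 * K * ?N x * (?N y + ?N y') = 25 * K * (?N y + ?N y') * ?N x" by simp
    ultimately show ?thesis by (rule ord_le_eq_trans[OF _ sym])
  qed
  have Fb: "\<bar>F x y\<bar> \<le> (b + 8 * K) * (?N x * ?N y)" if co: "x \<in> coord_space n" "y \<in> coord_space n" for x y
  proof -
    let ?u = "(1 / ?N x) *\<^sub>R x" and ?v = "(1 / ?N y) *\<^sub>R y"
    have u: "?u \<in> ?B" and v: "?v \<in> ?B" by (rule lp_ball_normalize[OF p0], rule co)+
    have "F x y = ?N x * (?N y * F ?u ?v)"
      using homl[of "?N x" ?u y] homr[of ?u "?N y" ?v] unit[OF co(1)] unit[OF co(2)] by simp
    then have "\<bar>F x y\<bar> = \<bar>F ?u ?v\<bar> * (?N x * ?N y)" by (simp add: abs_mult)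
    also have "\<dots> \<le> (b + 8 * K) * (?N x * ?N y)"
      using FD[OF u v] b[OF u v] by (intro mult_right_mono) auto
    finally show ?thesis .
  qed
  have Fm: "(\<lambda>(x, y). F x y) \<in> borel_measurable (borel \<Otimes>\<^sub>M borel)"
  proof -
    let ?M = "borel \<Otimes>\<^sub>M borel :: ((nat \<Rightarrow> real) \<times> (nat \<Rightarrow> real)) measure"
    have co: "(\<lambda>z. fst z j) \<in> borel_measurable ?M" "(\<lambda>z. snd z j) \<in> borel_measurable ?M" for j
      by (rule measurable_compose[OF measurable_fst measurable_product_coordinates],
          rule measurable_compose[OF measurable_snd measurable_product_coordinates])
    have N: "(\<lambda>z. ?N (fst z)) \<in> borel_measurable ?M" "(\<lambda>z. ?N (snd z)) \<in> borel_measurable ?M"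
      by (rule measurable_compose[OF measurable_fst measurable_lp_norm],
          rule measurable_compose[OF measurable_snd measurable_lp_norm])
    have u: "(\<lambda>z. (s / ?N (fst z)) *\<^sub>R fst z) \<in> ?M \<rightarrow>\<^sub>M borel" for s
      by (rule measurable_coordinatewise_then_product)
        (simp only: scaleR_fun_apply real_scaleR_def, intro borel_measurable_times borel_measurable_divide N co borel_measurable_const)
    have v: "(\<lambda>z. (s / ?N (snd z)) *\<^sub>R snd z) \<in> ?M \<rightarrow>\<^sub>M borel" for s
      by (rule measurable_coordinatewise_then_product)
        (simp only: scaleR_fun_apply real_scaleR_def, intro borel_measurable_times borel_measurable_divide N co borel_measurable_const)
    have DD: "(\<lambda>z. D ((s / ?N (fst z)) *\<^sub>R fst z) ((t / ?N (snd z)) *\<^sub>R snd z)) \<in> borel_measurable ?M" for s t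
      using measurable_compose[OF measurable_Pair[OF u[of s] v[of t]] D] by (simp only: prod.case)
    have neg: "- ((1 / c) *\<^sub>R x) = (- 1 / c) *\<^sub>R x" for c and x :: "nat \<Rightarrow> real" by simp
    show ?thesis
      unfolding F_def E_def homogenize_def neg case_prod_beta
      by (intro borel_measurable_times borel_measurable_divide borel_measurable_diff borel_measurable_const DD N)
  qed
  let ?J = "{..<n} \<times> {..<n}" and ?v = "\<lambda>s jk. fst s (fst jk) * snd s (snd jk) :: real"
  let ?C = "100 * (1 + abs_moment p) * real d * K"
  have C0: "?C \<ge> 0" using K abs_moment_nonneg[of p] by simp
  have "\<exists>c. \<forall>s\<in>?B \<times> ?B. \<bar>F (fst s) (snd s) - (\<Sum>jk\<in>?J. c jk * ?v s jk)\<bar> \<le> ?C"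
  proof (rule best_approximation_duality[where v="?v"])
    fix A and a :: "(nat \<Rightarrow> real) \<times> (nat \<Rightarrow> real) \<Rightarrow> real"
    assume A: "A \<subseteq> ?B \<times> ?B" "finite A" "\<forall>jk\<in>?J. (\<Sum>s\<in>A. a s * ?v s jk) = 0"
    show "\<bar>\<Sum>s\<in>A. a s * F (fst s) (snd s)\<bar> \<le> ?C * (\<Sum>s\<in>A. \<bar>a s\<bar>)"
    proof (rule annihilator_bound_by_small_supports[where v="?v" and J="?J" and S="?B \<times> ?B"])
      fix A and a :: "(nat \<Rightarrow> real) \<times> (nat \<Rightarrow> real) \<Rightarrow> real"
      assume A: "A \<subseteq> ?B \<times> ?B" "finite A" "card A \<le> Suc (card ?J)" "\<forall>jk\<in>?J. (\<Sum>s\<in>A. a s * ?v s jk) = 0"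
      (* The scaling makes the tensor product of X s and Y s equal to a s times that of the pair s,
         and bounds both squared norms by the absolute value of a s. *)
      define X where "X s = sqrt \<bar>a s\<bar> *\<^sub>R fst s" for s
      define Y where "Y s = (sgn (a s) * sqrt \<bar>a s\<bar>) *\<^sub>R snd s" for s
      have asq: "sqrt \<bar>a s\<bar> * (sgn (a s) * sqrt \<bar>a s\<bar>) = a s" for s
        by (simp add: mult.left_commute sgn_mult_abs)
      have mem: "fst s \<in> coord_space n" "snd s \<in> coord_space n" "?N (fst s) \<le> 1" "?N (snd s) \<le> 1" if "s \<in> A" for s
        using A(1) that by (auto simp: mem_lp_ball)
      have "\<bar>integral\<^sup>L (gaussian A) (\<lambda>w. F (\<Sum>s\<in>A. w s *\<^sub>R X s) (\<Sum>s\<in>A. w s *\<^sub>R Y s)) - (\<Sum>s\<in>A. F (X s) (Y s))\<bar>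
          \<le> 4 * (25 * K) * (1 + abs_moment p) * real d * (\<Sum>s\<in>A. \<bar>a s\<bar>)"
      proof (rule gaussian_bilinear_tree[OF p Fm homl homr Faddl Faddr Fb A(2)])
        show "card A \<le> 2 ^ d" using A(3) d by (simp add: card_cartesian_product)
        fix s assume s: "s \<in> A"
        show "X s \<in> coord_space n" "Y s \<in> coord_space n" using mem[OF s] by (auto simp: X_def Y_def)
        have sg: "\<bar>sgn (a s)\<bar> * sqrt \<bar>a s\<bar> = sqrt \<bar>a s\<bar>" by (simp add: sgn_if)
        have "(?N z)\<^sup>2 \<le> 1" if "?N z \<le> 1" for z using that by (simp add: power_le_one)
        then show "(?N (X s))\<^sup>2 \<le> \<bar>a s\<bar>" "(?N (Y s))\<^sup>2 \<le> \<bar>a s\<bar>"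
          using mem[OF s] p0 unfolding X_def Y_def
          by (simp_all add: abs_mult sg power_mult_distrib mult_left_le)
      qed (use K in auto)
      moreover have "integral\<^sup>L (gaussian A) (\<lambda>w. F (\<Sum>s\<in>A. w s *\<^sub>R X s) (\<Sum>s\<in>A. w s *\<^sub>R Y s)) = 0"
      proof (rule gaussian_uncorrelated_vanishes[OF Fm _ A(2)])
        show "F (- x) y = - F x y" for x y using homl[of "-1" x y] by simp
        show "X s j = 0" if "s \<in> A" "j \<ge> n" for s j using mem(1)[OF that(1)] that(2) by (simp add: X_def coord_space_def)
        show "(\<Sum>s\<in>A. X s j * Y s k) = 0" for j k
        proof -
          have "(\<Sum>s\<in>A. X s j * Y s k) = (\<Sum>s\<in>A. a s * (fst s j * snd s k))"
          proof (rule sum.cong[OF refl])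
            fix s
            have "X s j * Y s k = (sqrt \<bar>a s\<bar> * (sgn (a s) * sqrt \<bar>a s\<bar>)) * (fst s j * snd s k)"
              by (simp add: X_def Y_def mult_ac)
            then show "X s j * Y s k = a s * (fst s j * snd s k)" unfolding asq .
          qed
          also have "\<dots> = 0"
          proof (cases "j < n \<and> k < n")
            case True then show ?thesis using A(4) by auto
          next
            case False
            then show ?thesis using mem(1,2) by (intro sum.neutral) (auto simp: coord_space_def not_less)
          qed
          finally show ?thesis .
        qed
      qed
      moreover have "F (X s) (Y s) = a s * F (fst s) (snd s)" for s
        unfolding X_def Y_def homl homr
        using arg_cong[OF asq[of s], of "\<lambda>t. t * F (fst s) (snd s)"] by (simp only: mult_ac)
      ultimately show "\<bar>\<Sum>s\<in>A. a s * F (fst s) (snd s)\<bar> \<le> ?C * (\<Sum>s\<in>A. \<bar>a s\<bar>)"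
        by (simp add: mult_ac)
    qed (use A in auto)
  qed (use C0 in auto)
  then obtain c where c: "\<forall>s\<in>?B \<times> ?B. \<bar>F (fst s) (snd s) - (\<Sum>jk\<in>?J. c jk * ?v s jk)\<bar> \<le> ?C" by blast
  show ?thesis
  proof (intro exI[of _ c] ballI)
    fix x y assume xy: "x \<in> ?B" "y \<in> ?B"
    have "(\<Sum>jk\<in>?J. c jk * ?v (x, y) jk) = (\<Sum>j<n. \<Sum>k<n. c (j, k) * (x j * y k))"
      by (simp add: sum.cartesian_product case_prod_beta)
    moreover have "\<bar>F x y - (\<Sum>jk\<in>?J. c jk * ?v (x, y) jk)\<bar> \<le> ?C"
      using bspec[OF c SigmaI[OF xy]] by (simp only: fst_conv snd_conv)
    ultimately have "\<bar>D x y - (\<Sum>j<n. \<Sum>k<n. c (j, k) * (x j * y k))\<bar> \<le> ?C + 8 * K"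
      using FD[OF xy] by linarith
    then show "\<bar>D x y - (\<Sum>j<n. \<Sum>k<n. c (j, k) * (x j * y k))\<bar> \<le> (100 * (1 + abs_moment p) * real d + 8) * K"
      by (simp add: algebra_simps)
  qed
qed

section \<open>Mixed differences and multilinear forms\<close>
fun mixed_diff :: "(nat \<Rightarrow> real) list \<Rightarrow> ((nat \<Rightarrow> real) \<Rightarrow> real) \<Rightarrow> (nat \<Rightarrow> real) \<Rightarrow> real" where
  "mixed_diff [] f x = f x"
| "mixed_diff (h # hs) f x = mixed_diff hs (\<lambda>y. f (y + h) - f y) x"

lemma mixed_diff_diff:
  "mixed_diff hs (\<lambda>y. f y - g y) x = mixed_diff hs f x - mixed_diff hs g x"
proof (induction hs arbitrary: f g)
  case (Cons h hs)
  have eq: "(\<lambda>y. f (y + h) - g (y + h) - (f y - g y)) = (\<lambda>y. (f (y + h) - f y) - (g (y + h) - g y))"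
    by (simp add: fun_eq_iff)
  show ?case unfolding mixed_diff.simps eq by (rule Cons.IH)
qed simp

lemma mixed_diff_translate:
  "mixed_diff hs (\<lambda>y. f (y + h)) x = mixed_diff hs f (x + h)"
proof (induction hs arbitrary: f)
  case (Cons a hs)
  have eq: "(\<lambda>y. f (y + a + h) - f (y + h)) = (\<lambda>y. (\<lambda>z. f (z + a) - f z) (y + h))"
    by (simp add: add_ac)
  show ?case unfolding mixed_diff.simps eq by (rule Cons.IH)
qed simp

lemma mixed_diff_Cons:
  "mixed_diff (h # hs) f x = mixed_diff hs f (x + h) - mixed_diff hs f x"
  by (simp only: mixed_diff.simps mixed_diff_diff mixed_diff_translate)

text \<open>
  This is why bounded differences of order \<open>k + 1\<close> make those of order \<open>k\<close> approximately additive in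
  each argument.
\<close>
lemma mixed_diff_add:
  "mixed_diff ((x + y) # hs) f z - mixed_diff (x # hs) f z - mixed_diff (y # hs) f z
    = mixed_diff (x # y # hs) f z"
proof -
  have "z + x + y = z + (x + y)" by (rule add.assoc)
  then show ?thesis by (simp only: mixed_diff_Cons)
qed

text \<open>
  The coefficients are stored by recursion on the number of arguments, the first argument being expanded
  in coordinates. Only lists of length \<open>k\<close> are meant as arguments.
\<close>
fun multilinear_forms :: "nat \<Rightarrow> nat \<Rightarrow> ((nat \<Rightarrow> real) list \<Rightarrow> real) set" where
  "multilinear_forms n 0 = {M. \<exists>c. M = (\<lambda>_. c)}"
| "multilinear_forms n (Suc k) =
    {M. \<exists>G. (\<forall>j<n. G j \<in> multilinear_forms n k) \<and> M = (\<lambda>xs. \<Sum>j<n. hd xs j * G j (tl xs))}"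

lemma multilinear_forms_sum:
  assumes "finite I" "\<And>i. i \<in> I \<Longrightarrow> M i \<in> multilinear_forms n k"
  shows "(\<lambda>xs. \<Sum>i\<in>I. c i * M i xs) \<in> multilinear_forms n k"
  using assms(2)
proof (induction k arbitrary: M c)
  case 0
  then have "\<forall>i. \<exists>b. i \<in> I \<longrightarrow> M i = (\<lambda>_. b)" by auto
  then obtain b where b: "\<And>i. i \<in> I \<Longrightarrow> M i = (\<lambda>_. b i)" by metis
  have "(\<lambda>xs. \<Sum>i\<in>I. c i * M i xs) = (\<lambda>_. \<Sum>i\<in>I. c i * b i)"
    by (intro ext sum.cong) (auto simp: b)
  then show ?case by auto
next
  case (Suc k)
  then have "\<forall>i. \<exists>G. i \<in> I \<longrightarrow> (\<forall>j<n. G j \<in> multilinear_forms n k) \<and> M i = (\<lambda>xs. \<Sum>j<n. hd xs j * G j (tl xs))"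
    by simp
  then obtain G where G: "\<And>i j. i \<in> I \<Longrightarrow> j < n \<Longrightarrow> G i j \<in> multilinear_forms n k"
    "\<And>i. i \<in> I \<Longrightarrow> M i = (\<lambda>xs. \<Sum>j<n. hd xs j * G i j (tl xs))" by metis
  have "(\<lambda>xs. \<Sum>i\<in>I. c i * M i xs) = (\<lambda>xs. \<Sum>j<n. hd xs j * (\<Sum>i\<in>I. c i * G i j (tl xs)))"
  proof
    fix xs
    have "(\<Sum>i\<in>I. c i * M i xs) = (\<Sum>i\<in>I. \<Sum>j<n. hd xs j * (c i * G i j (tl xs)))"
      by (intro sum.cong refl) (simp add: G(2) sum_distrib_left mult.left_commute)
    also have "\<dots> = (\<Sum>j<n. \<Sum>i\<in>I. hd xs j * (c i * G i j (tl xs)))" by (rule sum.swap)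
    finally show "(\<Sum>i\<in>I. c i * M i xs) = (\<Sum>j<n. hd xs j * (\<Sum>i\<in>I. c i * G i j (tl xs)))"
      by (simp add: sum_distrib_left)
  qed
  moreover have "(\<lambda>xs. \<Sum>i\<in>I. c i * G i j xs) \<in> multilinear_forms n k" if "j < n" for j
    by (rule Suc.IH) (rule G(1)[OF _ that])
  ultimately show ?case unfolding multilinear_forms.simps mem_Collect_eq
    by (intro exI[of _ "\<lambda>j xs. \<Sum>i\<in>I. c i * G i j xs"] conjI allI impI)
qed

text \<open>
  This is what survives of continuity: measurability gives the Gaussian means a meaning, and local
  boundedness gives finite suprema. No estimate depends on the size of these bounds.
\<close>
definition tame :: "real \<Rightarrow> nat \<Rightarrow> ((nat \<Rightarrow> real) \<Rightarrow> real) \<Rightarrow> bool" where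
  "tame p n f \<longleftrightarrow> f \<in> borel_measurable borel \<and> (\<forall>R. \<exists>b. \<forall>x\<in>coord_space n. lp_norm p n x \<le> R \<longrightarrow> \<bar>f x\<bar> \<le> b)"

lemma tame_bound:
  assumes "tame p n f" obtains b where "\<And>x. x \<in> coord_space n \<Longrightarrow> lp_norm p n x \<le> R \<Longrightarrow> \<bar>f x\<bar> \<le> b"
  using assms unfolding tame_def by metis

lemma tame_difference:
  assumes p: "p \<ge> 1" and f: "tame p n f" and h: "h \<in> coord_space n"
  shows "tame p n (\<lambda>y. f (y + h) - f y)"
  unfolding tame_def
proof (intro conjI allI)
  have fm: "f \<in> borel_measurable borel" by (rule f[unfolded tame_def, THEN conjunct1])
  have "(\<lambda>y::nat \<Rightarrow> real. y + h) \<in> borel \<rightarrow>\<^sub>M borel"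
    by (rule measurable_coordinatewise_then_product)
      (simp only: plus_fun_apply, intro borel_measurable_add measurable_product_coordinates borel_measurable_const)
  from borel_measurable_diff[OF measurable_compose[OF this fm] fm]
  show "(\<lambda>y. f (y + h) - f y) \<in> borel_measurable borel" .
  fix R
  obtain b1 where b1: "\<And>x. x \<in> coord_space n \<Longrightarrow> lp_norm p n x \<le> R \<Longrightarrow> \<bar>f x\<bar> \<le> b1" by (rule tame_bound[OF f, where R=R]) blast
  obtain b2 where b2: "\<And>x. x \<in> coord_space n \<Longrightarrow> lp_norm p n x \<le> R + lp_norm p n h \<Longrightarrow> \<bar>f x\<bar> \<le> b2"
    by (rule tame_bound[OF f, where R="R + lp_norm p n h"]) blast
  show "\<exists>b. \<forall>x\<in>coord_space n. lp_norm p n x \<le> R \<longrightarrow> \<bar>f (x + h) - f x\<bar> \<le> b"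
  proof (intro exI ballI impI)
    fix x assume x: "x \<in> coord_space n" "lp_norm p n x \<le> R"
    have "x + h \<in> coord_space n" using x(1) h by (rule coord_space_closed(2))
    moreover have "lp_norm p n (x + h) \<le> R + lp_norm p n h"
      using lp_norm_triangle[OF p, of n x h] x(2) by linarith
    ultimately have "\<bar>f (x + h)\<bar> \<le> b2" by (rule b2)
    then show "\<bar>f (x + h) - f x\<bar> \<le> b2 + b1" using b1[OF x] by linarith
  qed
qed

lemma tame_mixed_diff:
  assumes p: "p \<ge> 1" and f: "tame p n f" and hs: "set hs \<subseteq> coord_space n"
  shows "tame p n (mixed_diff hs f)"
  using f hs
proof (induction hs arbitrary: f)
  case Nil
  have "mixed_diff [] f = f" by (simp add: fun_eq_iff)
  then show ?case using Nil by simp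
next
  case (Cons h hs)
  have "mixed_diff (h # hs) f = mixed_diff hs (\<lambda>y. f (y + h) - f y)" by (simp add: fun_eq_iff)
  moreover have "tame p n (mixed_diff hs (\<lambda>y. f (y + h) - f y))"
    using Cons.prems by (intro Cons.IH tame_difference[OF p]) auto
  ultimately show ?case by simp
qed

text \<open>
  The sign vectors, scaled to norm one, form a tight frame. The sum of the absolute values of the frame
  coefficients is estimated by the Cauchy-Schwarz inequality, which gives the Euclidean norm of \<open>z\<close>, and
  then by convexity. The unit vectors of the coordinate axes would only give \<open>n powr (1 - 1 / p)\<close>, which
  is larger than \<open>sqrt n\<close> for \<open>p > 2\<close>.
\<close>
lemma sign_vectors_tight_frame:
  assumes n: "n \<ge> 1" and p: "p \<ge> 2"
  shows "\<exists>(T :: (nat \<Rightarrow> real) set) u \<kappa>. finite T \<and> (\<forall>e\<in>T. u e \<in> lp_ball p n) \<and>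
     (\<forall>z. \<forall>j<n. z j = (\<Sum>e\<in>T. \<kappa> * (\<Sum>i<n. u e i * z i) * u e j)) \<and>
     (\<forall>z\<in>lp_ball p n. (\<Sum>e\<in>T. \<bar>\<kappa> * (\<Sum>i<n. u e i * z i)\<bar>) \<le> sqrt n)"
proof -
  (* The entry for which a sign vector has norm one. *)
  define t where "t = real n powr (- 1 / p)"
  have t: "t > 0" using n by (simp add: t_def)
  define T where "T = PiE {..<n} (\<lambda>_. {t, - t})"
  define u where "u e = (\<lambda>i. if i < n then e i else 0)" for e :: "nat \<Rightarrow> real"
  define \<kappa> where "\<kappa> = 1 / (t\<^sup>2 * 2 ^ n)"
  have \<kappa>: "\<kappa> > 0" using t by (simp add: \<kappa>_def)
  have T: "finite T" "card T = 2 ^ n" using t by (simp_all add: T_def finite_PiE card_PiE numeral_2_eq_2)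
  have eT: "e i = t \<or> e i = - t" if "e \<in> T" "i < n" for e i using that by (auto simp: T_def PiE_iff)
  have ball: "u e \<in> lp_ball p n" if "e \<in> T" for e
  proof -
    have "\<bar>u e i\<bar> powr p = 1 / real n" if "i < n" for i
    proof -
      have "\<bar>u e i\<bar> = t" using eT[OF \<open>e \<in> T\<close> that] t that by (auto simp: u_def)
      moreover have "t powr p = 1 / real n"
        unfolding t_def powr_powr using n p by (simp add: powr_minus_divide)
      ultimately show ?thesis by (simp only:)
    qed
    then have "(\<Sum>i<n. \<bar>u e i\<bar> powr p) = 1" using n by simp
    then show ?thesis by (simp add: mem_lp_ball lp_norm_def coord_space_def u_def)
  qed
  have orth: "(\<Sum>e\<in>T. e i * e j) = (if i = j then t\<^sup>2 * 2 ^ n else 0)" if ij: "i < n" "j < n" for i j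
  proof (cases "i = j")
    case True
    have "(\<Sum>e\<in>T. e i * e j) = (\<Sum>e\<in>T. t\<^sup>2)"
    proof (rule sum.cong[OF refl])
      fix e assume "e \<in> T"
      then show "e i * e j = t\<^sup>2" using eT[of e j] ij True by (auto simp: power2_eq_square)
    qed
    then show ?thesis using True T by simp
  next
    case False
    have pick: "(\<Prod>k<n. if k = i \<or> k = j then e k else 1) = e i * e j" for e :: "nat \<Rightarrow> real"
    proof -
      have "(\<Prod>k<n. if k = i \<or> k = j then e k else 1) = (\<Prod>k\<in>{i, j}. e k)"
        using ij by (intro prod.mono_neutral_cong_right) auto
      then show ?thesis using False by simp
    qed
    have "(\<Sum>e\<in>T. e i * e j) = (\<Sum>e\<in>T. \<Prod>k<n. (\<lambda>k y. if k = i \<or> k = j then y else 1) k (e k))"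
      by (simp add: pick)
    also have "\<dots> = (\<Prod>k<n. \<Sum>y\<in>{t, - t}. (\<lambda>k y. if k = i \<or> k = j then y else 1) k y)"
      unfolding T_def by (subst prod_sum_PiE) auto
    also have "\<dots> = 0" using ij t by (intro prod_zero) (auto intro!: bexI[of _ i])
    finally show ?thesis using False by simp
  qed
  have frame: "(\<Sum>e\<in>T. \<kappa> * (\<Sum>i<n. u e i * z i) * u e j) = z j" if j: "j < n" for z j
  proof -
    have "(\<Sum>e\<in>T. \<kappa> * (\<Sum>i<n. u e i * z i) * u e j) = (\<Sum>e\<in>T. \<Sum>i<n. \<kappa> * z i * (e i * e j))"
      using j by (intro sum.cong refl) (simp add: u_def sum_distrib_left sum_distrib_right mult_ac)
    also have "\<dots> = (\<Sum>i<n. \<Sum>e\<in>T. \<kappa> * z i * (e i * e j))" by (rule sum.swap)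
    also have "\<dots> = (\<Sum>i<n. \<kappa> * z i * (\<Sum>e\<in>T. e i * e j))" by (simp add: sum_distrib_left)
    also have "\<dots> = (\<Sum>i<n. if i = j then \<kappa> * z i * (t\<^sup>2 * 2 ^ n) else 0)"
      using orth j by (intro sum.cong) auto
    also have "\<dots> = z j" using j t by (simp add: \<kappa>_def)
    finally show ?thesis .
  qed
  have l2: "(\<Sum>i<n. (z i)\<^sup>2) \<le> real n * t\<^sup>2" if z: "z \<in> lp_ball p n" for z
  proof -
    have q: "p / 2 \<ge> 1" using p by simp
    have cvx: "convex_on {0..} (\<lambda>x::real. x powr (p / 2))"
      by (rule convex_onI) (use powr_convex_combination[OF _ _ _ _ q] in auto)
    have s1: "(\<Sum>i<n. \<bar>z i\<bar> powr p) \<le> 1"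
    proof -
      have "lp_norm p n z powr p \<le> 1 powr p" using z p by (intro powr_mono2) (auto simp: mem_lp_ball)
      then show ?thesis using p by (simp add: lp_norm_powr)
    qed
    define m where "m = (\<Sum>i<n. (z i)\<^sup>2) / real n"
    have m0: "m \<ge> 0" by (simp add: m_def sum_nonneg)
    have ne: "{..<n} \<noteq> {}" using n by (simp add: lessThan_empty_iff)
    have "(\<Sum>i<n. (1 / real n) *\<^sub>R (z i)\<^sup>2) powr (p / 2) \<le> (\<Sum>i<n. 1 / real n * (z i)\<^sup>2 powr (p / 2))"
      by (rule convex_on_sum[OF _ ne cvx]) (use n in auto)
    also have "\<dots> \<le> 1 / real n" unfolding power2_powr_half sum_distrib_left[symmetric] using s1 n by (simp add: divide_right_mono)
    finally have "m powr (p / 2) \<le> 1 / real n" by (simp add: m_def sum_divide_distrib)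
    then have "(m powr (p / 2)) powr (2 / p) \<le> (1 / real n) powr (2 / p)"
      using p by (intro powr_mono2) auto
    also have "(m powr (p / 2)) powr (2 / p) = m" using p m0 by (simp add: powr_powr)
    also have "(1 / real n) powr (2 / p) = t\<^sup>2"
    proof -
      have "t\<^sup>2 = t powr 2" using t by (simp add: powr_numeral)
      also have "\<dots> = real n powr (- (2 / p))" unfolding t_def powr_powr by simp
      also have "\<dots> = (1 / real n) powr (2 / p)" using n by (simp add: powr_minus_divide powr_divide)
      finally show ?thesis by simp
    qed
    finally show ?thesis using n by (simp add: m_def divide_simps mult.commute)
  qed
  have total: "(\<Sum>e\<in>T. \<bar>\<kappa> * (\<Sum>i<n. u e i * z i)\<bar>) \<le> sqrt n" if z: "z \<in> lp_ball p n" for z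
  proof -
    define g where "g e = (\<Sum>i<n. u e i * z i)" for e
    have g2: "(\<Sum>e\<in>T. (g e)\<^sup>2) = (t\<^sup>2 * 2 ^ n) * (\<Sum>i<n. (z i)\<^sup>2)"
    proof -
      have "(\<Sum>e\<in>T. \<kappa> * (g e)\<^sup>2) = (\<Sum>e\<in>T. \<Sum>j<n. z j * (\<kappa> * g e * u e j))"
        by (intro sum.cong refl) (simp add: g_def power2_eq_square sum_distrib_left sum_distrib_right mult_ac)
      also have "\<dots> = (\<Sum>j<n. \<Sum>e\<in>T. z j * (\<kappa> * g e * u e j))" by (rule sum.swap)
      also have "\<dots> = (\<Sum>j<n. z j * z j)"
        unfolding sum_distrib_left[symmetric] g_def using frame by (intro sum.cong) auto
      finally have eq: "\<kappa> * (\<Sum>e\<in>T. (g e)\<^sup>2) = (\<Sum>i<n. (z i)\<^sup>2)" by (simp add: sum_distrib_left power2_eq_square)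
      have "(\<Sum>e\<in>T. (g e)\<^sup>2) = (t\<^sup>2 * 2 ^ n) * (\<kappa> * (\<Sum>e\<in>T. (g e)\<^sup>2))" using t by (simp add: \<kappa>_def)
      then show ?thesis unfolding eq .
    qed
    have "(\<Sum>e\<in>T. \<bar>g e\<bar>)\<^sup>2 \<le> (\<Sum>e\<in>T. \<bar>g e\<bar>\<^sup>2) * real (card T)" by (rule sum_squared_le_sum_of_squares)
    also have "\<dots> = (t * 2 ^ n)\<^sup>2 * (\<Sum>i<n. (z i)\<^sup>2)"
      by (simp only: power2_abs g2 T of_nat_power of_nat_numeral power_mult_distrib power2_eq_square[of "2 ^ n"] mult_ac)
    also have "\<dots> \<le> (t * 2 ^ n)\<^sup>2 * (real n * t\<^sup>2)" by (intro mult_left_mono l2[OF z]) simp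
    also have "\<dots> = (t\<^sup>2 * 2 ^ n * sqrt n)\<^sup>2" by (simp add: power_mult_distrib)
    finally have "(\<Sum>e\<in>T. \<bar>g e\<bar>) \<le> t\<^sup>2 * 2 ^ n * sqrt n" by (rule power2_le_imp_le) simp
    then have "\<kappa> * (\<Sum>e\<in>T. \<bar>g e\<bar>) \<le> sqrt n" using t by (simp add: \<kappa>_def field_simps)
    then show ?thesis
      unfolding abs_mult abs_of_pos[OF \<kappa>] sum_distrib_left[of \<kappa>, symmetric] g_def .
  qed
  show ?thesis
    by (intro exI[of _ T] exI[of _ u] exI[of _ \<kappa>] conjI allI impI ballI)
      (use T ball frame total in auto)
qed

section \<open>Multilinear approximation of mixed differences\<close>
lemma log_depth:
  assumes "n \<ge> 1"
  obtains d where "n + 1 \<le> 2 ^ d" "real d \<le> 3 * ln (real n + 1)" "1 \<le> 2 * ln (real n + 1)"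
proof
  define d where "d = nat \<lceil>log 2 (real n + 1)\<rceil>"
  have l2: "1 / 2 \<le> ln (2::real)" using ln_ge_iff[of 2 "1/2"] exp_bound_half[of "1/2::real"] ln2_ge_two_thirds by linarith
  have mono: "ln 2 \<le> ln (real n + 1)" using assms by (intro ln_mono) auto
  show "1 \<le> 2 * ln (real n + 1)" using l2 mono by linarith
  have lg: "log 2 (real n + 1) \<ge> 1" using assms by (simp add: le_log_iff)
  then have d: "log 2 (real n + 1) \<le> real d" "real d \<le> log 2 (real n + 1) + 1" unfolding d_def by linarith+
  have "real n + 1 \<le> 2 powr real d" using d(1) by (simp add: log_le_iff)
  then have "real (n + 1) \<le> real (2 ^ d)" by (simp add: powr_realpow)
  then show "n + 1 \<le> 2 ^ d" by (simp only: of_nat_le_iff)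
  have "real d \<le> 2 * log 2 (real n + 1)" using d lg by linarith
  also have "\<dots> = 2 / ln 2 * ln (real n + 1)" by (simp add: log_def)
  also have "\<dots> \<le> 3 * ln (real n + 1)"
    using ln2_ge_two_thirds mono l2 by (intro mult_right_mono) (auto simp: divide_simps)
  finally show "real d \<le> 3 * ln (real n + 1)" .
qed

text \<open>
  The order of the error for \<open>k\<close>-linear forms. The subtraction on natural numbers covers \<open>k = 1\<close>, where
  the logarithm alone is the order that the proof gives.
\<close>
definition rate :: "nat \<Rightarrow> nat \<Rightarrow> real" where
  "rate n k = sqrt (real n) ^ (k - 2) * ln (real n + 1)"

lemma rate_Suc: assumes "k \<ge> 2" shows "rate n (Suc k) = sqrt (real n) * rate n k"
proof -
  have "Suc k - 2 = Suc (k - 2)" using assms by simp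
  then show ?thesis by (simp only: rate_def power_Suc mult.assoc)
qed

lemma ln_le_rate: assumes "n \<ge> 1" shows "ln (real n + 1) \<le> rate n k"
proof -
  have "1 \<le> sqrt (real n) ^ (k - 2)" using assms by (intro one_le_power) simp
  then show ?thesis unfolding rate_def using mult_right_mono[of 1 "sqrt (real n) ^ (k - 2)" "ln (real n + 1)"] by simp
qed

lemma rate_nonneg: "rate n k \<ge> 0"
  by (simp add: rate_def)

lemma approx_additive_mixed_diff:
  assumes md: "\<And>hs. length hs = Suc (Suc (length xs)) \<Longrightarrow> set hs \<subseteq> lp_ball p n \<Longrightarrow> \<bar>mixed_diff hs f 0\<bar> \<le> K"
    and xs: "set xs \<subseteq> lp_ball p n"
  shows "approx_additive p n K (\<lambda>z. mixed_diff (z # xs) f 0)"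
  unfolding approx_additive_def mixed_diff_add
proof (intro ballI impI)
  fix x y assume "x \<in> lp_ball p n" "y \<in> lp_ball p n"
  then show "\<bar>mixed_diff (x # y # xs) f 0\<bar> \<le> K" using xs by (intro md) auto
qed

lemma bounded_mixed_diff:
  assumes p: "p \<ge> 1" and f: "tame p n f" and xs: "set xs \<subseteq> lp_ball p n"
  shows "\<exists>b. \<forall>z\<in>lp_ball p n. \<bar>mixed_diff (z # xs) f 0\<bar> \<le> b"
proof -
  have xsc: "set xs \<subseteq> coord_space n" using xs by (auto simp: mem_lp_ball)
  obtain b where b: "\<And>x. x \<in> coord_space n \<Longrightarrow> lp_norm p n x \<le> 1 \<Longrightarrow> \<bar>mixed_diff xs f x\<bar> \<le> b"
    by (rule tame_bound[OF tame_mixed_diff[OF p f xsc], where R=1]) blast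
  have "\<bar>mixed_diff (z # xs) f 0\<bar> \<le> b + b" if z: "z \<in> lp_ball p n" for z
  proof -
    have "\<bar>mixed_diff xs f (0 + z)\<bar> \<le> b" "\<bar>mixed_diff xs f 0\<bar> \<le> b"
      using z by (intro b; simp add: mem_lp_ball)+
    then show ?thesis unfolding mixed_diff_Cons by linarith
  qed
  then show ?thesis by blast
qed

lemma linear_mixed_diff:
  assumes p: "p \<ge> 2" and n: "n \<ge> 1" and f: "tame p n f" and K: "K \<ge> 0"
    and md: "\<And>hs. length hs = Suc (Suc (length xs)) \<Longrightarrow> set hs \<subseteq> lp_ball p n \<Longrightarrow> \<bar>mixed_diff hs f 0\<bar> \<le> K"
    and xs: "set xs \<subseteq> lp_ball p n"
  shows "\<exists>c. \<forall>z\<in>lp_ball p n. \<bar>mixed_diff (z # xs) f 0 - (\<Sum>j<n. c j * z j)\<bar> \<le> 47 * K * ln (real n + 1)"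
proof -
  have p1: "p \<ge> 1" using p by simp
  obtain d where d: "n + 1 \<le> 2 ^ d" "real d \<le> 3 * ln (real n + 1)" "1 \<le> 2 * ln (real n + 1)"
    using log_depth[OF n] by blast
  obtain b where b: "\<And>z. z \<in> lp_ball p n \<Longrightarrow> \<bar>mixed_diff (z # xs) f 0\<bar> \<le> b"
    using bounded_mixed_diff[OF p1 f xs] by blast
  have "\<exists>c. \<forall>z\<in>lp_ball p n. \<bar>mixed_diff (z # xs) f 0 - (\<Sum>j<n. c j * z j)\<bar> \<le> (13 * real d + 4) * K"
    by (rule linear_approximation[OF p1 approx_additive_mixed_diff[OF md xs] b d(1) K])
  moreover have "(13 * real d + 4) * K \<le> 47 * K * ln (real n + 1)"
  proof -
    have "13 * real d + 4 \<le> 47 * ln (real n + 1)" using d(2,3) by linarith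
    from mult_right_mono[OF this K] show ?thesis by (simp add: mult_ac)
  qed
  ultimately show ?thesis by (meson order_trans)
qed

lemma bilinear_mixed_diff:
  assumes p: "p \<ge> 2" and n: "n \<ge> 1" and f: "tame p n f" and K: "K \<ge> 0"
    and md: "\<And>hs. length hs = 3 \<Longrightarrow> set hs \<subseteq> lp_ball p n \<Longrightarrow> \<bar>mixed_diff hs f 0\<bar> \<le> K"
  shows "\<exists>M\<in>multilinear_forms n 2. \<forall>x\<in>lp_ball p n. \<forall>y\<in>lp_ball p n.
    \<bar>mixed_diff [x, y] f 0 - M [x, y]\<bar> \<le> (600 * (1 + abs_moment p) + 16) * K * ln (real n + 1)"
proof -
  have p1: "p \<ge> 1" using p by simp
  obtain d where d: "n + 1 \<le> 2 ^ d" "real d \<le> 3 * ln (real n + 1)" "1 \<le> 2 * ln (real n + 1)"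
    using log_depth[OF n] by blast
  obtain b where b: "\<And>x. x \<in> coord_space n \<Longrightarrow> lp_norm p n x \<le> 2 \<Longrightarrow> \<bar>f x\<bar> \<le> b"
    by (rule tame_bound[OF f, where R=2]) blast
  have fm: "f \<in> borel_measurable borel" by (rule f[unfolded tame_def, THEN conjunct1])
  define D where "D x y = mixed_diff [x, y] f 0" for x y
  have Deq: "D x y = f (x + y) - f x - (f y - f 0)" for x y
    by (simp only: D_def mixed_diff_Cons mixed_diff.simps(1) add_0_left)
  have dd: "n * n + 1 \<le> 2 ^ (2 * d)"
  proof -
    have "n * n + 1 \<le> (n + 1) * (n + 1)" by simp
    also have "\<dots> \<le> 2 ^ d * 2 ^ d" using d(1) by (intro mult_mono) auto
    finally show ?thesis by (simp add: mult_2 power_add)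
  qed
  have "\<exists>c. \<forall>x\<in>lp_ball p n. \<forall>y\<in>lp_ball p n.
    \<bar>D x y - (\<Sum>j<n. \<Sum>k<n. c (j, k) * (x j * y k))\<bar> \<le> (100 * (1 + abs_moment p) * real (2 * d) + 8) * K"
  proof (rule bilinear_approximation[OF p _ _ _ _ dd K])
    let ?M = "borel \<Otimes>\<^sub>M borel :: ((nat \<Rightarrow> real) \<times> (nat \<Rightarrow> real)) measure"
    have "(\<lambda>z. fst z + snd z) \<in> ?M \<rightarrow>\<^sub>M borel"
      by (rule measurable_coordinatewise_then_product)
        (simp only: plus_fun_apply, intro borel_measurable_add
          measurable_compose[OF measurable_fst measurable_product_coordinates]
          measurable_compose[OF measurable_snd measurable_product_coordinates])
    from measurable_compose[OF this fm] have m: "(\<lambda>z. f (fst z + snd z)) \<in> borel_measurable ?M" .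
    show "(\<lambda>(x, y). D x y) \<in> borel_measurable ?M"
      unfolding Deq case_prod_beta
      by (intro borel_measurable_diff m borel_measurable_const
          measurable_compose[OF measurable_fst fm] measurable_compose[OF measurable_snd fm])
    show "approx_additive p n K (\<lambda>x. D x y)" if "y \<in> lp_ball p n" for y
      unfolding approx_additive_def D_def mixed_diff_add
      using that by (intro ballI impI md) auto
    show "approx_additive p n K (D x)" if x: "x \<in> lp_ball p n" for x
      unfolding approx_additive_def
    proof (intro ballI impI)
      fix y y' assume y: "y \<in> lp_ball p n" "y' \<in> lp_ball p n"
      have "D x (y + y') - D x y - D x y' = mixed_diff [x, y, y'] f 0"
        using mixed_diff_add[of y y' "[]" "\<lambda>z. f (z + x) - f z" 0]
        by (simp only: D_def mixed_diff.simps(2)[of x])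
      moreover have "\<bar>mixed_diff [x, y, y'] f 0\<bar> \<le> K" using x y by (intro md) auto
      ultimately show "\<bar>D x (y + y') - D x y - D x y'\<bar> \<le> K" by (simp only:)
    qed
    fix x y assume xy: "x \<in> lp_ball p n" "y \<in> lp_ball p n"
    have co: "x \<in> coord_space n" "y \<in> coord_space n" "lp_norm p n x \<le> 1" "lp_norm p n y \<le> 1"
      using xy by (auto simp: mem_lp_ball)
    have "\<bar>f (x + y)\<bar> \<le> b"
    proof (rule b)
      show "x + y \<in> coord_space n" using co(1,2) by (rule coord_space_closed(2))
      show "lp_norm p n (x + y) \<le> 2" using lp_norm_triangle[OF p1, of n x y] co(3,4) by linarith
    qed
    moreover have "\<bar>f x\<bar> \<le> b" "\<bar>f y\<bar> \<le> b" "\<bar>f 0\<bar> \<le> b" using co by (intro b; simp)+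
    ultimately show "\<bar>D x y\<bar> \<le> b + b + b + b" unfolding Deq by linarith
  qed
  then obtain c where c: "\<And>x y. x \<in> lp_ball p n \<Longrightarrow> y \<in> lp_ball p n \<Longrightarrow>
    \<bar>D x y - (\<Sum>j<n. \<Sum>k<n. c (j, k) * (x j * y k))\<bar> \<le> (100 * (1 + abs_moment p) * real (2 * d) + 8) * K"
    by blast
  define M where "M xs = (\<Sum>j<n. hd xs j * (\<Sum>k<n. hd (tl xs) k * c (j, k)))" for xs :: "(nat \<Rightarrow> real) list"
  have "M \<in> multilinear_forms n (Suc (Suc 0))"
    unfolding multilinear_forms.simps mem_Collect_eq
  proof (rule exI[where x="\<lambda>j xs. \<Sum>k<n. hd xs k * c (j, k)"], rule conjI)
    have "\<exists>G. (\<forall>k<n. \<exists>e. G k = (\<lambda>_. e)) \<and> (\<lambda>xs. \<Sum>k<n. hd xs k * c (j, k)) = (\<lambda>xs. \<Sum>k<n. hd xs k * G k (tl xs))" for j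
      by (rule exI[where x="\<lambda>k _. c (j, k)"]) blast
    then show "\<forall>j<n. \<exists>G. (\<forall>k<n. \<exists>e. G k = (\<lambda>_. e)) \<and> (\<lambda>xs. \<Sum>k<n. hd xs k * c (j, k)) = (\<lambda>xs. \<Sum>k<n. hd xs k * G k (tl xs))"
      by (intro allI impI)
    show "M = (\<lambda>xs. \<Sum>j<n. hd xs j * (\<Sum>k<n. hd (tl xs) k * c (j, k)))" by (simp add: fun_eq_iff M_def)
  qed
  moreover have "\<bar>mixed_diff [x, y] f 0 - M [x, y]\<bar> \<le> (600 * (1 + abs_moment p) + 16) * K * ln (real n + 1)"
    if xy: "x \<in> lp_ball p n" "y \<in> lp_ball p n" for x y
  proof -
    have "M [x, y] = (\<Sum>j<n. \<Sum>k<n. c (j, k) * (x j * y k))"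
      by (simp add: M_def sum_distrib_left mult_ac)
    then have "\<bar>mixed_diff [x, y] f 0 - M [x, y]\<bar> \<le> (100 * (1 + abs_moment p) * real (2 * d) + 8) * K"
      using c[OF xy] by (simp only: D_def)
    also have "\<dots> \<le> ((600 * (1 + abs_moment p) + 16) * ln (real n + 1)) * K"
    proof (rule mult_right_mono[OF _ K])
      have "100 * (1 + abs_moment p) * real (2 * d) \<le> 100 * (1 + abs_moment p) * (6 * ln (real n + 1))"
        using d(2) abs_moment_nonneg[of p] by (intro mult_left_mono) auto
      moreover have "8 \<le> 16 * ln (real n + 1)" using d(3) by linarith
      ultimately show "100 * (1 + abs_moment p) * real (2 * d) + 8 \<le> (600 * (1 + abs_moment p) + 16) * ln (real n + 1)"
        by (simp add: algebra_simps)
    qed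
    finally show ?thesis by (simp add: mult_ac)
  qed
  ultimately show ?thesis by (auto simp: numeral_2_eq_2)
qed

text \<open>
  The constant may depend on \<open>p\<close> and \<open>k\<close>, but the dimension is quantified inside.
\<close>
definition multilinear_constant :: "real \<Rightarrow> nat \<Rightarrow> real \<Rightarrow> bool" where
  "multilinear_constant p k C \<longleftrightarrow> (\<forall>n f K. n \<ge> 1 \<longrightarrow> tame p n f \<longrightarrow> K \<ge> 0 \<longrightarrow>
    (\<forall>hs. length hs = Suc k \<longrightarrow> set hs \<subseteq> lp_ball p n \<longrightarrow> \<bar>mixed_diff hs f 0\<bar> \<le> K) \<longrightarrow>
    (\<exists>M\<in>multilinear_forms n k. \<forall>hs. length hs = k \<longrightarrow> set hs \<subseteq> lp_ball p n \<longrightarrow>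
       \<bar>mixed_diff hs f 0 - M hs\<bar> \<le> C * K * rate n k))"

lemma multilinear_constantI:
  assumes "\<And>n f K. n \<ge> 1 \<Longrightarrow> tame p n f \<Longrightarrow> K \<ge> 0 \<Longrightarrow>
    (\<And>hs. length hs = Suc k \<Longrightarrow> set hs \<subseteq> lp_ball p n \<Longrightarrow> \<bar>mixed_diff hs f 0\<bar> \<le> K) \<Longrightarrow>
    \<exists>M\<in>multilinear_forms n k. \<forall>hs. length hs = k \<longrightarrow> set hs \<subseteq> lp_ball p n \<longrightarrow>
       \<bar>mixed_diff hs f 0 - M hs\<bar> \<le> C * K * rate n k"
  shows "multilinear_constant p k C"
  unfolding multilinear_constant_def by (intro allI impI assms) auto

lemma multilinear_constantD:
  assumes "multilinear_constant p k C" "n \<ge> 1" "tame p n f" "K \<ge> 0"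
    "\<And>hs. length hs = Suc k \<Longrightarrow> set hs \<subseteq> lp_ball p n \<Longrightarrow> \<bar>mixed_diff hs f 0\<bar> \<le> K"
  shows "\<exists>M\<in>multilinear_forms n k. \<forall>hs. length hs = k \<longrightarrow> set hs \<subseteq> lp_ball p n \<longrightarrow>
       \<bar>mixed_diff hs f 0 - M hs\<bar> \<le> C * K * rate n k"
  by (rule assms(1)[unfolded multilinear_constant_def, rule_format, OF assms(2-4)]) (rule assms(5))

lemma multilinear_constant_1:
  assumes p: "p \<ge> 2" shows "multilinear_constant p 1 47"
proof (rule multilinear_constantI)
  fix n :: nat and f K
  assume n: "n \<ge> 1" and f: "tame p n f" and K: "K \<ge> (0::real)"
    and md: "\<And>hs. length hs = Suc 1 \<Longrightarrow> set hs \<subseteq> lp_ball p n \<Longrightarrow> \<bar>mixed_diff hs f 0\<bar> \<le> K"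
  have "\<exists>c. \<forall>z\<in>lp_ball p n. \<bar>mixed_diff (z # []) f 0 - (\<Sum>j<n. c j * z j)\<bar> \<le> 47 * K * ln (real n + 1)"
    by (rule linear_mixed_diff[OF p n f K]) (auto intro: md)
  then obtain c where c: "\<And>z. z \<in> lp_ball p n \<Longrightarrow> \<bar>mixed_diff [z] f 0 - (\<Sum>j<n. c j * z j)\<bar> \<le> 47 * K * ln (real n + 1)"
    by blast
  define M where "M xs = (\<Sum>j<n. hd xs j * c j)" for xs :: "(nat \<Rightarrow> real) list"
  have M: "M \<in> multilinear_forms n 1"
    unfolding One_nat_def multilinear_forms.simps mem_Collect_eq
    by (intro exI[where x="\<lambda>j _. c j"] conjI allI impI exI refl) (simp_all add: fun_eq_iff M_def)
  have "\<bar>mixed_diff hs f 0 - M hs\<bar> \<le> 47 * K * rate n 1"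
    if hs: "length hs = 1" "set hs \<subseteq> lp_ball p n" for hs
  proof -
    obtain z where z: "hs = [z]" using hs(1) by (auto simp: length_Suc_conv)
    then have "z \<in> lp_ball p n" using hs(2) by simp
    from c[OF this] have "\<bar>mixed_diff hs f 0 - M hs\<bar> \<le> 47 * K * ln (real n + 1)"
      unfolding z M_def by (simp only: list.sel mult.commute)
    also have "\<dots> \<le> 47 * K * rate n 1" using K ln_le_rate[OF n] by (intro mult_left_mono) auto
    finally show ?thesis .
  qed
  then show "\<exists>M\<in>multilinear_forms n 1. \<forall>hs. length hs = 1 \<longrightarrow> set hs \<subseteq> lp_ball p n \<longrightarrow>
     \<bar>mixed_diff hs f 0 - M hs\<bar> \<le> 47 * K * rate n 1" using M by (intro bexI[of _ M]) auto
qed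

lemma multilinear_constant_2:
  assumes p: "p \<ge> 2" shows "multilinear_constant p 2 (600 * (1 + abs_moment p) + 16)"
proof (rule multilinear_constantI)
  fix n :: nat and f K
  assume n: "n \<ge> 1" and f: "tame p n f" and K: "K \<ge> (0::real)"
    and md: "\<And>hs. length hs = Suc 2 \<Longrightarrow> set hs \<subseteq> lp_ball p n \<Longrightarrow> \<bar>mixed_diff hs f 0\<bar> \<le> K"
  have "\<exists>M\<in>multilinear_forms n 2. \<forall>x\<in>lp_ball p n. \<forall>y\<in>lp_ball p n.
    \<bar>mixed_diff [x, y] f 0 - M [x, y]\<bar> \<le> (600 * (1 + abs_moment p) + 16) * K * ln (real n + 1)"
    by (rule bilinear_mixed_diff[OF p n f K]) (auto intro: md)
  then obtain M where M: "M \<in> multilinear_forms n 2" "\<And>x y. x \<in> lp_ball p n \<Longrightarrow> y \<in> lp_ball p n \<Longrightarrow>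
      \<bar>mixed_diff [x, y] f 0 - M [x, y]\<bar> \<le> (600 * (1 + abs_moment p) + 16) * K * ln (real n + 1)"
    by blast
  have "\<bar>mixed_diff hs f 0 - M hs\<bar> \<le> (600 * (1 + abs_moment p) + 16) * K * rate n 2"
    if hs: "length hs = 2" "set hs \<subseteq> lp_ball p n" for hs
  proof -
    obtain x y where xy: "hs = [x, y]" using hs(1) by (auto simp: numeral_2_eq_2 length_Suc_conv)
    then have "x \<in> lp_ball p n" "y \<in> lp_ball p n" using hs(2) by auto
    from M(2)[OF this] show ?thesis unfolding xy by (simp only: rate_def diff_self_eq_0 power_0 mult_1)
  qed
  then show "\<exists>M\<in>multilinear_forms n 2. \<forall>hs. length hs = 2 \<longrightarrow> set hs \<subseteq> lp_ball p n \<longrightarrow>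
     \<bar>mixed_diff hs f 0 - M hs\<bar> \<le> (600 * (1 + abs_moment p) + 16) * K * rate n 2"
    using M(1) by (intro bexI[of _ M]) auto
qed

text \<open>
  Fix the first argument at the vectors of the tight frame, approximate there by \<open>k\<close>-linear forms, and
  extend linearly in the first argument. Since the mixed difference is itself close to a linear function
  \<open>l\<close> of its first argument, which the frame reproduces exactly, the errors at the frame vectors enter
  with total weight \<open>sqrt n\<close>.
\<close>
lemma multilinear_constant_Suc:
  assumes p: "p \<ge> 2" and k: "k \<ge> 2" and C: "multilinear_constant p k C" "C \<ge> 0"
  shows "multilinear_constant p (Suc k) (94 + C)"
proof (rule multilinear_constantI)
  fix n :: nat and f K
  assume n: "n \<ge> 1" and f: "tame p n f" and K: "K \<ge> (0::real)"
    and md: "\<And>hs. length hs = Suc (Suc k) \<Longrightarrow> set hs \<subseteq> lp_ball p n \<Longrightarrow> \<bar>mixed_diff hs f 0\<bar> \<le> K"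
  have p1: "p \<ge> 1" using p by simp
  have "\<forall>z\<in>lp_ball p n. \<exists>M. M \<in> multilinear_forms n k \<and> (\<forall>hs. length hs = k \<longrightarrow> set hs \<subseteq> lp_ball p n \<longrightarrow>
       \<bar>mixed_diff (z # hs) f 0 - M hs\<bar> \<le> C * K * rate n k)"
  proof
    fix z assume z: "z \<in> lp_ball p n"
    have zc: "z \<in> coord_space n" using z by (simp add: mem_lp_ball)
    have bd: "\<bar>mixed_diff hs (\<lambda>y. f (y + z) - f y) 0\<bar> \<le> K"
      if "length hs = Suc k" "set hs \<subseteq> lp_ball p n" for hs
      using md[of "z # hs"] that z by simp
    show "\<exists>M. M \<in> multilinear_forms n k \<and> (\<forall>hs. length hs = k \<longrightarrow> set hs \<subseteq> lp_ball p n \<longrightarrow>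
       \<bar>mixed_diff (z # hs) f 0 - M hs\<bar> \<le> C * K * rate n k)"
      using multilinear_constantD[OF C(1) n tame_difference[OF p1 f zc] K bd]
      unfolding mixed_diff.simps(2) Bex_def .
  qed
  from bchoice[OF this] obtain M where M0: "\<forall>z\<in>lp_ball p n. M z \<in> multilinear_forms n k \<and>
      (\<forall>hs. length hs = k \<longrightarrow> set hs \<subseteq> lp_ball p n \<longrightarrow> \<bar>mixed_diff (z # hs) f 0 - M z hs\<bar> \<le> C * K * rate n k)"
    by (rule exE)
  have M: "\<And>z. z \<in> lp_ball p n \<Longrightarrow> M z \<in> multilinear_forms n k"
    "\<And>z hs. z \<in> lp_ball p n \<Longrightarrow> length hs = k \<Longrightarrow> set hs \<subseteq> lp_ball p n \<Longrightarrow>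
       \<bar>mixed_diff (z # hs) f 0 - M z hs\<bar> \<le> C * K * rate n k"
    using M0 by blast+
  from sign_vectors_tight_frame[OF n p] obtain T :: "(nat \<Rightarrow> real) set" and u \<kappa> where T0: "finite T" "\<forall>e\<in>T. u e \<in> lp_ball p n"
    and frame: "\<forall>z. \<forall>j<n. z j = (\<Sum>e\<in>T. \<kappa> * (\<Sum>i<n. u e i * z i) * u e j)"
    and total: "\<forall>z\<in>lp_ball p n. (\<Sum>e\<in>T. \<bar>\<kappa> * (\<Sum>i<n. u e i * z i)\<bar>) \<le> sqrt n"
    by (elim exE conjE) (rule that)
  have T: "finite T" "\<And>e. e \<in> T \<Longrightarrow> u e \<in> lp_ball p n" using T0 by auto
  define g where "g e z = \<kappa> * (\<Sum>i<n. u e i * z i)" for e z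
  define N where "N xs = (\<Sum>j<n. hd xs j * (\<Sum>e\<in>T. (\<kappa> * u e j) * M (u e) (tl xs)))" for xs
  have Nml: "N \<in> multilinear_forms n (Suc k)"
    unfolding multilinear_forms.simps mem_Collect_eq
    by (intro exI[where x="\<lambda>j xs. \<Sum>e\<in>T. (\<kappa> * u e j) * M (u e) xs"] conjI allI impI multilinear_forms_sum T M)
      (simp_all add: fun_eq_iff N_def)
  have Neq: "N (z # xs) = (\<Sum>e\<in>T. g e z * M (u e) xs)" for z xs
  proof -
    have "N (z # xs) = (\<Sum>j<n. \<Sum>e\<in>T. \<kappa> * (u e j * z j) * M (u e) xs)"
      by (simp add: N_def sum_distrib_left mult_ac)
    also have "\<dots> = (\<Sum>e\<in>T. \<Sum>j<n. \<kappa> * (u e j * z j) * M (u e) xs)" by (rule sum.swap)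
    also have "\<dots> = (\<Sum>e\<in>T. g e z * M (u e) xs)" by (simp only: g_def sum_distrib_left sum_distrib_right)
    finally show ?thesis .
  qed
  define L where "L = 47 * K * ln (real n + 1)"
  have L0: "L \<ge> 0" using K by (simp add: L_def)
  have sq: "sqrt (real n) \<ge> 1" using n by simp
  have "\<bar>mixed_diff hs f 0 - N hs\<bar> \<le> (94 + C) * K * rate n (Suc k)"
    if hs: "length hs = Suc k" "set hs \<subseteq> lp_ball p n" for hs
  proof -
    obtain z xs where zx: "hs = z # xs" using hs(1) by (cases hs) auto
    have z: "z \<in> lp_ball p n" and xs: "length xs = k" "set xs \<subseteq> lp_ball p n" using hs zx by auto
    have "\<exists>c. \<forall>z\<in>lp_ball p n. \<bar>mixed_diff (z # xs) f 0 - (\<Sum>j<n. c j * z j)\<bar> \<le> L"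
      unfolding L_def by (rule linear_mixed_diff[OF p n f K _ xs(2)]) (intro md, auto simp: xs(1))
    then obtain c where c: "\<And>z. z \<in> lp_ball p n \<Longrightarrow> \<bar>mixed_diff (z # xs) f 0 - (\<Sum>j<n. c j * z j)\<bar> \<le> L"
      by blast
    define l where "l z = (\<Sum>j<n. c j * z j)" for z
    have lz: "l z = (\<Sum>e\<in>T. g e z * l (u e))"
    proof -
      have "l z = (\<Sum>j<n. c j * (\<Sum>e\<in>T. g e z * u e j))"
      proof -
        have "z j = (\<Sum>e\<in>T. g e z * u e j)" if "j < n" for j
          unfolding g_def by (rule frame[rule_format, OF that])
        then show ?thesis unfolding l_def by (intro sum.cong refl) simp
      qed
      also have "\<dots> = (\<Sum>j<n. \<Sum>e\<in>T. g e z * (c j * u e j))" by (simp add: sum_distrib_left mult_ac)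
      also have "\<dots> = (\<Sum>e\<in>T. \<Sum>j<n. g e z * (c j * u e j))" by (rule sum.swap)
      finally show ?thesis by (simp only: l_def sum_distrib_left)
    qed
    have "\<bar>l z - N (z # xs)\<bar> = \<bar>\<Sum>e\<in>T. g e z * (l (u e) - M (u e) xs)\<bar>"
      unfolding lz Neq by (simp only: sum_subtractf right_diff_distrib)
    also have "\<dots> \<le> (\<Sum>e\<in>T. \<bar>g e z * (l (u e) - M (u e) xs)\<bar>)" by (rule sum_abs)
    also have "\<dots> \<le> (\<Sum>e\<in>T. \<bar>g e z\<bar> * (L + C * K * rate n k))"
    proof (rule sum_mono)
      fix e assume e: "e \<in> T"
      have "\<bar>l (u e) - M (u e) xs\<bar> \<le> L + C * K * rate n k"
        using c[OF T(2)[OF e]] M(2)[OF T(2)[OF e] xs] unfolding l_def by linarith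
      then show "\<bar>g e z * (l (u e) - M (u e) xs)\<bar> \<le> \<bar>g e z\<bar> * (L + C * K * rate n k)"
        unfolding abs_mult by (rule mult_left_mono) simp
    qed
    also have "\<dots> = (\<Sum>e\<in>T. \<bar>g e z\<bar>) * (L + C * K * rate n k)" by (rule sum_distrib_right[symmetric])
    also have "\<dots> \<le> sqrt n * (L + C * K * rate n k)"
      using bspec[OF total z] L0 K C(2) rate_nonneg by (intro mult_right_mono) (auto simp: g_def)
    finally have "\<bar>mixed_diff hs f 0 - N hs\<bar> \<le> L + sqrt n * (L + C * K * rate n k)"
      using c[OF z] unfolding zx l_def by linarith
    also have "\<dots> \<le> sqrt n * L + sqrt n * (L + C * K * rate n k)"
      using mult_right_mono[OF sq L0] by simp
    also have "\<dots> \<le> sqrt n * (47 * K * rate n k) + sqrt n * (47 * K * rate n k + C * K * rate n k)"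
      unfolding L_def using K ln_le_rate[OF n, of k] sq C(2) by (intro add_mono mult_left_mono) auto
    also have "\<dots> = (94 + C) * K * rate n (Suc k)" by (simp add: rate_Suc[OF k] algebra_simps)
    finally show ?thesis .
  qed
  then show "\<exists>M\<in>multilinear_forms n (Suc k). \<forall>hs. length hs = Suc k \<longrightarrow> set hs \<subseteq> lp_ball p n \<longrightarrow>
     \<bar>mixed_diff hs f 0 - M hs\<bar> \<le> (94 + C) * K * rate n (Suc k)"
    using Nml by (intro bexI[of _ N]) auto
qed

lemma multilinear_constant_exists:
  assumes p: "p \<ge> 2" and "k \<ge> 1"
  shows "\<exists>C\<ge>0. multilinear_constant p k C"
proof (cases "k = 1")
  case True
  then show ?thesis using multilinear_constant_1[OF p] by (intro exI[of _ 47]) simp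
next
  case False
  then have "k \<ge> 2" using \<open>k \<ge> 1\<close> by simp
  then show ?thesis
  proof (induction k rule: dec_induct)
    case base
    show ?case using multilinear_constant_2[OF p] abs_moment_nonneg[of p]
      by (intro exI[of _ "600 * (1 + abs_moment p) + 16"]) simp
  next
    case (step k)
    then obtain C where "C \<ge> 0" "multilinear_constant p k C" by blast
    then show ?case using multilinear_constant_Suc[OF p step(1)] by (intro exI[of _ "94 + C"]) simp
  qed
qed

section \<open>Finite differences and polynomials\<close>
definition difference_sum :: "nat \<Rightarrow> (nat \<Rightarrow> real) \<Rightarrow> real" where
  "difference_sum k F = (\<Sum>j\<le>k. (- 1) ^ (k - j) * real (k choose j) * F j)"

lemma difference_sum_Suc: "difference_sum (Suc k) F = difference_sum k (\<lambda>j. F (Suc j) - F j)"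
proof -
  let ?s = "\<lambda>j. (- 1 :: real) ^ (k - j)"
  have "difference_sum (Suc k) F = (- 1) ^ Suc k * F 0 + (\<Sum>j\<le>k. ?s j * real (Suc k choose Suc j) * F (Suc j))"
    unfolding difference_sum_def by (subst sum.atMost_Suc_shift) simp
  also have "(\<Sum>j\<le>k. ?s j * real (Suc k choose Suc j) * F (Suc j))
      = (\<Sum>j\<le>k. ?s j * real (k choose j) * F (Suc j)) + (\<Sum>j\<le>k. ?s j * real (k choose Suc j) * F (Suc j))"
    by (simp add: sum.distrib[symmetric] algebra_simps)
  finally have 1: "difference_sum (Suc k) F = (- 1) ^ Suc k * F 0
      + (\<Sum>j\<le>k. ?s j * real (k choose j) * F (Suc j)) + (\<Sum>j\<le>k. ?s j * real (k choose Suc j) * F (Suc j))" by simp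
  have "(\<Sum>j\<le>k. ?s j * real (k choose j) * F j) = - ((- 1) ^ Suc k * F 0 + (\<Sum>j\<le>k. ?s j * real (k choose Suc j) * F (Suc j)))"
  proof -
    have "(\<Sum>j\<le>k. ?s j * real (k choose j) * F j) = (\<Sum>j\<le>Suc k. - ((- 1) ^ (Suc k - j)) * real (k choose j) * F j)"
      by (simp add: Suc_diff_le)
    also have "\<dots> = - ((- 1) ^ Suc k) * F 0 + (\<Sum>j\<le>k. - ?s j * real (k choose Suc j) * F (Suc j))"
      by (subst sum.atMost_Suc_shift) simp
    finally show ?thesis by (simp add: sum_negf)
  qed
  then show ?thesis unfolding 1 unfolding difference_sum_def right_diff_distrib sum_subtractf by simp
qed

lemma difference_sum_sum: "difference_sum k (\<lambda>j. \<Sum>i\<in>I. c i * F i j) = (\<Sum>i\<in>I. c i * difference_sum k (F i))"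
proof -
  have "difference_sum k (\<lambda>j. \<Sum>i\<in>I. c i * F i j)
      = (\<Sum>j\<le>k. \<Sum>i\<in>I. c i * ((- 1) ^ (k - j) * real (k choose j) * F i j))"
    unfolding difference_sum_def by (simp add: sum_distrib_left mult_ac)
  also have "\<dots> = (\<Sum>i\<in>I. \<Sum>j\<le>k. c i * ((- 1) ^ (k - j) * real (k choose j) * F i j))" by (rule sum.swap)
  finally show ?thesis by (simp add: difference_sum_def sum_distrib_left)
qed

lemma difference_sum_diff: "difference_sum k (\<lambda>j. F j - G j) = difference_sum k F - difference_sum k G"
  by (simp add: difference_sum_def right_diff_distrib sum_subtractf)

lemma abs_difference_sum_le:
  assumes "\<And>j. j \<le> k \<Longrightarrow> \<bar>F j\<bar> \<le> b" shows "\<bar>difference_sum k F\<bar> \<le> 2 ^ k * b"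
proof -
  have "\<bar>difference_sum k F\<bar> \<le> (\<Sum>j\<le>k. \<bar>(- 1) ^ (k - j) * real (k choose j) * F j\<bar>)"
    unfolding difference_sum_def by (rule sum_abs)
  also have "\<dots> \<le> (\<Sum>j\<le>k. real (k choose j) * b)"
    using assms by (intro sum_mono) (simp add: abs_mult power_abs mult_left_mono)
  also have "\<dots> = real (\<Sum>j\<le>k. k choose j) * b" by (simp add: sum_distrib_right)
  also have "\<dots> = 2 ^ k * b" by (simp only: choose_row_sum) simp
  finally show ?thesis .
qed

lemma difference_sum_power: "i \<le> k \<Longrightarrow> difference_sum k (\<lambda>j. real j ^ i) = (if i = k then fact k else 0)"
proof (induction k arbitrary: i)
  case 0
  then show ?case by (simp add: difference_sum_def)
next
  case (Suc k)
  show ?case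
  proof (cases i)
    case 0
    then show ?thesis by (simp add: difference_sum_Suc) (simp add: difference_sum_def)
  next
    case (Suc i')
    then have i': "i' \<le> k" using Suc.prems by simp
    have "(real (Suc j)) ^ i - real j ^ i = (\<Sum>l\<le>i'. real (i choose l) * real j ^ l)" for j
    proof -
      have "real (Suc j) ^ i = (\<Sum>l\<le>i. real (i choose l) * real j ^ l)"
        using binomial_ring[of "real j" 1 i] by (simp add: add.commute)
      then show ?thesis by (simp add: Suc)
    qed
    then have "difference_sum (Suc k) (\<lambda>j. real j ^ i) = difference_sum k (\<lambda>j. \<Sum>l\<le>i'. real (i choose l) * real j ^ l)"
      unfolding difference_sum_Suc by (simp only:)
    also have "\<dots> = (\<Sum>l\<le>i'. real (i choose l) * difference_sum k (\<lambda>j. real j ^ l))" by (rule difference_sum_sum)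
    also have "\<dots> = (\<Sum>l\<le>i'. real (i choose l) * (if l = k then fact k else 0))"
      using i' by (intro sum.cong refl) (simp add: Suc.IH)
    also have "\<dots> = (\<Sum>l\<le>i'. if l = k then real (i choose k) * fact k else 0)"
      by (intro sum.cong) auto
    also have "\<dots> = (if i' = k then real (i choose k) * fact k else 0)"
      using i' by (simp add: sum.delta)
    finally show ?thesis using Suc by auto
  qed
qed

lemma difference_sum_poly:
  assumes "degree q < k" shows "difference_sum k (\<lambda>j. poly q (real j)) = 0"
proof -
  have "difference_sum k (\<lambda>j. poly q (real j)) = (\<Sum>i\<le>degree q. coeff q i * difference_sum k (\<lambda>j. real j ^ i))"
    unfolding poly_altdef by (rule difference_sum_sum)
  also have "\<dots> = 0" using assms by (intro sum.neutral) (auto simp: difference_sum_power)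
  finally show ?thesis .
qed

lemma finite_difference_eq:
  "finite_difference k h f x = difference_sum k (\<lambda>j. f (x + real j *\<^sub>R h))"
proof -
  have "(\<lambda>i. x i + real j * h i) = x + real j *\<^sub>R h" for j by (simp add: fun_eq_iff)
  then show ?thesis by (simp only: finite_difference_def difference_sum_def)
qed

lemma mixed_diff_replicate: "mixed_diff (replicate k h) f x = finite_difference k h f x"
proof (induction k arbitrary: f)
  case 0
  show ?case by (simp add: finite_difference_eq difference_sum_def)
next
  case (Suc k)
  have "x + real j *\<^sub>R h + h = x + real (Suc j) *\<^sub>R h" for j by (simp add: fun_eq_iff algebra_simps)
  then show ?case
    by (simp only: replicate_Suc mixed_diff.simps Suc.IH finite_difference_eq difference_sum_Suc)
qed

lemma finite_multi_indices: "finite (multi_indices n d)"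
proof (rule finite_subset)
  have "\<alpha> i \<le> (\<Sum>i<n. \<alpha> i)" if "i < n" for \<alpha> :: "nat \<Rightarrow> nat" and i
    using that by (intro member_le_sum) auto
  then show "multi_indices n d \<subseteq> {\<alpha>. \<forall>i. (i \<in> {..<n} \<longrightarrow> \<alpha> i \<in> {..d}) \<and> (i \<notin> {..<n} \<longrightarrow> \<alpha> i = 0)}"
    unfolding multi_indices_def by (auto simp: not_less) (meson order_trans)
qed (rule finite_set_of_finite_funs; simp)

lemma polynomials_sum:
  assumes "finite I" "\<And>i. i \<in> I \<Longrightarrow> \<phi> i \<in> polynomials n d"
  shows "(\<lambda>x. \<Sum>i\<in>I. c i * \<phi> i x) \<in> polynomials n d"
proof -
  have "\<forall>i\<in>I. \<exists>e. \<phi> i = (\<lambda>x. \<Sum>\<alpha>\<in>multi_indices n d. e \<alpha> * (\<Prod>i<n. x i ^ \<alpha> i))"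
    using assms(2) by (simp add: polynomials_def)
  from bchoice[OF this] obtain e where e: "\<forall>i\<in>I. \<phi> i = (\<lambda>x. \<Sum>\<alpha>\<in>multi_indices n d. e i \<alpha> * (\<Prod>i<n. x i ^ \<alpha> i))"
    by (rule exE)
  have "(\<lambda>x. \<Sum>i\<in>I. c i * \<phi> i x)
      = (\<lambda>x. \<Sum>\<alpha>\<in>multi_indices n d. (\<Sum>i\<in>I. c i * e i \<alpha>) * (\<Prod>i<n. x i ^ \<alpha> i))"
  proof
    fix x
    have "(\<Sum>i\<in>I. c i * \<phi> i x) = (\<Sum>i\<in>I. \<Sum>\<alpha>\<in>multi_indices n d. c i * e i \<alpha> * (\<Prod>i<n. x i ^ \<alpha> i))"
      using e by (intro sum.cong refl) (simp add: sum_distrib_left mult_ac)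
    also have "\<dots> = (\<Sum>\<alpha>\<in>multi_indices n d. \<Sum>i\<in>I. c i * e i \<alpha> * (\<Prod>i<n. x i ^ \<alpha> i))" by (rule sum.swap)
    finally show "(\<Sum>i\<in>I. c i * \<phi> i x) = (\<Sum>\<alpha>\<in>multi_indices n d. (\<Sum>i\<in>I. c i * e i \<alpha>) * (\<Prod>i<n. x i ^ \<alpha> i))"
      by (simp only: sum_distrib_right)
  qed
  then show ?thesis unfolding polynomials_def mem_Collect_eq
    by (rule exI[where x="\<lambda>\<alpha>. \<Sum>i\<in>I. c i * e i \<alpha>"])
qed

lemma polynomials_monomial:
  assumes "\<beta> \<in> multi_indices n d" shows "(\<lambda>x. \<Prod>i<n. x i ^ \<beta> i) \<in> polynomials n d"
proof -
  have "(\<lambda>x :: nat \<Rightarrow> real. \<Prod>i<n. x i ^ \<beta> i)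
      = (\<lambda>x. \<Sum>\<alpha>\<in>multi_indices n d. (if \<alpha> = \<beta> then 1 else 0) * (\<Prod>i<n. x i ^ \<alpha> i))"
  proof
    fix x :: "nat \<Rightarrow> real"
    have "(\<Sum>\<alpha>\<in>multi_indices n d. (if \<alpha> = \<beta> then 1 else 0) * (\<Prod>i<n. x i ^ \<alpha> i))
        = (\<Sum>\<alpha>\<in>multi_indices n d. if \<alpha> = \<beta> then \<Prod>i<n. x i ^ \<beta> i else 0)"
      by (intro sum.cong) auto
    also have "\<dots> = (\<Prod>i<n. x i ^ \<beta> i)" using assms by (simp only: sum.delta[OF finite_multi_indices] if_True)
    finally show "(\<Prod>i<n. x i ^ \<beta> i) = (\<Sum>\<alpha>\<in>multi_indices n d. (if \<alpha> = \<beta> then 1 else 0) * (\<Prod>i<n. x i ^ \<alpha> i))"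
      by (rule sym)
  qed
  then show ?thesis unfolding polynomials_def mem_Collect_eq
    by (rule exI[where x="\<lambda>\<alpha>. if \<alpha> = \<beta> then 1 else 0"])
qed

lemma polynomialsE:
  assumes "\<phi> \<in> polynomials n d"
  obtains c where "\<phi> = (\<lambda>x. \<Sum>\<alpha>\<in>multi_indices n d. c \<alpha> * (\<Prod>i<n. x i ^ \<alpha> i))"
  using assms unfolding polynomials_def mem_Collect_eq by (elim exE)

lemma polynomials_mono:
  assumes "\<phi> \<in> polynomials n d" "d \<le> e" shows "\<phi> \<in> polynomials n e"
proof -
  obtain c where c: "\<phi> = (\<lambda>x. \<Sum>\<alpha>\<in>multi_indices n d. c \<alpha> * (\<Prod>i<n. x i ^ \<alpha> i))"
    by (rule polynomialsE[OF assms(1)])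
  show ?thesis unfolding c
    by (intro polynomials_sum finite_multi_indices polynomials_monomial) (use assms(2) in \<open>auto simp: multi_indices_def\<close>)
qed

lemma polynomials_const: "(\<lambda>_. c) \<in> polynomials n d"
proof -
  have "(\<lambda>_. 0) \<in> multi_indices n d" by (simp add: multi_indices_def)
  from polynomials_sum[of "{()}" "\<lambda>_. _", OF _ polynomials_monomial[OF this], of "\<lambda>_. c"] show ?thesis by simp
qed

lemma polynomials_mult_coord:
  assumes "\<phi> \<in> polynomials n d" "j < n" shows "(\<lambda>x. x j * \<phi> x) \<in> polynomials n (Suc d)"
proof -
  obtain c where c: "\<phi> = (\<lambda>x. \<Sum>\<alpha>\<in>multi_indices n d. c \<alpha> * (\<Prod>i<n. x i ^ \<alpha> i))"
    by (rule polynomialsE[OF assms(1)])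
  have mon: "x j * (\<Prod>i<n. x i ^ \<alpha> i) = (\<Prod>i<n. x i ^ (\<alpha>(j := Suc (\<alpha> j))) i)" for x :: "nat \<Rightarrow> real" and \<alpha> :: "nat \<Rightarrow> nat"
  proof -
    have "(\<Prod>i<n. x i ^ (\<alpha>(j := Suc (\<alpha> j))) i) = x j ^ Suc (\<alpha> j) * (\<Prod>i\<in>{..<n} - {j}. x i ^ \<alpha> i)"
      using assms(2) by (subst prod.remove[of _ j]) (auto intro!: prod.cong)
    moreover have "(\<Prod>i<n. x i ^ \<alpha> i) = x j ^ \<alpha> j * (\<Prod>i\<in>{..<n} - {j}. x i ^ \<alpha> i)"
      using assms(2) by (subst prod.remove[of _ j]) auto
    ultimately show ?thesis by simp
  qed
  have eq: "(\<lambda>x. x j * \<phi> x) = (\<lambda>x. \<Sum>\<alpha>\<in>multi_indices n d. c \<alpha> * (\<Prod>i<n. x i ^ (\<alpha>(j := Suc (\<alpha> j))) i))"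
    unfolding c mon[symmetric] by (simp add: fun_eq_iff sum_distrib_left mult_ac)
  show ?thesis unfolding eq
  proof (intro polynomials_sum finite_multi_indices polynomials_monomial)
    fix \<alpha> assume \<alpha>: "\<alpha> \<in> multi_indices n d"
    have "(\<Sum>i<n. (\<alpha>(j := Suc (\<alpha> j))) i) = Suc (\<alpha> j) + (\<Sum>i\<in>{..<n} - {j}. \<alpha> i)"
      using assms(2) by (subst sum.remove[of _ j]) (auto intro!: sum.cong)
    moreover have "(\<Sum>i<n. \<alpha> i) = \<alpha> j + (\<Sum>i\<in>{..<n} - {j}. \<alpha> i)"
      using assms(2) by (subst sum.remove[of _ j]) auto
    ultimately show "\<alpha>(j := Suc (\<alpha> j)) \<in> multi_indices n (Suc d)"
      using \<alpha> assms(2) by (auto simp: multi_indices_def)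
  qed
qed

lemma polynomials_rescale:
  assumes "\<phi> \<in> polynomials n d" shows "(\<lambda>x. \<phi> (r *\<^sub>R x)) \<in> polynomials n d"
proof -
  obtain c where c: "\<phi> = (\<lambda>x. \<Sum>\<alpha>\<in>multi_indices n d. c \<alpha> * (\<Prod>i<n. x i ^ \<alpha> i))"
    by (rule polynomialsE[OF assms(1)])
  have eq: "(\<lambda>x. \<phi> (r *\<^sub>R x)) = (\<lambda>x. \<Sum>\<alpha>\<in>multi_indices n d. (c \<alpha> * (\<Prod>i<n. r ^ \<alpha> i)) * (\<Prod>i<n. x i ^ \<alpha> i))"
    unfolding c by (simp add: power_mult_distrib prod.distrib mult.assoc)
  show ?thesis unfolding eq by (intro polynomials_sum finite_multi_indices polynomials_monomial)
qed

lemma polynomials_add: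
  assumes "\<phi> \<in> polynomials n d" "\<psi> \<in> polynomials n d" shows "(\<lambda>x. \<phi> x + \<psi> x) \<in> polynomials n d"
  using polynomials_sum[of "{True, False}" "\<lambda>b. if b then \<phi> else \<psi>" n d "\<lambda>_. 1"] assms by simp

lemma polynomials_multilinear_diagonal:
  assumes "M \<in> multilinear_forms n k" shows "(\<lambda>x. M (replicate k x)) \<in> polynomials n k"
  using assms
proof (induction k arbitrary: M)
  case 0
  then show ?case by (auto intro: polynomials_const)
next
  case (Suc k)
  then obtain G where G: "\<forall>j<n. G j \<in> multilinear_forms n k" "M = (\<lambda>xs. \<Sum>j<n. hd xs j * G j (tl xs))"
    by auto
  have eq: "(\<lambda>x. M (replicate (Suc k) x)) = (\<lambda>x. \<Sum>j<n. 1 * (x j * G j (replicate k x)))"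
    by (simp add: G(2))
  show ?case unfolding eq
    by (intro polynomials_sum polynomials_mult_coord Suc.IH) (use G(1) in auto)
qed

lemma finite_difference_polynomial:
  assumes "\<phi> \<in> polynomials n d" "d < k" shows "finite_difference k h \<phi> x = 0"
proof -
  obtain c where c: "\<phi> = (\<lambda>x. \<Sum>\<alpha>\<in>multi_indices n d. c \<alpha> * (\<Prod>i<n. x i ^ \<alpha> i))"
    by (rule polynomialsE[OF assms(1)])
  have "difference_sum k (\<lambda>j. \<Prod>i<n. (x + real j *\<^sub>R h) i ^ \<alpha> i) = 0" if \<alpha>: "\<alpha> \<in> multi_indices n d" for \<alpha>
  proof -
    define q where "q = (\<Prod>i<n. [:x i, h i:] ^ \<alpha> i)"
    have "degree q \<le> (\<Sum>i<n. degree ([:x i, h i:] ^ \<alpha> i))" 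
      using degree_prod_sum_le[of "{..<n}" "\<lambda>i. [:x i, h i:] ^ \<alpha> i"] by (simp add: o_def q_def)
    also have "\<dots> \<le> (\<Sum>i<n. \<alpha> i)"
    proof (rule sum_mono)
      fix i
      have "degree ([:x i, h i:] ^ \<alpha> i) \<le> degree [:x i, h i:] * \<alpha> i" by (rule degree_power_le)
      also have "\<dots> \<le> 1 * \<alpha> i" by (intro mult_right_mono) auto
      finally show "degree ([:x i, h i:] ^ \<alpha> i) \<le> \<alpha> i" by simp
    qed
    also have "\<dots> \<le> d" using \<alpha> by (simp add: multi_indices_def)
    finally have "degree q < k" using assms(2) by simp
    moreover have "(\<Prod>i<n. (x + real j *\<^sub>R h) i ^ \<alpha> i) = poly q (real j)" for j
      by (simp add: q_def poly_prod)
    ultimately show ?thesis by (simp only: difference_sum_poly)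
  qed
  then show ?thesis unfolding finite_difference_eq c difference_sum_sum by (simp only: mult_zero_right sum.neutral_const cong: sum.cong)
qed

section \<open>Mixed differences in terms of pure differences\<close>
lemma mixed_diff_zero:
  "0 \<in> set hs \<Longrightarrow> mixed_diff hs f x = 0"
proof (induction hs arbitrary: x)
  case (Cons h hs)
  show ?case
  proof (cases "h = 0")
    case True then show ?thesis by (simp only: mixed_diff_Cons add_0_right diff_self)
  next
    case False
    then have "0 \<in> set hs" using Cons.prems unfolding list.set(2) insert_iff by metis
    then show ?thesis by (simp only: mixed_diff_Cons Cons.IH diff_self)
  qed
qed simp

text \<open>
  The condition on \<open>x\<close> and \<open>h\<close> keeps all points \<open>x + j h\<close> with \<open>j \<le> m\<close> in the ball of radius \<open>R\<close>. It is
  subadditive in both vectors, and so it survives the estimates below.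
\<close>
definition smooth_bound :: "real \<Rightarrow> nat \<Rightarrow> nat \<Rightarrow> real \<Rightarrow> real \<Rightarrow> ((nat \<Rightarrow> real) \<Rightarrow> real) \<Rightarrow> bool" where
  "smooth_bound p n m R K f \<longleftrightarrow> (\<forall>x\<in>coord_space n. \<forall>h\<in>coord_space n.
     lp_norm p n x + real m * lp_norm p n h \<le> R \<longrightarrow> \<bar>finite_difference m h f x\<bar> \<le> K)"

lemma smooth_boundD:
  "smooth_bound p n m R K f \<Longrightarrow> x \<in> coord_space n \<Longrightarrow> h \<in> coord_space n
    \<Longrightarrow> lp_norm p n x + real m * lp_norm p n h \<le> R \<Longrightarrow> \<bar>finite_difference m h f x\<bar> \<le> K"
  by (simp add: smooth_bound_def)

lemma difference_points_in_ball:
  assumes p: "p \<ge> 1" and x: "x \<in> coord_space n" and h: "h \<in> coord_space n"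
    and le: "lp_norm p n x + real m * lp_norm p n h \<le> 1" and j: "j \<le> m"
  shows "x + real j *\<^sub>R h \<in> lp_ball p n"
proof -
  have p0: "p > 0" using p by simp
  have "lp_norm p n (x + real j *\<^sub>R h) \<le> lp_norm p n x + real j * lp_norm p n h"
    using lp_norm_triangle[OF p, of n x "real j *\<^sub>R h"] unfolding lp_norm_scaleR[OF p0] by simp
  also have "\<dots> \<le> lp_norm p n x + real m * lp_norm p n h" using j by (intro add_left_mono mult_right_mono) auto
  finally have "lp_norm p n (x + real j *\<^sub>R h) \<le> 1" using le by linarith
  moreover have "x + real j *\<^sub>R h \<in> coord_space n"
    by (rule coord_space_closed(2)[OF x coord_space_closed(3)[OF h]])
  ultimately show ?thesis unfolding mem_lp_ball by (rule conjI[rotated])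
qed

text \<open>
  Expanding the mixed difference for each \<open>j\<close> gives \<open>2 ^ length ps\<close> values of \<open>f\<close> at points that move
  linearly with \<open>j\<close>, and the alternating sum over \<open>j\<close> turns each of them into a pure difference.
\<close>
lemma moving_mixed_diff_bound:
  assumes p: "p \<ge> 1" and W: "smooth_bound p n m R K f"
    and "x \<in> coord_space n" "z \<in> coord_space n" "\<forall>(h, k)\<in>set ps. h \<in> coord_space n \<and> k \<in> coord_space n"
    and "lp_norm p n x + real m * lp_norm p n z + (\<Sum>(h, k)\<leftarrow>ps. lp_norm p n h + real m * lp_norm p n k) \<le> R"
  shows "\<bar>difference_sum m (\<lambda>j. mixed_diff (map (\<lambda>(h, k). h + real j *\<^sub>R k) ps) f (x + real j *\<^sub>R z))\<bar> \<le> 2 ^ length ps * K"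
  using assms(3-)
proof (induction ps arbitrary: x z)
  case Nil
  then have "lp_norm p n x + real m * lp_norm p n z \<le> R" by simp
  from smooth_boundD[OF W Nil(1,2) this] show ?case
    by (simp only: list.map mixed_diff.simps(1) finite_difference_eq list.size(3) power_0 mult_1)
next
  case (Cons hk ps)
  obtain h k where hk: "hk = (h, k)" by (cases hk)
  have co: "h \<in> coord_space n" "k \<in> coord_space n" using Cons.prems(3) by (auto simp: hk)
  let ?g = "\<lambda>j y. mixed_diff (map (\<lambda>(h, k). h + real j *\<^sub>R k) ps) f y"
  have mv: "x + real j *\<^sub>R z + (h + real j *\<^sub>R k) = (x + h) + real j *\<^sub>R (z + k)" for j
    by (simp add: fun_eq_iff algebra_simps)
  have eq: "difference_sum m (\<lambda>j. mixed_diff (map (\<lambda>(h, k). h + real j *\<^sub>R k) (hk # ps)) f (x + real j *\<^sub>R z))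
      = difference_sum m (\<lambda>j. ?g j ((x + h) + real j *\<^sub>R (z + k))) - difference_sum m (\<lambda>j. ?g j (x + real j *\<^sub>R z))"
    unfolding hk list.map prod.case mixed_diff_Cons mv difference_sum_diff ..
  let ?S = "(\<Sum>(h, k)\<leftarrow>ps. lp_norm p n h + real m * lp_norm p n k)"
  have tot: "lp_norm p n x + real m * lp_norm p n z + (lp_norm p n h + real m * lp_norm p n k + ?S) \<le> R"
    using Cons.prems(4) by (simp add: hk)
  have mk: "real m * lp_norm p n (z + k) \<le> real m * lp_norm p n z + real m * lp_norm p n k"
    using mult_left_mono[OF lp_norm_triangle[OF p, of n z k], of "real m"] by (simp add: distrib_left)
  have "\<bar>difference_sum m (\<lambda>j. ?g j ((x + h) + real j *\<^sub>R (z + k)))\<bar> \<le> 2 ^ length ps * K"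
  proof (rule Cons.IH)
    show "lp_norm p n (x + h) + real m * lp_norm p n (z + k) + ?S \<le> R"
      using lp_norm_triangle[OF p, of n x h] mk tot by linarith
    show "x + h \<in> coord_space n" by (rule coord_space_closed(2)[OF Cons.prems(1) co(1)])
    show "z + k \<in> coord_space n" by (rule coord_space_closed(2)[OF Cons.prems(2) co(2)])
    show "\<forall>(h, k)\<in>set ps. h \<in> coord_space n \<and> k \<in> coord_space n" using Cons.prems(3) by auto
  qed
  moreover have "\<bar>difference_sum m (\<lambda>j. ?g j (x + real j *\<^sub>R z))\<bar> \<le> 2 ^ length ps * K"
  proof (rule Cons.IH[OF Cons.prems(1,2)])
    have "0 \<le> lp_norm p n h + real m * lp_norm p n k" by simp
    then show "lp_norm p n x + real m * lp_norm p n z + ?S \<le> R" using tot by linarith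
    show "\<forall>(h, k)\<in>set ps. h \<in> coord_space n \<and> k \<in> coord_space n" using Cons.prems(3) by auto
  qed
  ultimately show ?case unfolding eq by simp
qed

text \<open>
  A classical identity: let the step number \<open>i\<close> move as \<open>(1 - j / i) h\<close>. For each \<open>j\<close> between \<open>1\<close> and \<open>m\<close>
  one of the steps is zero, so the alternating sum over \<open>j\<close> reduces to the term \<open>j = 0\<close>, which is the
  mixed difference.
\<close>
lemma mixed_diff_bound:
  assumes p: "p \<ge> 1" and W: "smooth_bound p n m R K f"
    and hs: "length hs = m" "set hs \<subseteq> coord_space n" "\<And>h. h \<in> set hs \<Longrightarrow> lp_norm p n h \<le> \<sigma>"
    and R: "real m * (real m + 1) * \<sigma> \<le> R" and m: "m \<ge> 1"
  shows "\<bar>mixed_diff hs f 0\<bar> \<le> 2 ^ m * K"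
proof -
  (* Indices of lists start at 0, hence Suc i. *)
  define ps where "ps = map (\<lambda>i. (hs ! i, (- 1 / real (Suc i)) *\<^sub>R hs ! i)) [0..<m]"
  have p0: "p > 0" using p by simp
  have len: "length ps = m" by (simp add: ps_def)
  have nth: "hs ! i \<in> coord_space n" "lp_norm p n (hs ! i) \<le> \<sigma>" if "i < m" for i
    using that hs nth_mem[of i hs] by auto
  have "\<bar>difference_sum m (\<lambda>j. mixed_diff (map (\<lambda>(h, k). h + real j *\<^sub>R k) ps) f (0 + real j *\<^sub>R 0))\<bar> \<le> 2 ^ length ps * K"
  proof (rule moving_mixed_diff_bound[OF p W])
    show "\<forall>(h, k)\<in>set ps. h \<in> coord_space n \<and> k \<in> coord_space n"
      using nth by (auto simp: ps_def simp del: scaleR_fun_apply)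
    have "(\<Sum>(h, k)\<leftarrow>ps. lp_norm p n h + real m * lp_norm p n k)
        = (\<Sum>i<m. lp_norm p n (hs ! i) + real m * (1 / real (Suc i) * lp_norm p n (hs ! i)))"
      unfolding ps_def by (simp add: o_def interv_sum_list_conv_sum_set_nat p0 atLeast0LessThan)
    also have "\<dots> \<le> (\<Sum>i<m. (real m + 1) * \<sigma>)"
    proof (rule sum_mono)
      fix i assume "i \<in> {..<m}"
      then have i: "i < m" by simp
      have "1 / real (Suc i) * lp_norm p n (hs ! i) \<le> 1 * lp_norm p n (hs ! i)"
        by (intro mult_right_mono) auto
      then have "real m * (1 / real (Suc i) * lp_norm p n (hs ! i)) \<le> real m * (1 * lp_norm p n (hs ! i))"
        by (intro mult_left_mono) auto
      then have "lp_norm p n (hs ! i) + real m * (1 / real (Suc i) * lp_norm p n (hs ! i)) \<le> (real m + 1) * lp_norm p n (hs ! i)"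
        by (simp add: algebra_simps)
      also have "\<dots> \<le> (real m + 1) * \<sigma>" using nth(2)[OF i] by (intro mult_left_mono) auto
      finally show "lp_norm p n (hs ! i) + real m * (1 / real (Suc i) * lp_norm p n (hs ! i)) \<le> (real m + 1) * \<sigma>" .
    qed
    also have "\<dots> \<le> R" using R by (simp add: mult.assoc)
    finally show "lp_norm p n 0 + real m * lp_norm p n 0 + (\<Sum>(h, k)\<leftarrow>ps. lp_norm p n h + real m * lp_norm p n k) \<le> R" by simp
  qed auto
  moreover have "difference_sum m (\<lambda>j. mixed_diff (map (\<lambda>(h, k). h + real j *\<^sub>R k) ps) f (0 + real j *\<^sub>R 0))
      = (- 1) ^ m * mixed_diff hs f 0"
  proof -
    have vanish: "mixed_diff (map (\<lambda>(h, k). h + real j *\<^sub>R k) ps) f (0 + real j *\<^sub>R 0) = 0" if j: "j \<in> {..m} - {0}" for j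
    proof (rule mixed_diff_zero)
      obtain i where i: "j = Suc i" "i < m" using j by (cases j) auto
      have z: "hs ! i + real j *\<^sub>R ((- 1 / real (Suc i)) *\<^sub>R hs ! i) = 0" by (simp add: i(1) fun_eq_iff field_simps)
      have "map (\<lambda>(h, k). h + real j *\<^sub>R k) ps ! i = hs ! i + real j *\<^sub>R ((- 1 / real (Suc i)) *\<^sub>R hs ! i)"
        using i(2) by (simp add: ps_def del: scaleR_scaleR)
      then have "0 = map (\<lambda>(h, k). h + real j *\<^sub>R k) ps ! i" unfolding z by (rule sym)
      then show "0 \<in> set (map (\<lambda>(h, k). h + real j *\<^sub>R k) ps)" using i(2) len nth_mem[of i "map (\<lambda>(h, k). h + real j *\<^sub>R k) ps"] by simp
    qed
    have zero: "map (\<lambda>(h, k). h + real 0 *\<^sub>R k) ps = hs"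
      by (rule nth_equalityI) (simp_all add: ps_def hs(1))
    have "difference_sum m (\<lambda>j. mixed_diff (map (\<lambda>(h, k). h + real j *\<^sub>R k) ps) f (0 + real j *\<^sub>R 0))
        = (- 1) ^ (m - 0) * real (m choose 0) * mixed_diff (map (\<lambda>(h, k). h + real 0 *\<^sub>R k) ps) f (0 + real 0 *\<^sub>R 0)"
      unfolding difference_sum_def
      by (subst sum.remove[of _ 0]) (simp_all only: vanish mult_zero_right sum.neutral_const finite_atMost atMost_iff le0 add_0_right cong: sum.cong)
    then show ?thesis unfolding zero by simp
  qed
  ultimately show ?thesis by (simp add: len abs_mult power_abs)
qed

text \<open>
  Along a ray the mixed difference is additive in each argument up to \<open>K\<close>, hence linear in it up to \<open>3 K\<close>;
  the arguments are replaced one at a time.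
\<close>
lemma mixed_diff_ray:
  assumes p: "p \<ge> 1" and u: "u \<in> lp_ball p n" and t: "0 \<le> t" "t \<le> 1"
    and f: "tame p n f"
    and md: "\<And>hs. length hs = Suc k \<Longrightarrow> set hs \<subseteq> lp_ball p n \<Longrightarrow> \<bar>mixed_diff hs f 0\<bar> \<le> K"
  shows "\<bar>mixed_diff (replicate k (t *\<^sub>R u)) f 0 - t ^ k * mixed_diff (replicate k u) f 0\<bar> \<le> 3 * real k * K"
  using f md
proof (induction k arbitrary: f)
  case 0
  then show ?case by simp
next
  case (Suc k)
  have p0: "p > 0" using p by simp
  have tu: "t *\<^sub>R u \<in> lp_ball p n" using u t by (intro lp_ball_scaleR[OF p0]) auto
  have tuc: "t *\<^sub>R u \<in> coord_space n" using tu by (simp add: mem_lp_ball)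
  let ?g = "\<lambda>y. f (y + t *\<^sub>R u) - f y"
  have 1: "\<bar>mixed_diff (replicate k (t *\<^sub>R u)) ?g 0 - t ^ k * mixed_diff (replicate k u) ?g 0\<bar> \<le> 3 * real k * K"
  proof (rule Suc.IH[OF tame_difference[OF p Suc.prems(1) tuc]])
    fix hs assume "length hs = Suc k" "set hs \<subseteq> lp_ball p n"
    then have "\<bar>mixed_diff (t *\<^sub>R u # hs) f 0\<bar> \<le> K" using tu by (intro Suc.prems(2)) auto
    then show "\<bar>mixed_diff hs ?g 0\<bar> \<le> K" by (simp only: mixed_diff.simps(2))
  qed
  have ru: "set (replicate k u) \<subseteq> lp_ball p n" using u by (auto simp: set_replicate_conv_if)
  have aa: "approx_additive p n K (\<lambda>z. mixed_diff (z # replicate k u) f 0)"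
    by (rule approx_additive_mixed_diff[OF _ ru]) (intro Suc.prems(2), auto)
  obtain b where b: "\<And>z. z \<in> lp_ball p n \<Longrightarrow> \<bar>mixed_diff (z # replicate k u) f 0\<bar> \<le> b"
    using bounded_mixed_diff[OF p Suc.prems(1) ru] by blast
  have "\<bar>mixed_diff (t *\<^sub>R u # replicate k u) f 0 - t * mixed_diff (u # replicate k u) f 0\<bar> \<le> 3 * K"
    by (rule approx_additive_ray[OF p aa b u t])
  moreover define A where "A = mixed_diff (t *\<^sub>R u # replicate k u) f 0"
  moreover define B where "B = mixed_diff (u # replicate k u) f 0"
  ultimately have AB: "\<bar>A - t * B\<bar> \<le> 3 * K" by (simp only:)
  have "\<bar>t ^ k * (A - t * B)\<bar> \<le> 1 * (3 * K)"
    unfolding abs_mult using t AB by (intro mult_mono) (auto simp: power_le_one power_abs)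
  then have 2: "\<bar>t ^ k * A - t ^ Suc k * B\<bar> \<le> 3 * K" by (simp add: algebra_simps)
  have "mixed_diff (replicate k u) ?g 0 = A" unfolding A_def mixed_diff.simps(2) ..
  then have "\<bar>mixed_diff (replicate (Suc k) (t *\<^sub>R u)) f 0 - t ^ k * A\<bar> \<le> 3 * real k * K"
    using 1 by (simp only: replicate_Suc mixed_diff.simps(2)[of "t *\<^sub>R u"])
  then have "\<bar>mixed_diff (replicate (Suc k) (t *\<^sub>R u)) f 0 - t ^ Suc k * B\<bar> \<le> 3 * real k * K + 3 * K"
    using 2 by linarith
  moreover have "3 * real (Suc k) * K = 3 * real k * K + 3 * K" by (simp add: algebra_simps)
  ultimately show ?case unfolding B_def replicate_Suc[of k u, symmetric] by (simp only:)
qed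

section \<open>Polynomial approximation near the origin\<close>
lemma measurable_scaled:
  assumes "c \<in> borel_measurable borel" "f \<in> borel_measurable borel"
  shows "(\<lambda>x :: nat \<Rightarrow> real. f (c x *\<^sub>R x)) \<in> borel_measurable borel"
proof -
  have "(\<lambda>x :: nat \<Rightarrow> real. c x *\<^sub>R x) \<in> borel \<rightarrow>\<^sub>M borel"
    by (rule measurable_coordinatewise_then_product)
      (simp only: scaleR_fun_apply real_scaleR_def, intro borel_measurable_times assms measurable_product_coordinates)
  from measurable_compose[OF this assms(2)] show ?thesis .
qed

lemma tame_rescale:
  assumes p: "p > 0" and f: "tame p n f" shows "tame p n (\<lambda>x. f (r *\<^sub>R x))"
  unfolding tame_def
proof (intro conjI allI)
  show "(\<lambda>x. f (r *\<^sub>R x)) \<in> borel_measurable borel"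
    by (rule measurable_scaled[OF borel_measurable_const f[unfolded tame_def, THEN conjunct1]])
  fix R
  obtain b where b: "\<And>x. x \<in> coord_space n \<Longrightarrow> lp_norm p n x \<le> \<bar>r\<bar> * R \<Longrightarrow> \<bar>f x\<bar> \<le> b"
    by (rule tame_bound[OF f, where R="\<bar>r\<bar> * R"]) blast
  show "\<exists>b. \<forall>x\<in>coord_space n. lp_norm p n x \<le> R \<longrightarrow> \<bar>f (r *\<^sub>R x)\<bar> \<le> b"
  proof (intro exI ballI impI)
    fix x assume x: "x \<in> coord_space n" "lp_norm p n x \<le> R"
    show "\<bar>f (r *\<^sub>R x)\<bar> \<le> b"
    proof (rule b)
      show "r *\<^sub>R x \<in> coord_space n" by (rule coord_space_closed(3)[OF x(1)])
      show "lp_norm p n (r *\<^sub>R x) \<le> \<bar>r\<bar> * R" unfolding lp_norm_scaleR[OF p] by (rule mult_left_mono[OF x(2)]) simp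
    qed
  qed
qed

lemma tame_minus:
  assumes f: "tame p n f" and g: "tame p n g" shows "tame p n (\<lambda>x. f x - g x)"
  unfolding tame_def
proof (intro conjI allI)
  show "(\<lambda>x. f x - g x) \<in> borel_measurable borel"
    by (rule borel_measurable_diff[OF f[unfolded tame_def, THEN conjunct1] g[unfolded tame_def, THEN conjunct1]])
  fix R
  obtain b where b: "\<And>x. x \<in> coord_space n \<Longrightarrow> lp_norm p n x \<le> R \<Longrightarrow> \<bar>f x\<bar> \<le> b"
    by (rule tame_bound[OF f, where R=R]) blast
  obtain c where c: "\<And>x. x \<in> coord_space n \<Longrightarrow> lp_norm p n x \<le> R \<Longrightarrow> \<bar>g x\<bar> \<le> c"
    by (rule tame_bound[OF g, where R=R]) blast
  show "\<exists>b. \<forall>x\<in>coord_space n. lp_norm p n x \<le> R \<longrightarrow> \<bar>f x - g x\<bar> \<le> b"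
  proof (intro exI ballI impI)
    fix x assume "x \<in> coord_space n" "lp_norm p n x \<le> R"
    then show "\<bar>f x - g x\<bar> \<le> b + c" using b[of x] c[of x] by linarith
  qed
qed

lemma smooth_bound_rescale:
  assumes p: "p > 0" and W: "smooth_bound p n m R K f" and r: "r \<ge> 0" "r * R' \<le> R"
  shows "smooth_bound p n m R' K (\<lambda>x. f (r *\<^sub>R x))"
  unfolding smooth_bound_def
proof (intro ballI impI)
  fix x h assume xh: "x \<in> coord_space n" "h \<in> coord_space n" "lp_norm p n x + real m * lp_norm p n h \<le> R'"
  have "finite_difference m h (\<lambda>x. f (r *\<^sub>R x)) x = finite_difference m (r *\<^sub>R h) f (r *\<^sub>R x)"
    unfolding finite_difference_eq by (simp only: scaleR_add_right scaleR_scaleR mult.commute)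
  moreover have "\<bar>finite_difference m (r *\<^sub>R h) f (r *\<^sub>R x)\<bar> \<le> K"
  proof (rule smooth_boundD[OF W coord_space_closed(3)[OF xh(1)] coord_space_closed(3)[OF xh(2)]])
    have "lp_norm p n (r *\<^sub>R x) + real m * lp_norm p n (r *\<^sub>R h) = r * (lp_norm p n x + real m * lp_norm p n h)"
      using r p by (simp add: algebra_simps)
    also have "\<dots> \<le> r * R'" by (rule mult_left_mono[OF xh(3) r(1)])
    finally show "lp_norm p n (r *\<^sub>R x) + real m * lp_norm p n (r *\<^sub>R h) \<le> R" using r(2) by linarith
  qed
  ultimately show "\<bar>finite_difference m h (\<lambda>x. f (r *\<^sub>R x)) x\<bar> \<le> K" by (simp only:)
qed

lemma finite_difference_minus:
  "finite_difference m h (\<lambda>x. f x - g x) x = finite_difference m h f x - finite_difference m h g x"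
  unfolding finite_difference_eq by (rule difference_sum_diff)

lemma abs_divide_fact_le: "\<bar>y / fact k\<bar> \<le> \<bar>y :: real\<bar>"
  using divide_left_mono[of 1 "fact k :: real" "\<bar>y\<bar>"] by (simp add: abs_divide fact_ge_1)

text \<open>
  A function that is exactly homogeneous of degree \<open>k\<close> and close to the leading part of \<open>g\<close> in the sense
  of the \<open>k\<close>-th difference at the origin. It need not be a polynomial.
\<close>
definition radial_part :: "real \<Rightarrow> nat \<Rightarrow> nat \<Rightarrow> ((nat \<Rightarrow> real) \<Rightarrow> real) \<Rightarrow> (nat \<Rightarrow> real) \<Rightarrow> real" where
  "radial_part p n k g x = lp_norm p n x ^ k * finite_difference k ((1 / lp_norm p n x) *\<^sub>R x) g 0 / fact k"

lemma tame_radial_part: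
  assumes p: "p > 0" and g: "tame p n g" shows "tame p n (radial_part p n k g)"
  unfolding tame_def
proof (intro conjI allI)
  have gm: "g \<in> borel_measurable borel" by (rule g[unfolded tame_def, THEN conjunct1])
  have eq: "radial_part p n k g = (\<lambda>x. lp_norm p n x ^ k *
      (\<Sum>j\<le>k. (- 1) ^ (k - j) * real (k choose j) * g ((real j * (1 / lp_norm p n x)) *\<^sub>R x)) / fact k)"
    by (rule ext) (simp only: radial_part_def finite_difference_eq difference_sum_def add_0_left scaleR_scaleR)
  show "radial_part p n k g \<in> borel_measurable borel"
    unfolding eq
    by (intro borel_measurable_divide borel_measurable_times borel_measurable_power borel_measurable_sum
        borel_measurable_const measurable_lp_norm measurable_scaled gm)
  fix R
  obtain b where b: "\<And>x. x \<in> coord_space n \<Longrightarrow> lp_norm p n x \<le> real k \<Longrightarrow> \<bar>g x\<bar> \<le> b"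
    by (rule tame_bound[OF g, where R="real k"]) blast
  show "\<exists>b. \<forall>x\<in>coord_space n. lp_norm p n x \<le> R \<longrightarrow> \<bar>radial_part p n k g x\<bar> \<le> b"
  proof (intro exI ballI impI)
    fix x assume x: "x \<in> coord_space n" "lp_norm p n x \<le> R"
    let ?u = "(1 / lp_norm p n x) *\<^sub>R x"
    have u: "?u \<in> coord_space n" "lp_norm p n ?u \<le> 1" using lp_ball_normalize[OF p x(1)] by (simp_all add: mem_lp_ball)
    have "\<bar>finite_difference k ?u g 0\<bar> \<le> 2 ^ k * b"
      unfolding finite_difference_eq
    proof (rule abs_difference_sum_le)
      fix j assume j: "j \<le> k"
      show "\<bar>g (0 + real j *\<^sub>R ?u)\<bar> \<le> b"
      proof (rule b)
        show "0 + real j *\<^sub>R ?u \<in> coord_space n" unfolding add_0_left by (rule coord_space_closed(3)[OF u(1)])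
        have "real j * lp_norm p n ?u \<le> real k * 1" using j u(2) by (intro mult_mono) auto
        then show "lp_norm p n (0 + real j *\<^sub>R ?u) \<le> real k"
          unfolding add_0_left lp_norm_scaleR[OF p, of n "real j"] by simp
      qed
    qed
    moreover have "\<bar>lp_norm p n x ^ k\<bar> \<le> R ^ k"
      using power_mono[OF x(2) lp_norm_nonneg, of k] by (simp add: power_abs)
    moreover have "0 \<le> R ^ k" using order_trans[OF lp_norm_nonneg x(2)] by simp
    ultimately have "\<bar>lp_norm p n x ^ k\<bar> * \<bar>finite_difference k ?u g 0\<bar> \<le> R ^ k * (2 ^ k * b)"
      by (intro mult_mono) simp_all
    moreover note abs_divide_fact_le[of _ k]
    ultimately show "\<bar>radial_part p n k g x\<bar> \<le> R ^ k * (2 ^ k * b)"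
      unfolding radial_part_def by (metis abs_mult order_trans)
  qed
qed

lemma radial_part_scaleR:
  assumes p: "p > 0" and t: "t \<ge> 0" and k: "k \<ge> 1"
  shows "radial_part p n k g (t *\<^sub>R x) = t ^ k * radial_part p n k g x"
proof (cases "t = 0 \<or> lp_norm p n x = 0")
  case True
  then show ?thesis using k t p by (auto simp: radial_part_def power_0_left simp del: scaleR_fun_apply)
next
  case False
  then have "(1 / lp_norm p n (t *\<^sub>R x)) *\<^sub>R (t *\<^sub>R x) = (1 / lp_norm p n x) *\<^sub>R x"
    unfolding lp_norm_scaleR[OF p] scaleR_scaleR using t by simp
  then show ?thesis unfolding radial_part_def lp_norm_scaleR[OF p] using t by (simp only: power_mult_distrib abs_of_nonneg) simp
qed

lemma finite_difference_homogeneous: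
  assumes "\<And>t. t \<ge> 0 \<Longrightarrow> F (t *\<^sub>R h) = t ^ k * F h"
  shows "finite_difference k h F 0 = fact k * F h"
proof -
  have "finite_difference k h F 0 = difference_sum k (\<lambda>j. real j ^ k * F h)"
    unfolding finite_difference_eq add_0_left by (simp only: assms of_nat_0_le_iff)
  also have "\<dots> = difference_sum k (\<lambda>j. real j ^ k) * F h"
    unfolding difference_sum_def by (simp only: sum_distrib_right mult.assoc)
  finally show ?thesis by (simp add: difference_sum_power)
qed

lemma radial_part_close:
  assumes p: "p \<ge> 1" and g: "tame p n g" and h: "h \<in> lp_ball p n"
    and md: "\<And>hs. length hs = Suc k \<Longrightarrow> set hs \<subseteq> lp_ball p n \<Longrightarrow> \<bar>mixed_diff hs g 0\<bar> \<le> K"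
  shows "\<bar>finite_difference k h g 0 - fact k * radial_part p n k g h\<bar> \<le> 3 * real k * K"
proof -
  have p0: "p > 0" using p by simp
  have hc: "h \<in> coord_space n" "lp_norm p n h \<le> 1" using h by (auto simp: mem_lp_ball)
  let ?u = "(1 / lp_norm p n h) *\<^sub>R h"
  note hu = lp_norm_scaleR_normalize[OF hc(1), of p]
  have "\<bar>mixed_diff (replicate k (lp_norm p n h *\<^sub>R ?u)) g 0 - lp_norm p n h ^ k * mixed_diff (replicate k ?u) g 0\<bar> \<le> 3 * real k * K"
    by (rule mixed_diff_ray[OF p lp_ball_normalize[OF p0 hc(1)] lp_norm_nonneg hc(2) g md])
  then show ?thesis unfolding hu mixed_diff_replicate radial_part_def by simp
qed

text \<open>
  Shrinking the ball from radius \<open>1\<close> to \<open>r\<close> leaves room for the differences used in the proof. The radius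
  must not depend on the dimension.
\<close>
definition local_whitney :: "real \<Rightarrow> nat \<Rightarrow> real \<Rightarrow> real \<Rightarrow> bool" where
  "local_whitney p m C r \<longleftrightarrow> (\<forall>n f K. n \<ge> 1 \<longrightarrow> K \<ge> 0 \<longrightarrow> tame p n f \<longrightarrow> smooth_bound p n m 1 K f \<longrightarrow>
     (\<exists>\<phi>\<in>polynomials n (m - 1). \<forall>x\<in>coord_space n. lp_norm p n x \<le> r \<longrightarrow> \<bar>f x - \<phi> x\<bar> \<le> C * K * rate n (m - 1)))"

lemma rate_bounds:
  assumes "n \<ge> 1" shows "1 \<le> 2 * rate n k" "rate n k \<le> rate n (Suc k)"
proof -
  show "1 \<le> 2 * rate n k" using log_depth[OF assms] ln_le_rate[OF assms, of k] by (smt (verit))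
  have "sqrt (real n) ^ (k - 2) \<le> sqrt (real n) ^ (Suc k - 2)" using assms by (intro power_increasing) auto
  then show "rate n k \<le> rate n (Suc k)" unfolding rate_def by (rule mult_right_mono) simp
qed

text \<open>
  At the origin the \<open>k\<close>-th differences of \<open>g\<close> and of its radial part almost agree, by homogeneity of the
  latter. Moving the base point from \<open>0\<close> to \<open>x\<close> costs a mixed difference of order \<open>k + 1\<close>. That one is
  bounded for the radial part too, which is close to a fixed linear combination of dilates of \<open>g\<close>. The
  bound for the remainder is a multiple of \<open>K\<close> independent of the dimension.
\<close>
lemma smooth_bound_remainder:
  fixes g :: "(nat \<Rightarrow> real) \<Rightarrow> real"
  assumes p: "p \<ge> 1" and n: "n \<ge> 1" and k: "k \<ge> 1" and K: "K \<ge> 0" and g: "tame p n g"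
  defines "m \<equiv> Suc k"
  assumes W: "smooth_bound p n m (real m * (real m + 1)) K g"
    and md: "\<And>hs. length hs = Suc k \<Longrightarrow> set hs \<subseteq> lp_ball p n \<Longrightarrow> \<bar>mixed_diff hs g 0\<bar> \<le> 2 ^ m * K"
  shows "smooth_bound p n k (1 / (real m * (real m + 1)))
     ((3 * real k * 2 ^ m + 2 ^ m * (1 + 2 ^ m * (3 * real k * 2 ^ m) + 2 ^ k)) * K) (\<lambda>x. g x - radial_part p n k g x)"
proof -
  let ?N = "lp_norm p n" and ?F = "radial_part p n k g"
  let ?K1 = "3 * real k * (2 ^ m * K)"
  let ?K3 = "K + (2 ^ m * ?K1 + 2 ^ k * K)"
  define \<rho> where "\<rho> = 1 / (real m * (real m + 1))"
  have p0: "p > 0" using p by simp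
  have m1: "real m \<ge> 1" by (simp add: m_def)
  have \<rho>: "\<rho> > 0" "real m * (real m + 1) * \<rho> = 1" using m1 by (auto simp: \<rho>_def)
  have \<rho>1: "\<rho> \<le> 1"
  proof -
    have "1 * 1 \<le> real m * (real m + 1)" using m1 by (intro mult_mono) auto
    then show ?thesis by (simp add: \<rho>_def divide_simps)
  qed
  have close: "\<bar>finite_difference k x g 0 - fact k * ?F x\<bar> \<le> ?K1" if "x \<in> lp_ball p n" for x
    by (rule radial_part_close[OF p g that md])
  note fact1 = abs_divide_fact_le[of _ k]
  have WG: "smooth_bound p n m 1 ?K3 (\<lambda>x. g x - ?F x)"
    unfolding smooth_bound_def
  proof (intro ballI impI)
    fix x h assume xh: "x \<in> coord_space n" "h \<in> coord_space n" "?N x + real m * ?N h \<le> 1"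
    have gb: "\<bar>finite_difference m h g x\<bar> \<le> K"
    proof (rule smooth_boundD[OF W xh(1,2)])
      have "1 * 1 \<le> real m * (real m + 1)" using m1 by (intro mult_mono) auto
      then show "?N x + real m * ?N h \<le> real m * (real m + 1)" using xh(3) by linarith
    qed
    note ball = difference_points_in_ball[OF p xh]
    define q where "q y = finite_difference k y g 0 / fact k" for y
    have qF: "\<bar>?F y - q y\<bar> \<le> ?K1" if "y \<in> lp_ball p n" for y
    proof -
      have "?F y - q y = - ((finite_difference k y g 0 - fact k * ?F y) / fact k)"
        by (simp add: q_def field_simps)
      then show ?thesis using fact1[of "finite_difference k y g 0 - fact k * ?F y"] close[OF that] by simp
    qed
    have 1: "\<bar>difference_sum m (\<lambda>j. ?F (x + real j *\<^sub>R h) - q (x + real j *\<^sub>R h))\<bar> \<le> 2 ^ m * ?K1"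
      by (rule abs_difference_sum_le) (rule qF[OF ball])
    have 2: "\<bar>difference_sum m (\<lambda>j. q (x + real j *\<^sub>R h))\<bar> \<le> 2 ^ k * K"
    proof -
      have pt: "0 + real i *\<^sub>R (x + real j *\<^sub>R h) = real i *\<^sub>R x + real j *\<^sub>R (real i *\<^sub>R h)" for i j
        by (simp only: add_0_left scaleR_add_right scaleR_scaleR mult.commute)
      have "difference_sum m (\<lambda>j. q (x + real j *\<^sub>R h))
          = difference_sum m (\<lambda>j. \<Sum>i\<le>k. ((- 1) ^ (k - i) * real (k choose i) / fact k) * g (real i *\<^sub>R x + real j *\<^sub>R (real i *\<^sub>R h)))"
        unfolding q_def finite_difference_eq difference_sum_def[of k] pt by (simp add: sum_divide_distrib)
      also have "\<dots> = (\<Sum>i\<le>k. ((- 1) ^ (k - i) * real (k choose i) / fact k) * finite_difference m (real i *\<^sub>R h) g (real i *\<^sub>R x))"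
        unfolding difference_sum_sum finite_difference_eq ..
      also have "\<dots> = difference_sum k (\<lambda>i. finite_difference m (real i *\<^sub>R h) g (real i *\<^sub>R x)) / fact k"
        unfolding difference_sum_def by (simp add: sum_divide_distrib)
      finally have eq: "difference_sum m (\<lambda>j. q (x + real j *\<^sub>R h)) = difference_sum k (\<lambda>i. finite_difference m (real i *\<^sub>R h) g (real i *\<^sub>R x)) / fact k" .
      have "\<bar>difference_sum k (\<lambda>i. finite_difference m (real i *\<^sub>R h) g (real i *\<^sub>R x))\<bar> \<le> 2 ^ k * K"
      proof (rule abs_difference_sum_le)
        fix i assume i: "i \<le> k"
        show "\<bar>finite_difference m (real i *\<^sub>R h) g (real i *\<^sub>R x)\<bar> \<le> K"
        proof (rule smooth_boundD[OF W coord_space_closed(3)[OF xh(1)] coord_space_closed(3)[OF xh(2)]])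
          have "?N (real i *\<^sub>R x) + real m * ?N (real i *\<^sub>R h) = real i * (?N x + real m * ?N h)"
            unfolding lp_norm_scaleR[OF p0] by (simp add: algebra_simps)
          also have "\<dots> \<le> real m * (real m + 1)"
            using xh(3) i by (intro mult_mono) (auto simp: m_def)
          finally show "?N (real i *\<^sub>R x) + real m * ?N (real i *\<^sub>R h) \<le> real m * (real m + 1)" .
        qed
      qed
      then show ?thesis unfolding eq using fact1 order_trans by blast
    qed
    have "finite_difference m h ?F x = difference_sum m (\<lambda>j. ?F (x + real j *\<^sub>R h) - q (x + real j *\<^sub>R h))
        + difference_sum m (\<lambda>j. q (x + real j *\<^sub>R h))"
      unfolding finite_difference_eq difference_sum_diff by simp
    then have "\<bar>finite_difference m h ?F x\<bar> \<le> 2 ^ m * ?K1 + 2 ^ k * K" using 1 2 by linarith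
    then show "\<bar>finite_difference m h (\<lambda>x. g x - ?F x) x\<bar> \<le> ?K3"
      unfolding finite_difference_minus using gb by linarith
  qed
  show ?thesis
    unfolding smooth_bound_def \<rho>_def[symmetric]
  proof (intro ballI impI)
    fix x h assume xh: "x \<in> coord_space n" "h \<in> coord_space n" "?N x + real k * ?N h \<le> \<rho>"
    let ?G = "\<lambda>x. g x - ?F x"
    have Nh: "?N h \<le> real k * ?N h" using k mult_right_mono[of 1 "real k" "?N h"] by simp
    have Nx: "?N x \<ge> 0" by simp
    have Nk: "real k * ?N h \<ge> 0" by simp
    have small: "?N x \<le> \<rho>" "?N h \<le> \<rho>" using xh(3) Nh Nx Nk by linarith+
    have hball: "h \<in> lp_ball p n" using xh(2) small(2) \<rho>1 by (simp add: mem_lp_ball)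
    have "\<bar>mixed_diff (x # replicate k h) ?G 0\<bar> \<le> 2 ^ m * ?K3"
    proof (rule mixed_diff_bound[OF p WG])
      show "length (x # replicate k h) = m" by (simp add: m_def)
      show "set (x # replicate k h) \<subseteq> coord_space n" using xh by (auto simp: set_replicate_conv_if)
      show "?N y \<le> \<rho>" if "y \<in> set (x # replicate k h)" for y
        using that small by (auto simp: set_replicate_conv_if split: if_splits)
      show "real m * (real m + 1) * \<rho> \<le> 1" using \<rho>(2) by simp
      show "m \<ge> 1" by (simp add: m_def)
    qed
    then have 1: "\<bar>finite_difference k h ?G x - finite_difference k h ?G 0\<bar> \<le> 2 ^ m * ?K3"
      by (simp only: mixed_diff_Cons mixed_diff_replicate add_0_left)
    have "finite_difference k h ?F 0 = fact k * ?F h"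
      by (rule finite_difference_homogeneous) (rule radial_part_scaleR[OF p0 _ k])
    then have "\<bar>finite_difference k h ?G 0\<bar> \<le> ?K1"
      unfolding finite_difference_minus using close[OF hball] by simp
    then have "\<bar>finite_difference k h ?G x\<bar> \<le> ?K1 + 2 ^ m * ?K3" using 1 by linarith
    also have "\<dots> = (3 * real k * 2 ^ m + 2 ^ m * (1 + 2 ^ m * (3 * real k * 2 ^ m) + 2 ^ k)) * K"
      by (simp add: algebra_simps)
    finally show "\<bar>finite_difference k h ?G x\<bar>
        \<le> (3 * real k * 2 ^ m + 2 ^ m * (1 + 2 ^ m * (3 * real k * 2 ^ m) + 2 ^ k)) * K" .
  qed
qed

lemma local_whitney_1: "local_whitney p 1 2 1"
  unfolding local_whitney_def
proof (intro allI impI)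
  fix n :: nat and f and K :: real
  assume n: "n \<ge> 1" and K: "K \<ge> 0" and W: "smooth_bound p n 1 1 K f"
  have "\<bar>f x - f 0\<bar> \<le> 2 * K * rate n (1 - 1)" if x: "x \<in> coord_space n" "lp_norm p n x \<le> 1" for x
  proof -
    have "finite_difference 1 x f 0 = f x - f 0"
      unfolding finite_difference_eq difference_sum_def by simp
    moreover have "\<bar>finite_difference 1 x f 0\<bar> \<le> K"
      by (rule smooth_boundD[OF W]) (use x in auto)
    moreover have "K \<le> 2 * K * rate n (1 - 1)"
      using mult_left_mono[OF rate_bounds(1)[OF n, of "1 - 1"] K] by (simp add: mult_ac)
    ultimately show ?thesis by linarith
  qed
  then show "\<exists>\<phi>\<in>polynomials n (1 - 1). \<forall>x\<in>coord_space n. lp_norm p n x \<le> 1 \<longrightarrow> \<bar>f x - \<phi> x\<bar> \<le> 2 * K * rate n (1 - 1)"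
    by (intro bexI[of _ "\<lambda>_. f 0"] polynomials_const) blast
qed

text \<open>
  The radial part is within the multilinear error of the polynomial \<open>M (x, ..., x) / k!\<close>, because both
  are read off from the \<open>k\<close>-th difference at the origin, and the remainder has bounded differences of
  order \<open>k\<close>. The two errors are added.
\<close>
lemma local_whitney_Suc:
  assumes p: "p \<ge> 2" and k: "k \<ge> 1" and IH: "local_whitney p k C r" "C \<ge> 0" "r > 0"
    and Ck: "multilinear_constant p k Ck" "Ck \<ge> 0"
  shows "\<exists>C'\<ge>0. \<exists>r'>0. local_whitney p (Suc k) C' r'"
proof -
  define m where "m = Suc k"
  define \<rho> where "\<rho> = 1 / (real m * (real m + 1))"
  define c4 where "c4 = 3 * real k * 2 ^ m + 2 ^ m * (1 + 2 ^ m * (3 * real k * 2 ^ m) + 2 ^ k)"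
  define C' where "C' = C * c4 + 6 * real k * 2 ^ m + Ck * 2 ^ m"
  define r' where "r' = \<rho> * \<rho> * min r 1"
  have p1: "p \<ge> 1" and p0: "p > 0" using p by auto
  have m1: "real m \<ge> 1" by (simp add: m_def)
  have \<rho>: "\<rho> > 0" "real m * (real m + 1) * \<rho> = 1" using m1 by (auto simp: \<rho>_def)
  have \<rho>1: "\<rho> \<le> 1"
  proof -
    have "1 * 1 \<le> real m * (real m + 1)" using m1 by (intro mult_mono) auto
    then show ?thesis by (simp add: \<rho>_def divide_simps)
  qed
  have c4: "c4 \<ge> 0" by (simp add: c4_def)
  have "local_whitney p m C' r'"
    unfolding local_whitney_def
  proof (intro allI impI)
    fix n :: nat and f and K :: real
    assume n: "n \<ge> 1" and K: "K \<ge> 0" and f: "tame p n f" and W: "smooth_bound p n m 1 K f"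
    define g where "g x = f (\<rho> *\<^sub>R x)" for x
    have g: "tame p n g" unfolding g_def by (rule tame_rescale[OF p0 f])
    have Wg: "smooth_bound p n m (real m * (real m + 1)) K g"
      unfolding g_def by (rule smooth_bound_rescale[OF p0 W]) (use \<rho> in \<open>simp_all add: mult.commute\<close>)
    have md: "\<bar>mixed_diff hs g 0\<bar> \<le> 2 ^ m * K" if "length hs = Suc k" "set hs \<subseteq> lp_ball p n" for hs
      by (rule mixed_diff_bound[OF p1 Wg, where \<sigma>=1]) (use that in \<open>auto simp: m_def mem_lp_ball\<close>)
    have K1: "2 ^ m * K \<ge> 0" using K by simp
    let ?F = "radial_part p n k g"
    define G where "G x = g (\<rho> *\<^sub>R x) - ?F (\<rho> *\<^sub>R x)" for x
    have G: "tame p n G" unfolding G_def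
      by (rule tame_rescale[OF p0, of n "\<lambda>x. g x - ?F x"]) (rule tame_minus[OF g tame_radial_part[OF p0 g]])
    have "smooth_bound p n k \<rho> (c4 * K) (\<lambda>x. g x - ?F x)"
      unfolding \<rho>_def c4_def m_def
      by (rule smooth_bound_remainder[OF p1 n k K g Wg[unfolded m_def] md[unfolded m_def]])
    then have WG: "smooth_bound p n k 1 (c4 * K) G"
      unfolding G_def by (rule smooth_bound_rescale[OF p0]) (use \<rho> in auto)
    have "c4 * K \<ge> 0" using c4 K by simp
    from IH(1)[unfolded local_whitney_def, rule_format, OF n this G WG] obtain \<phi> where
      \<phi>: "\<phi> \<in> polynomials n (k - 1)" "\<forall>x\<in>coord_space n. lp_norm p n x \<le> r \<longrightarrow> \<bar>G x - \<phi> x\<bar> \<le> C * (c4 * K) * rate n (k - 1)"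
      by (rule bexE)
    from multilinear_constantD[OF Ck(1) n g K1 md] obtain M where
      M: "M \<in> multilinear_forms n k" "\<forall>hs. length hs = k \<longrightarrow> set hs \<subseteq> lp_ball p n \<longrightarrow>
        \<bar>mixed_diff hs g 0 - M hs\<bar> \<le> Ck * (2 ^ m * K) * rate n k"
      by (rule bexE)
    define P where "P x = M (replicate k x)" for x
    have P: "P \<in> polynomials n k" unfolding P_def by (rule polynomials_multilinear_diagonal[OF M(1)])
    (* Both rescalings are undone: one for f to g, one more for the remainder G. *)
    define \<psi> where "\<psi> x = (1 / fact k) * P ((1 / \<rho>) *\<^sub>R x) + \<phi> ((1 / (\<rho> * \<rho>)) *\<^sub>R x)" for x
    have \<psi>: "\<psi> \<in> polynomials n (m - 1)"
    proof -
      have "(\<lambda>x. \<Sum>i\<in>{()}. (1 / fact k) * P ((1 / \<rho>) *\<^sub>R x)) \<in> polynomials n k"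
        by (rule polynomials_sum) (auto intro: polynomials_rescale[OF P])
      then have 1: "(\<lambda>x. (1 / fact k) * P ((1 / \<rho>) *\<^sub>R x)) \<in> polynomials n k" by simp
      have 2: "(\<lambda>x. \<phi> ((1 / (\<rho> * \<rho>)) *\<^sub>R x)) \<in> polynomials n k"
        by (rule polynomials_rescale[OF polynomials_mono[OF \<phi>(1)]]) simp
      show ?thesis using polynomials_add[OF 1 2] unfolding \<psi>_def m_def by simp
    qed
    have "\<bar>f x - \<psi> x\<bar> \<le> C' * K * rate n (m - 1)" if x: "x \<in> coord_space n" "lp_norm p n x \<le> r'" for x
    proof -
      define y where "y = (1 / \<rho>) *\<^sub>R x"
      define z where "z = (1 / (\<rho> * \<rho>)) *\<^sub>R x"
      have yz: "\<rho> *\<^sub>R z = y" "\<rho> *\<^sub>R y = x" using \<rho>(1) by (simp_all add: y_def z_def)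
      have yc: "y \<in> coord_space n" and zc: "z \<in> coord_space n"
        unfolding y_def z_def by (rule coord_space_closed(3)[OF x(1)])+
      have "lp_norm p n z = lp_norm p n x / (\<rho> * \<rho>)"
        unfolding z_def lp_norm_scaleR[OF p0] using \<rho>(1) by simp
      also have "\<dots> \<le> r' / (\<rho> * \<rho>)" using x(2) \<rho>(1) by (intro divide_right_mono) auto
      also have "\<dots> = min r 1" using \<rho>(1) by (simp add: r'_def)
      finally have Nz: "lp_norm p n z \<le> r" "lp_norm p n z \<le> 1" by auto
      have Ny: "lp_norm p n y \<le> 1"
      proof -
        have "lp_norm p n y = \<rho> * lp_norm p n z" unfolding yz(1)[symmetric] lp_norm_scaleR[OF p0] using \<rho>(1) by simp
        also have "\<dots> \<le> 1 * 1" using Nz(2) \<rho> \<rho>1 by (intro mult_mono) auto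
        finally show ?thesis by simp
      qed
      have yb: "y \<in> lp_ball p n" using yc Ny by (simp add: mem_lp_ball)
      have a: "\<bar>G z - \<phi> z\<bar> \<le> C * (c4 * K) * rate n (k - 1)" using \<phi>(2) zc Nz(1) by blast
      have Gz: "G z = f x - ?F y" unfolding G_def g_def yz ..
      have b1: "\<bar>finite_difference k y g 0 - fact k * ?F y\<bar> \<le> 3 * real k * (2 ^ m * K)"
        by (rule radial_part_close[OF p1 g yb md])
      have b2: "\<bar>finite_difference k y g 0 - P y\<bar> \<le> Ck * (2 ^ m * K) * rate n k"
      proof -
        have "set (replicate k y) \<subseteq> lp_ball p n" using yb by (auto simp: set_replicate_conv_if)
        then have "\<bar>mixed_diff (replicate k y) g 0 - M (replicate k y)\<bar> \<le> Ck * (2 ^ m * K) * rate n k"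
          using M(2) by (metis length_replicate)
        then show ?thesis unfolding mixed_diff_replicate P_def .
      qed
      note fact1 = abs_divide_fact_le[of _ k]
      have "?F y - (1 / fact k) * P y = (fact k * ?F y - P y) / fact k" by (simp add: field_simps)
      then have b: "\<bar>?F y - (1 / fact k) * P y\<bar> \<le> 3 * real k * (2 ^ m * K) + Ck * (2 ^ m * K) * rate n k"
        using fact1[of "fact k * ?F y - P y"] b1 b2 by linarith
      have "f x - \<psi> x = (G z - \<phi> z) + (?F y - (1 / fact k) * P y)"
        unfolding Gz \<psi>_def y_def[symmetric] z_def[symmetric] by simp
      then have "\<bar>f x - \<psi> x\<bar> \<le> C * (c4 * K) * rate n (k - 1) + (3 * real k * (2 ^ m * K) + Ck * (2 ^ m * K) * rate n k)"
        using a b by linarith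
      also have "\<dots> \<le> C * (c4 * K) * rate n k + (3 * real k * (2 ^ m * K) * (2 * rate n k) + Ck * (2 ^ m * K) * rate n k)"
      proof (intro add_mono order_refl)
        have "rate n (k - 1) \<le> rate n k" using rate_bounds(2)[OF n, of "k - 1"] k by simp
        then show "C * (c4 * K) * rate n (k - 1) \<le> C * (c4 * K) * rate n k"
          using IH(2) c4 K by (intro mult_left_mono) auto
        show "3 * real k * (2 ^ m * K) \<le> 3 * real k * (2 ^ m * K) * (2 * rate n k)"
          using mult_left_mono[OF rate_bounds(1)[OF n, of k], of "3 * real k * (2 ^ m * K)"] K by simp
      qed
      also have "\<dots> = C' * K * rate n (m - 1)" by (simp add: C'_def m_def algebra_simps)
      finally show ?thesis .
    qed
    then show "\<exists>\<phi>\<in>polynomials n (m - 1). \<forall>x\<in>coord_space n. lp_norm p n x \<le> r' \<longrightarrow> \<bar>f x - \<phi> x\<bar> \<le> C' * K * rate n (m - 1)"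
      using \<psi> by (intro bexI[of _ \<psi>]) blast
  qed
  moreover have "C' \<ge> 0" using IH(2) Ck(2) c4 by (simp add: C'_def)
  moreover have "r' > 0" using \<rho>(1) IH(3) by (simp add: r'_def)
  ultimately show ?thesis unfolding m_def by blast
qed

lemma local_whitney_exists:
  assumes p: "p \<ge> 2" and "m \<ge> 1"
  shows "\<exists>C\<ge>0. \<exists>r>0. local_whitney p m C r"
  using assms(2)
proof (induction m rule: dec_induct)
  case base
  show ?case using local_whitney_1[of p] by (intro exI[of _ 2] conjI exI[of _ 1]) auto
next
  case (step k)
  obtain C r where C: "C \<ge> 0" "r > 0" "local_whitney p k C r" using step(3) by blast
  obtain Ck where Ck: "Ck \<ge> 0" "multilinear_constant p k Ck"
    using multilinear_constant_exists[OF p step(1)] by blast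
  show ?case by (rule local_whitney_Suc[OF p step(1) C(3,1,2) Ck(2,1)])
qed

section \<open>Extrapolation to the unit ball\<close>
text \<open>
  With \<open>h = x / m\<close> the difference at the origin involves \<open>x\<close> and points of norm at most
  \<open>(m - 1) / m\<close> times that of \<open>x\<close>.
\<close>
lemma extrapolation_step:
  assumes p: "p \<ge> 1" and m: "m \<ge> 2" and W: "smooth_bound p n m 1 K g" and K: "K \<le> b" "b \<ge> 0"
    and bound: "\<And>x. x \<in> coord_space n \<Longrightarrow> lp_norm p n x \<le> s \<Longrightarrow> \<bar>g x\<bar> \<le> b"
    and x: "x \<in> coord_space n" "lp_norm p n x \<le> 1" "lp_norm p n x \<le> s * (real m / (real m - 1))"
  shows "\<bar>g x\<bar> \<le> (1 + 2 ^ m) * b"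
proof -
  have p0: "p > 0" using p by simp
  have m1: "real m - 1 > 0" "real m > 0" using m by auto
  define h where "h = (1 / real m) *\<^sub>R x"
  define F where "F j = g (0 + real j *\<^sub>R h)" for j
  have mh: "real m *\<^sub>R h = x" using m1 by (simp add: h_def)
  have hc: "h \<in> coord_space n" unfolding h_def by (rule coord_space_closed(3)[OF x(1)])
  have Nh: "lp_norm p n h = lp_norm p n x / real m" unfolding h_def lp_norm_scaleR[OF p0] by simp
  have "\<bar>finite_difference m h g 0\<bar> \<le> K"
  proof (rule smooth_boundD[OF W coord_space_closed(1) hc])
    show "lp_norm p n 0 + real m * lp_norm p n h \<le> 1" unfolding Nh using m1 x(2) by simp
  qed
  then have 1: "\<bar>difference_sum m F\<bar> \<le> K" unfolding finite_difference_eq F_def .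
  have "\<bar>difference_sum m (\<lambda>j. F j - (if j = m then F m else 0))\<bar> \<le> 2 ^ m * b"
  proof (rule abs_difference_sum_le)
    fix j assume "j \<le> m"
    show "\<bar>F j - (if j = m then F m else 0)\<bar> \<le> b"
    proof (cases "j = m")
      case True then show ?thesis using K(2) by simp
    next
      case False
      then have j: "real j \<le> real m - 1" using \<open>j \<le> m\<close> by linarith
      have "\<bar>g (0 + real j *\<^sub>R h)\<bar> \<le> b"
      proof (rule bound)
        show "0 + real j *\<^sub>R h \<in> coord_space n" unfolding add_0_left by (rule coord_space_closed(3)[OF hc])
        have "lp_norm p n (0 + real j *\<^sub>R h) = real j * (lp_norm p n x / real m)"
          unfolding add_0_left lp_norm_scaleR[OF p0] Nh by simp
        also have "\<dots> \<le> (real m - 1) * (s * (real m / (real m - 1)) / real m)"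
          using j x(3) m1 by (intro mult_mono divide_right_mono) auto
        also have "\<dots> = s" using m1 by simp
        finally show "lp_norm p n (0 + real j *\<^sub>R h) \<le> s" .
      qed
      then show ?thesis using False by (simp only: F_def if_False diff_0_right)
    qed
  qed
  moreover have "difference_sum m (\<lambda>j. if j = m then F m else 0) = F m"
  proof -
    have "difference_sum m (\<lambda>j. if j = m then F m else 0) = (\<Sum>j\<le>m. if j = m then F m else 0)"
      unfolding difference_sum_def by (intro sum.cong) auto
    then show ?thesis by (simp add: sum.delta)
  qed
  ultimately have "\<bar>difference_sum m F - F m\<bar> \<le> 2 ^ m * b" by (simp only: difference_sum_diff)
  moreover have "F m = g x" unfolding F_def mh add_0_left ..
  ultimately have "\<bar>g x\<bar> \<le> K + 2 ^ m * b" using 1 by linarith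
  then show ?thesis using K(1) by (simp add: algebra_simps)
qed

lemma extrapolation:
  assumes p: "p \<ge> 1" and m: "m \<ge> 2" and W: "smooth_bound p n m 1 K g" and K: "K \<le> b" "b \<ge> 0"
    and bound: "\<And>x. x \<in> coord_space n \<Longrightarrow> lp_norm p n x \<le> s \<Longrightarrow> \<bar>g x\<bar> \<le> b"
    and x: "x \<in> coord_space n" "lp_norm p n x \<le> 1" "lp_norm p n x \<le> s * (real m / (real m - 1)) ^ i"
  shows "\<bar>g x\<bar> \<le> (1 + 2 ^ m) ^ i * b"
  using x
proof (induction i arbitrary: x)
  case 0
  then show ?case using bound by simp
next
  case (Suc i)
  let ?q = "real m / (real m - 1)" and ?b = "(1 + 2 ^ m) ^ i * b"
  have q: "?q \<ge> 1" using m by simp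
  have one: "(1::real) \<le> (1 + 2 ^ m) ^ i" by (rule one_le_power) simp
  have b: "b \<le> ?b" using mult_right_mono[OF one K(2)] by simp
  have "\<bar>g x\<bar> \<le> (1 + 2 ^ m) * ?b"
  proof (rule extrapolation_step[OF p m W, where s="min 1 (s * ?q ^ i)"])
    show "K \<le> ?b" "0 \<le> ?b" using K b by linarith+
    show "\<bar>g y\<bar> \<le> ?b" if "y \<in> coord_space n" "lp_norm p n y \<le> min 1 (s * ?q ^ i)" for y
      using that by (intro Suc.IH) auto
    show "lp_norm p n x \<le> min 1 (s * ?q ^ i) * ?q"
    proof (cases "1 \<le> s * ?q ^ i")
      case True
      then show ?thesis using Suc.prems(2) q by (simp add: min_def)
    next
      case False
      then show ?thesis using Suc.prems(3) by (simp add: min_def mult_ac)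
    qed
  qed (use Suc.prems in auto)
  then show ?case by (simp add: mult_ac)
qed

lemma continuous_on_lp_norm:
  assumes "p > 0" shows "continuous_on UNIV (lp_norm p n)"
proof -
  have c: "continuous_on UNIV (\<lambda>x :: nat \<Rightarrow> real. x i)" for i by (rule continuous_on_product_coordinates)
  have "continuous_on UNIV (\<lambda>x :: nat \<Rightarrow> real. (\<Sum>i<n. \<bar>x i\<bar> powr p) powr (1 / p))"
    by (intro continuous_on_powr' continuous_on_sum continuous_on_rabs c continuous_on_const)
      (use assms in \<open>auto simp: sum_nonneg\<close>)
  then show ?thesis unfolding lp_norm_def .
qed

lemma compact_lp_ball:
  assumes p: "p > 0" shows "compact (lp_ball p n)"
proof -
  have c: "continuous_on UNIV (\<lambda>x :: nat \<Rightarrow> real. x i)" for i by (rule continuous_on_product_coordinates)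
  have eq: "lp_ball p n = (\<Inter>i\<in>{n..}. {x. x i = 0}) \<inter> {x. lp_norm p n x \<le> 1}"
    by (auto simp: mem_lp_ball coord_space_def)
  have "closed (lp_ball p n)" unfolding eq
    by (intro closed_Int closed_INT ballI closed_Collect_eq closed_Collect_le c continuous_on_const continuous_on_lp_norm p)
  moreover have "compact (PiE UNIV (\<lambda>_::nat. {-1..1::real}))"
  proof -
    have "compactin (product_topology (\<lambda>_::nat. euclidean) UNIV) (PiE UNIV (\<lambda>_. {-1..1::real}))"
      unfolding compactin_PiE by simp
    then show ?thesis by (simp add: euclidean_product_topology)
  qed
  moreover have "lp_ball p n \<subseteq> PiE UNIV (\<lambda>_. {-1..1})"
  proof
    fix x assume x: "x \<in> lp_ball p n"
    have "\<bar>x i\<bar> \<le> 1" for i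
    proof (cases "i < n")
      case True
      then show ?thesis using abs_coord_le_lp_norm[OF p True, of x] x by (simp add: mem_lp_ball)
    next
      case False
      then show ?thesis using x by (simp add: mem_lp_ball coord_space_def)
    qed
    then show "x \<in> PiE UNIV (\<lambda>_. {-1..1})" by (auto simp: abs_le_iff minus_le_iff)
  qed
  ultimately show ?thesis by (metis compact_Int_closed inf.absorb_iff2)
qed

text \<open>
  Extending \<open>f\<close> by zero makes it measurable on the whole space; the jump at the boundary is harmless
  because all differences are taken inside the ball.
\<close>
lemma tame_indicator:
  assumes p: "p > 0" and f: "continuous_on (lp_ball p n) f"
  shows "tame p n (\<lambda>x. indicator (lp_ball p n) x *\<^sub>R f x)"
  unfolding tame_def
proof (intro conjI allI)
  have "lp_ball p n = coord_space n \<inter> lp_norm p n -` {..1}" by (auto simp: mem_lp_ball)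
  also have "\<dots> \<in> sets borel"
    using coord_space_measurable measurable_sets[OF measurable_lp_norm, of "{..1}" p n] by (intro sets.Int) simp_all
  finally have "lp_ball p n \<in> sets borel" .
  then show "(\<lambda>x. indicator (lp_ball p n) x *\<^sub>R f x) \<in> borel_measurable borel"
    using f by (rule borel_measurable_continuous_on_indicator)
  have "bounded (f ` lp_ball p n)" by (rule compact_imp_bounded[OF compact_continuous_image[OF f compact_lp_ball[OF p]]])
  then obtain b where b: "\<And>x. x \<in> lp_ball p n \<Longrightarrow> \<bar>f x\<bar> \<le> b" by (auto simp: bounded_iff)
  fix R
  have "\<bar>indicator (lp_ball p n) x *\<^sub>R f x\<bar> \<le> \<bar>b\<bar>" for x
  proof (cases "x \<in> lp_ball p n")
    case True then show ?thesis using b[OF True] by simp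
  qed simp
  then show "\<exists>b. \<forall>x\<in>coord_space n. lp_norm p n x \<le> R \<longrightarrow> \<bar>indicator (lp_ball p n) x *\<^sub>R f x\<bar> \<le> b" by blast
qed

lemma smooth_bound_indicator:
  assumes p: "p \<ge> 1" and f: "modulus_of_smoothness m n (lp_norm p n) f \<le> 1"
  shows "smooth_bound p n m 1 1 (\<lambda>x. indicator (lp_ball p n) x *\<^sub>R f x)"
  unfolding smooth_bound_def
proof (intro ballI impI)
  fix x h assume xh: "x \<in> coord_space n" "h \<in> coord_space n" "lp_norm p n x + real m * lp_norm p n h \<le> 1"
  have p0: "p > 0" using p by simp
  have eq: "(\<lambda>i. x i + real j * h i) = x + real j *\<^sub>R h" for j by (simp add: fun_eq_iff)
  note ball = difference_points_in_ball[OF p xh]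
  have "finite_difference m h (\<lambda>x. indicator (lp_ball p n) x *\<^sub>R f x) x = finite_difference m h f x"
    unfolding finite_difference_eq difference_sum_def
    by (intro sum.cong refl arg_cong2[where f="(*)"]) (simp only: indicator_simps ball atMost_iff scaleR_one)
  moreover have "ereal \<bar>finite_difference m h f x\<bar> \<le> modulus_of_smoothness m n (lp_norm p n) f"
    unfolding modulus_of_smoothness_def
    by (rule SUP_upper2[of "(x, h)"]) (use xh ball in \<open>simp_all only: eq mem_Collect_eq prod.case order_refl, simp\<close>)
  then have "ereal \<bar>finite_difference m h f x\<bar> \<le> 1" using f by (rule order_trans)
  then have "\<bar>finite_difference m h f x\<bar> \<le> 1" by (simp add: one_ereal_def)
  ultimately show "\<bar>finite_difference m h (\<lambda>x. indicator (lp_ball p n) x *\<^sub>R f x) x\<bar> \<le> 1" by (simp only:)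
qed

lemma rate_eq_powr:
  assumes "m \<ge> 3" "n \<ge> 1"
  shows "rate n (m - 1) = real n powr ((real m - 3) / 2) * ln (real n + 1)"
proof -
  have "sqrt (real n) ^ (m - 3) = sqrt (real n) powr real (m - 3)"
    by (rule powr_realpow[symmetric]) (use assms in simp)
  also have "\<dots> = (real n powr (1 / 2)) powr real (m - 3)"
    by (simp only: powr_half_sqrt of_nat_0_le_iff)
  also have "\<dots> = real n powr ((real m - 3) / 2)" unfolding powr_powr using assms by (simp add: of_nat_diff)
  finally show ?thesis using assms by (simp add: rate_def numeral_3_eq_3 numeral_2_eq_2)
qed

theorem corollary5p8:
  fixes m :: nat and p :: real
  assumes "m \<ge> 3" and "2 \<le> p"
  shows "\<exists>C::real. \<forall>n\<ge>1.
           whitney_constant m n (lp_norm p n)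
             \<le> ereal (C * real n powr ((real m - 3) / 2) * ln (real n + 1))"
proof -
  have p1: "p \<ge> 1" and p0: "p > 0" using assms by auto
  have m1: "m \<ge> 1" and m2: "m \<ge> 2" using assms by auto
  obtain C r where C: "C \<ge> 0" "r > 0" "local_whitney p m C r"
    using local_whitney_exists[OF assms(2) m1] by blast
  have "real m / (real m - 1) > 1" using m2 by simp
  then obtain i where i: "1 / r < (real m / (real m - 1)) ^ i" using real_arch_pow by blast
  from mult_strict_left_mono[OF i C(2)] have ri: "1 \<le> r * (real m / (real m - 1)) ^ i" using C(2) by simp
  define C' where "C' = (1 + 2 ^ m) ^ i * (C + 2)"
  show ?thesis
  proof (intro exI[of _ C'] allI impI)
    fix n :: nat assume n: "n \<ge> 1"
    have rate: "1 \<le> 2 * rate n (m - 1)" "rate n (m - 1) \<ge> 0" using rate_bounds(1)[OF n] rate_nonneg by auto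
    have "best_approx m n (lp_norm p n) f \<le> ereal (C' * rate n (m - 1))"
      if f: "continuous_on (lp_ball p n) f" "modulus_of_smoothness m n (lp_norm p n) f \<le> 1" for f
    proof -
      let ?f = "\<lambda>x. indicator (lp_ball p n) x *\<^sub>R f x"
      have W: "smooth_bound p n m 1 1 ?f" by (rule smooth_bound_indicator[OF p1 f(2)])
      from C(3)[unfolded local_whitney_def, rule_format, OF n zero_le_one tame_indicator[OF p0 f(1)] W]
      obtain \<phi> where \<phi>: "\<phi> \<in> polynomials n (m - 1)"
        "\<forall>x\<in>coord_space n. lp_norm p n x \<le> r \<longrightarrow> \<bar>?f x - \<phi> x\<bar> \<le> C * 1 * rate n (m - 1)"
        by (rule bexE)
      have W': "smooth_bound p n m 1 1 (\<lambda>x. ?f x - \<phi> x)"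
        using W finite_difference_polynomial[OF \<phi>(1), of m] m1
        unfolding smooth_bound_def finite_difference_minus by simp
      have near: "\<bar>?f x - \<phi> x\<bar> \<le> (C + 2) * rate n (m - 1)"
        if "x \<in> coord_space n" "lp_norm p n x \<le> r" for x
      proof -
        have "\<bar>?f x - \<phi> x\<bar> \<le> C * 1 * rate n (m - 1)" using \<phi>(2) that by blast
        then show ?thesis using rate(2) by (simp add: distrib_right)
      qed
      have b: "1 \<le> (C + 2) * rate n (m - 1)" "0 \<le> (C + 2) * rate n (m - 1)"
        using rate mult_nonneg_nonneg[OF C(1) rate(2)] unfolding distrib_right by linarith+
      have "\<bar>f x - \<phi> x\<bar> \<le> C' * rate n (m - 1)" if x: "x \<in> lp_ball p n" for x
      proof -
        have "\<bar>?f x - \<phi> x\<bar> \<le> (1 + 2 ^ m) ^ i * ((C + 2) * rate n (m - 1))"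
          by (rule extrapolation[OF p1 m2 W' b near]) (use x ri in \<open>auto simp: mem_lp_ball\<close>)
        then show ?thesis using x by (simp add: C'_def mult.assoc)
      qed
      then have "(SUP x\<in>lp_ball p n. ereal \<bar>f x - \<phi> x\<bar>) \<le> ereal (C' * rate n (m - 1))"
        by (intro SUP_least) simp
      then show ?thesis unfolding best_approx_def by (rule INF_lower2[OF \<phi>(1)])
    qed
    then have "whitney_constant m n (lp_norm p n) \<le> ereal (C' * rate n (m - 1))"
      unfolding whitney_constant_def by (intro SUP_least) simp
    then show "whitney_constant m n (lp_norm p n) \<le> ereal (C' * real n powr ((real m - 3) / 2) * ln (real n + 1))"
      by (simp only: rate_eq_powr[OF assms(1) n] mult.assoc)
  qed
qed

end
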